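(* Let $M$ be a manifold of dimension $4n+3$, let $P$ be a $Q$-structure on $M$ with associated rank $4n$ distribution $\mathcal D$, and let $\Theta^Q\colon P\to \Lambda^2V^*\otimes \frac TV$ be its intrinsic torsion. Then $\mathcal D$ is integrable (in the sense of Frobenius) if and only if $\Theta^Q$ is identically zero. Moreover $\mathcal D$ is a qc structure if and only if $\Theta^Q$ takes values in the $Q$-orbit of $$\omega_1\otimes w_1+\omega_2\otimes w_2+\omega_3\otimes w_3\in \Lambda^2V^*\otimes \tfrac TV .$$
   Context: Fix $n\ge 1$. $T=\mathbb R^{4n+3}=V\oplus W$ with $V=\mathbb R^{4n}$, $W=\mathbb R^3$; $e_1,\dots,e_{4n+3}$ is the standard basis, $e^1,\dots,e^{4n+3}$ the dual basis, $e^{ab}=e^a\wedge e^b$, $w^s=e^{4n+s}$, and $w_s$ is the class of $e_{4n+s}$ in $T/V$ ($s=1,2,3$). Set $\omega_1=\sum_{j=1}^n(e^{4j-3,4j-2}-e^{4j-1,4j})$, $\omega_2=\sum_{j=1}^n(e^{4j-3,4j-1}+e^{4j-2,4j})$, $\omega_3=\sum_{j=1}^n(e^{4j-3,4j}-e^{4j-2,4j-1})$. $Q=\mathrm{GL}(4n,\mathbb R)\times\mathrm{GL}(3,\mathbb R)\ltimes\mathrm{Hom}(\mathbb R^3,\mathbb R^{4n})\subset \mathrm{GL}(T)$ is the stabilizer of the subspace $V\subset T$. For a Lie subgroup $G\subset\mathrm{GL}(T)$ with Lie algebra $\mathfrak g$, a $G$-structure on $M$ is a reduction $P$ to $G$ of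 the bundle of frames $u\colon T\to T_xM$; $\partial_G\colon T^*\otimes\mathfrak g\to\Lambda^2T^*\otimes T$ is the restriction of $e^k\otimes(e^i\otimes e_j)\mapsto e^{ki}\otimes e_j$. The torsion of any connection on $P$, viewed as an equivariant map $P\to\Lambda^2T^*\otimes T$ and projected to $\mathrm{coker}\,\partial_G$, is the intrinsic torsion $\Theta^G$; it does not depend on the connection. For $G=Q$ one has $\mathrm{coker}\,\partial_Q=\Lambda^2V^*\otimes T/V$, the projection being restriction of $2$-forms to $V$ together with $T\to T/V$. The distribution associated to a $Q$-structure $P$ is $\mathcal D_x=u(V)$, $u\in P_x$ (so $Q$-structures are the same as rank $4n$ distributions). A qc structure on a $(4n+3)$-manifold is a rank $4n$ distribution $\mathcal D$ that can locally be written as $\ker\eta_1\cap\ker\eta_2\cap\ker\eta_3$, where the $\eta_s$ are one-forms such that at each point $x$ there is a linear isomorphism $u\colon\mathbb R^{4n}\to\mathcal D_x$ with $d\eta_s(u(e_a),u(e_b))=\omega_s(e_a,e_b)$ for $s=1,2,3$. *)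

theory Defs
  imports "HOL-Analysis.Analysis"
begin

subsection \<open>Smooth maps between Euclidean spaces\<close>

text \<open>Both predicates are meant for open \<open>S\<close> only.\<close>

fun Ck_on :: "nat \<Rightarrow> ('a::euclidean_space \<Rightarrow> 'b::real_normed_vector) \<Rightarrow> 'a set \<Rightarrow> bool" where
  "Ck_on 0 f S \<longleftrightarrow> continuous_on S f"
| "Ck_on (Suc k) f S \<longleftrightarrow>
     (\<forall>x\<in>S. f differentiable (at x)) \<and> (\<forall>v. Ck_on k (\<lambda>x. frechet_derivative f (at x) v) S)"

definition smooth_on :: "('a::euclidean_space \<Rightarrow> 'b::real_normed_vector) \<Rightarrow> 'a set \<Rightarrow> bool" where
  "smooth_on f S \<longleftrightarrow> (\<forall>k. Ck_on k f S)"

subsection \<open>Smooth manifolds\<close>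

text \<open>A manifold is a Hausdorff, second countable type \<open>'m\<close> with a smooth atlas of charts into
  \<open>'e\<close>; its dimension is \<open>DIM('e)\<close>. The atlas need not be maximal. A chart is a pair of its domain
  and its coordinate map; the values of the latter outside the domain are irrelevant.\<close>

type_synonym ('m, 'e) chart = "'m set \<times> ('m \<Rightarrow> 'e)"

abbreviation chart_inv :: "('m, 'e) chart \<Rightarrow> 'e \<Rightarrow> 'm" where
  "chart_inv c \<equiv> inv_into (fst c) (snd c)"

definition is_chart :: "('m::topological_space, 'e::euclidean_space) chart \<Rightarrow> bool" where
  "is_chart c \<longleftrightarrow> open (fst c) \<and> open (snd c ` fst c) \<and>
     homeomorphism (fst c) (snd c ` fst c) (snd c) (chart_inv c)"

definition smooth_atlas ::
  "('m::{t2_space,second_countable_topology}, 'e::euclidean_space) chart set \<Rightarrow> bool" where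
  "smooth_atlas A \<longleftrightarrow> (\<forall>c\<in>A. is_chart c) \<and> (\<Union>c\<in>A. fst c) = UNIV \<and>
     (\<forall>c\<in>A. \<forall>c'\<in>A. smooth_on (snd c' \<circ> chart_inv c) (snd c ` (fst c \<inter> fst c')))"

definition charts_at :: "('m, 'e) chart set \<Rightarrow> 'm \<Rightarrow> ('m, 'e) chart set" where
  "charts_at A x = {c \<in> A. x \<in> fst c}"

subsection \<open>Tangent vectors\<close>

text \<open>A tangent vector at \<open>x\<close> is the family of its coordinate representations in all charts around
  \<open>x\<close>, related by the derivatives of the coordinate changes (and \<open>0\<close> at the other charts). The
  vector space operations are those of the components, so a map into a tangent space is linear
  iff all its components are.\<close>

type_synonym ('m, 'e) tvec = "('m, 'e) chart \<Rightarrow> 'e"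

definition tangent_space ::
  "('m, 'e::euclidean_space) chart set \<Rightarrow> 'm \<Rightarrow> ('m, 'e) tvec set" where
  "tangent_space A x = {v.
     (\<forall>c\<in>charts_at A x. \<forall>c'\<in>charts_at A x.
        v c' = frechet_derivative (snd c' \<circ> chart_inv c) (at (snd c x)) (v c)) \<and>
     (\<forall>c. c \<notin> charts_at A x \<longrightarrow> v c = 0)}"

text \<open>The tangent vector at \<open>x\<close> whose representation in the chart \<open>c\<close> is \<open>\<xi>\<close>.\<close>

definition tvec_of ::
  "('m, 'e::euclidean_space) chart set \<Rightarrow> ('m, 'e) chart \<Rightarrow> 'm \<Rightarrow> 'e \<Rightarrow> ('m, 'e) tvec" where
  "tvec_of A c x \<xi> = (\<lambda>c'. if c' \<in> charts_at A x
      then frechet_derivative (snd c' \<circ> chart_inv c) (at (snd c x)) \<xi> else 0)"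

definition tlinear :: "('v::real_vector \<Rightarrow> ('m, 'e::real_vector) tvec) \<Rightarrow> bool" where
  "tlinear u \<longleftrightarrow> (\<forall>c. linear (\<lambda>t. u t c))"

text \<open>\<open>X\<close> is a smooth family of linear maps from \<open>'v\<close> to the tangent spaces over the open set
  \<open>U\<close>.\<close>

definition smooth_tlinear_on ::
  "('m::topological_space, 'e::euclidean_space) chart set \<Rightarrow> 'm set \<Rightarrow>
     ('m \<Rightarrow> 'v::real_vector \<Rightarrow> ('m, 'e) tvec) \<Rightarrow> bool" where
  "smooth_tlinear_on A U X \<longleftrightarrow> open U \<and>
     (\<forall>y\<in>U. tlinear (X y) \<and> range (X y) \<subseteq> tangent_space A y) \<and>
     (\<forall>c\<in>A. \<forall>v. smooth_on (\<lambda>p. X (chart_inv c p) v c) (snd c ` (fst c \<inter> U)))"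

subsection \<open>Vector-valued functions and one-forms\<close>

text \<open>Differentials and exterior derivatives are computed in one chart around the point; for smooth
  data on a manifold the result does not depend on this chart.\<close>

definition some_chart :: "('m, 'e) chart set \<Rightarrow> 'm \<Rightarrow> ('m, 'e) chart" where
  "some_chart A x = (SOME c. c \<in> charts_at A x)"

definition differential ::
  "('m, 'e::euclidean_space) chart set \<Rightarrow> ('m \<Rightarrow> 'b::real_normed_vector) \<Rightarrow>
     'm \<Rightarrow> ('m, 'e) tvec \<Rightarrow> 'b" where
  "differential A f x v = (let c = some_chart A x in
     frechet_derivative (f \<circ> chart_inv c) (at (snd c x)) (v c))"

definition smooth_one_form_on ::
  "('m::topological_space, 'e::euclidean_space) chart set \<Rightarrow> 'm set \<Rightarrow>
     ('m \<Rightarrow> ('m, 'e) tvec \<Rightarrow> 'b::real_normed_vector) \<Rightarrow> bool" where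
  "smooth_one_form_on A U \<alpha> \<longleftrightarrow> open U \<and>
     (\<forall>c\<in>A. (\<forall>x\<in>fst c \<inter> U. linear (\<lambda>\<xi>. \<alpha> x (tvec_of A c x \<xi>))) \<and>
       (\<forall>\<xi>. smooth_on (\<lambda>p. \<alpha> (chart_inv c p) (tvec_of A c (chart_inv c p) \<xi>))
          (snd c ` (fst c \<inter> U))))"

text \<open>The convention is \<open>d\<alpha>(X,Y) = X(\<alpha>(Y)) - Y(\<alpha>(X)) - \<alpha>([X,Y])\<close>; \<open>F \<xi>\<close> is \<open>\<alpha>\<close> evaluated on the
  coordinate field with constant representation \<open>\<xi>\<close>.\<close>

definition ext_deriv ::
  "('m, 'e::euclidean_space) chart set \<Rightarrow> ('m \<Rightarrow> ('m, 'e) tvec \<Rightarrow> 'b::real_normed_vector) \<Rightarrow>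
     'm \<Rightarrow> ('m, 'e) tvec \<Rightarrow> ('m, 'e) tvec \<Rightarrow> 'b" where
  "ext_deriv A \<alpha> x v w = (let c = some_chart A x;
      F = (\<lambda>\<xi> p. \<alpha> (chart_inv c p) (tvec_of A c (chart_inv c p) \<xi>)) in
     frechet_derivative (F (w c)) (at (snd c x)) (v c)
     - frechet_derivative (F (v c)) (at (snd c x)) (w c))"

subsection \<open>G-structures, connections and torsion\<close>

type_synonym ('t, 'm, 'e) frame = "'t \<Rightarrow> ('m, 'e) tvec"

definition frames ::
  "('m, 'e::euclidean_space) chart set \<Rightarrow> 'm \<Rightarrow> ('t::real_vector, 'm, 'e) frame set" where
  "frames A x = {u. tlinear u \<and> bij_betw u UNIV (tangent_space A x)}"

text \<open>A subbundle of the frame bundle is given by its fibres \<open>P x\<close>.\<close>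

definition local_section ::
  "('m::topological_space, 'e::euclidean_space) chart set \<Rightarrow>
     ('m \<Rightarrow> ('t::real_vector, 'm, 'e) frame set) \<Rightarrow> 'm set \<Rightarrow> ('m \<Rightarrow> ('t, 'm, 'e) frame) \<Rightarrow> bool" where
  "local_section A P U s \<longleftrightarrow> smooth_tlinear_on A U s \<and> (\<forall>y\<in>U. s y \<in> P y)"

definition G_structure ::
  "('m::topological_space, 'e::euclidean_space) chart set \<Rightarrow> ('t \<Rightarrow> 't) set \<Rightarrow>
     ('m \<Rightarrow> ('t::real_vector, 'm, 'e) frame set) \<Rightarrow> bool" where
  "G_structure A G P \<longleftrightarrow> (\<forall>x. P x \<subseteq> frames A x) \<and>
     (\<forall>x. \<exists>U s. x \<in> U \<and> local_section A P U s \<and> (\<forall>y\<in>U. P y = (\<lambda>g. s y \<circ> g) ` G))"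

text \<open>The Lie algebra of a closed subgroup of \<open>GL(T)\<close>, as the tangent space at the identity.\<close>

definition lie_algebra :: "('t \<Rightarrow> 't) set \<Rightarrow> ('t::real_normed_vector \<Rightarrow> 't) set" where
  "lie_algebra G = {B. linear B \<and> (\<exists>\<gamma>::real \<Rightarrow> 't \<Rightarrow> 't. \<gamma> 0 = id \<and> (\<forall>r. \<gamma> r \<in> G) \<and>
     (\<forall>t. ((\<lambda>r. \<gamma> r t) has_vector_derivative B t) (at 0)))}"

text \<open>A connection over the open set \<open>U0\<close>, on the restriction of \<open>P\<close> to \<open>U0\<close>, is given by the
  pull-backs \<open>\<omega> s\<close> of its connection form along all local sections \<open>s\<close> of \<open>P\<close>. If \<open>s' = s g\<close>, then
  \<open>\<omega> s' = Ad(g\<^sup>-\<^sup>1) (\<omega> s) + g\<^sup>-\<^sup>1 dg\<close>. Over \<open>U0 = UNIV\<close> these are the connections on \<open>P\<close>.\<close>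

definition transition :: "('m \<Rightarrow> ('t, 'm, 'e) frame) \<Rightarrow> ('m \<Rightarrow> ('t, 'm, 'e) frame) \<Rightarrow> 'm \<Rightarrow> 't \<Rightarrow> 't" where
  "transition s s' y = inv (s y) \<circ> s' y"

definition connection_on ::
  "('m::topological_space, 'e::euclidean_space) chart set \<Rightarrow> ('t \<Rightarrow> 't) set \<Rightarrow>
     ('m \<Rightarrow> ('t::real_normed_vector, 'm, 'e) frame set) \<Rightarrow> 'm set \<Rightarrow>
     (('m \<Rightarrow> ('t, 'm, 'e) frame) \<Rightarrow> 'm \<Rightarrow> ('m, 'e) tvec \<Rightarrow> 't \<Rightarrow> 't) \<Rightarrow> bool" where
  "connection_on A G P U0 \<omega> \<longleftrightarrow> open U0 \<and>
     (\<forall>U s. local_section A P U s \<longrightarrow>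
        (\<forall>x\<in>U \<inter> U0. \<forall>v\<in>tangent_space A x. \<omega> s x v \<in> lie_algebra G) \<and>
        (\<forall>t. smooth_one_form_on A (U \<inter> U0) (\<lambda>x v. \<omega> s x v t))) \<and>
     (\<forall>U s U' s'. local_section A P U s \<longrightarrow> local_section A P U' s' \<longrightarrow>
        (\<forall>x\<in>U \<inter> U' \<inter> U0. \<forall>v\<in>tangent_space A x. \<forall>t.
           \<omega> s' x v t = inv (transition s s' x)
             (\<omega> s x v (transition s s' x t) + differential A (\<lambda>y. transition s s' y t) x v)))"

text \<open>With \<open>\<theta> = inv (s _)\<close> the coframe of \<open>s\<close>, this is \<open>(d\<theta> + \<omega> \<and> \<theta>)(s a, s b)\<close>; note
  \<open>\<theta>(s a) = a\<close>.\<close>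

definition section_torsion ::
  "('m, 'e::euclidean_space) chart set \<Rightarrow>
     (('m \<Rightarrow> ('t, 'm, 'e) frame) \<Rightarrow> 'm \<Rightarrow> ('m, 'e) tvec \<Rightarrow> 't \<Rightarrow> 't) \<Rightarrow>
     ('m \<Rightarrow> ('t, 'm, 'e) frame) \<Rightarrow> 'm \<Rightarrow> 't::real_normed_vector \<Rightarrow> 't \<Rightarrow> 't" where
  "section_torsion A \<omega> s x a b =
     ext_deriv A (\<lambda>y. inv (s y)) x (s x a) (s x b) + \<omega> s x (s x a) b - \<omega> s x (s x b) a"

text \<open>The value of the torsion, as a map \<open>P \<rightarrow> \<Lambda>\<^sup>2T\<^sup>* \<otimes> T\<close>, at \<open>u \<in> P x\<close>. It is the same for all
  local sections through \<open>u\<close>.\<close>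

definition torsion ::
  "('m::topological_space, 'e::euclidean_space) chart set \<Rightarrow>
     ('m \<Rightarrow> ('t::real_normed_vector, 'm, 'e) frame set) \<Rightarrow>
     (('m \<Rightarrow> ('t, 'm, 'e) frame) \<Rightarrow> 'm \<Rightarrow> ('m, 'e) tvec \<Rightarrow> 't \<Rightarrow> 't) \<Rightarrow>
     'm \<Rightarrow> ('t, 'm, 'e) frame \<Rightarrow> 't \<Rightarrow> 't \<Rightarrow> 't" where
  "torsion A P \<omega> x u = (THE \<tau>. \<forall>U s. local_section A P U s \<longrightarrow> x \<in> U \<longrightarrow> s x = u \<longrightarrow>
     \<tau> = section_torsion A \<omega> s x)"

subsection \<open>The group Q and its intrinsic torsion\<close>

text \<open>\<open>v $ j $ i\<close> is the coordinate of index \<open>4j - 4 + i\<close> of \<open>v\<close> in \<open>V = \<real>\<^sup>4\<^sup>n\<close>, where \<open>j\<close> ranges over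
  the \<open>n\<close> elements of \<open>'n\<close> and \<open>i\<close> over \<open>1, 2, 3, 4\<close>.\<close>

type_synonym 'n V = "real ^ 4 ^ 'n"
type_synonym W = "real ^ 3"
type_synonym 'n T = "(real ^ 4 ^ 'n) \<times> (real ^ 3)"

definition V_sub :: "'n::finite T set" where
  "V_sub = UNIV \<times> {0}"

definition Q_group :: "('n::finite T \<Rightarrow> 'n T) set" where
  "Q_group = {g. linear g \<and> bij g \<and> g ` V_sub = V_sub}"

definition associated_distribution ::
  "('m \<Rightarrow> ('n::finite T, 'm, 'e) frame set) \<Rightarrow> 'm \<Rightarrow> ('m, 'e) tvec set" where
  "associated_distribution P x = (\<Union>u\<in>P x. u ` V_sub)"

text \<open>Elements of \<open>T/V\<close> are represented in \<open>W\<close>, the quotient map being \<open>snd\<close>, so that the class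
  of the \<open>s\<close>-th basis vector of \<open>W \<subset> T\<close> is \<open>axis s 1\<close>. Elements of \<open>\<Lambda>\<^sup>2V\<^sup>* \<otimes> T/V\<close> are alternating
  bilinear maps. The next definition is the projection \<open>\<Lambda>\<^sup>2T\<^sup>* \<otimes> T \<rightarrow> \<Lambda>\<^sup>2V\<^sup>* \<otimes> T/V\<close>.\<close>

definition coker_proj :: "('n::finite T \<Rightarrow> 'n T \<Rightarrow> 'n T) \<Rightarrow> 'n V \<Rightarrow> 'n V \<Rightarrow> W" where
  "coker_proj \<tau> v w = snd (\<tau> (v, 0) (w, 0))"

text \<open>The value depends only on \<open>P\<close> near \<open>x\<close>, so all connections over neighbourhoods of \<open>x\<close> are
  admitted, among them those on the whole of \<open>P\<close>.\<close>

definition intrinsic_torsion ::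
  "('m::topological_space, 'e::euclidean_space) chart set \<Rightarrow>
     ('m \<Rightarrow> ('n::finite T, 'm, 'e) frame set) \<Rightarrow>
     'm \<Rightarrow> ('n T, 'm, 'e) frame \<Rightarrow> 'n V \<Rightarrow> 'n V \<Rightarrow> W" where
  "intrinsic_torsion A P x u = (THE \<Theta>. \<forall>U \<omega>. connection_on A Q_group P U \<omega> \<longrightarrow> x \<in> U \<longrightarrow>
     \<Theta> = coker_proj (torsion A P \<omega> x u))"

text \<open>The action of \<open>Q\<close> on \<open>\<Lambda>\<^sup>2V\<^sup>* \<otimes> T/V\<close> induced by those on \<open>V\<close> and \<open>T/V\<close>.\<close>

definition Q_act :: "('n::finite T \<Rightarrow> 'n T) \<Rightarrow> ('n V \<Rightarrow> 'n V \<Rightarrow> W) \<Rightarrow> 'n V \<Rightarrow> 'n V \<Rightarrow> W" where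
  "Q_act g \<Theta> v w = snd (g (0, \<Theta> (fst (inv g (v, 0))) (fst (inv g (w, 0)))))"

definition Q_orbit :: "('n::finite V \<Rightarrow> 'n V \<Rightarrow> W) \<Rightarrow> ('n V \<Rightarrow> 'n V \<Rightarrow> W) set" where
  "Q_orbit \<Theta> = (\<lambda>g. Q_act g \<Theta>) ` Q_group"

subsection \<open>The model forms\<close>

definition coord_wedge :: "'n::finite \<Rightarrow> 4 \<Rightarrow> 4 \<Rightarrow> 'n V \<Rightarrow> 'n V \<Rightarrow> real" where
  "coord_wedge j a b v w = v $ j $ a * w $ j $ b - v $ j $ b * w $ j $ a"

definition omega1 :: "'n::finite V \<Rightarrow> 'n V \<Rightarrow> real" where
  "omega1 v w = (\<Sum>j\<in>UNIV. coord_wedge j 1 2 v w - coord_wedge j 3 4 v w)"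

definition omega2 :: "'n::finite V \<Rightarrow> 'n V \<Rightarrow> real" where
  "omega2 v w = (\<Sum>j\<in>UNIV. coord_wedge j 1 3 v w + coord_wedge j 2 4 v w)"

definition omega3 :: "'n::finite V \<Rightarrow> 'n V \<Rightarrow> real" where
  "omega3 v w = (\<Sum>j\<in>UNIV. coord_wedge j 1 4 v w - coord_wedge j 2 3 v w)"

definition qc_model :: "'n::finite V \<Rightarrow> 'n V \<Rightarrow> W" where
  "qc_model v w = omega1 v w *\<^sub>R axis 1 1 + omega2 v w *\<^sub>R axis 2 1 + omega3 v w *\<^sub>R axis 3 1"

subsection \<open>Distributions\<close>

text \<open>Smooth distributions of rank \<open>DIM('v)\<close>.\<close>

definition distribution ::
  "'v::euclidean_space itself \<Rightarrow> ('m::topological_space, 'e::euclidean_space) chart set \<Rightarrow>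
     ('m \<Rightarrow> ('m, 'e) tvec set) \<Rightarrow> bool" where
  "distribution _ A D \<longleftrightarrow> (\<forall>x. \<exists>U (X :: 'm \<Rightarrow> 'v \<Rightarrow> ('m, 'e) tvec).
     x \<in> U \<and> smooth_tlinear_on A U X \<and> (\<forall>y\<in>U. bij_betw (X y) UNIV (D y)))"

text \<open>Smooth maps from an open subset of a Euclidean space to the manifold, and their differential.\<close>

definition smooth_into ::
  "('m::topological_space, 'e::euclidean_space) chart set \<Rightarrow> 'v::euclidean_space set \<Rightarrow>
     ('v \<Rightarrow> 'm) \<Rightarrow> bool" where
  "smooth_into A S f \<longleftrightarrow> open S \<and> continuous_on S f \<and>
     (\<forall>c\<in>A. smooth_on (snd c \<circ> f) (S \<inter> f -` fst c))"

definition pushforward ::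
  "('m, 'e::euclidean_space) chart set \<Rightarrow> ('v::euclidean_space \<Rightarrow> 'm) \<Rightarrow> 'v \<Rightarrow> 'v \<Rightarrow> ('m, 'e) tvec" where
  "pushforward A f y h = (\<lambda>c. if c \<in> charts_at A (f y)
      then frechet_derivative (snd c \<circ> f) (at y) h else 0)"

text \<open>Integrability of a distribution of rank \<open>DIM('v)\<close>: every point lies on an integral manifold,
  which is given by a local parametrization.\<close>

definition integrable_distribution ::
  "'v::euclidean_space itself \<Rightarrow> ('m::topological_space, 'e::euclidean_space) chart set \<Rightarrow>
     ('m \<Rightarrow> ('m, 'e) tvec set) \<Rightarrow> bool" where
  "integrable_distribution _ A D \<longleftrightarrow> (\<forall>x. \<exists>(S :: 'v set) f.
     smooth_into A S f \<and> inj_on f S \<and> x \<in> f ` S \<and>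
     (\<forall>y\<in>S. inj (pushforward A f y) \<and> range (pushforward A f y) = D (f y)))"

definition qc_structure ::
  "'n::finite itself \<Rightarrow> ('m::topological_space, 'e::euclidean_space) chart set \<Rightarrow>
     ('m \<Rightarrow> ('m, 'e) tvec set) \<Rightarrow> bool" where
  "qc_structure _ A D \<longleftrightarrow> distribution TYPE('n V) A D \<and>
     (\<forall>p. \<exists>U (\<eta>1 :: 'm \<Rightarrow> ('m, 'e) tvec \<Rightarrow> real) \<eta>2 \<eta>3. p \<in> U \<and>
        smooth_one_form_on A U \<eta>1 \<and> smooth_one_form_on A U \<eta>2 \<and> smooth_one_form_on A U \<eta>3 \<and>
        (\<forall>x\<in>U. D x = {v \<in> tangent_space A x. \<eta>1 x v = 0 \<and> \<eta>2 x v = 0 \<and> \<eta>3 x v = 0} \<and>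
          (\<exists>u :: 'n V \<Rightarrow> ('m, 'e) tvec. tlinear u \<and> bij_betw u UNIV (D x) \<and>
             (\<forall>a\<in>Basis. \<forall>b\<in>Basis.
                ext_deriv A \<eta>1 x (u a) (u b) = omega1 a b \<and>
                ext_deriv A \<eta>2 x (u a) (u b) = omega2 a b \<and>
                ext_deriv A \<eta>3 x (u a) (u b) = omega3 a b))))"

end

theory Submission
  imports Defs
begin

text \<open>For a local section \<open>s\<close> of \<open>P\<close> with coframe \<open>\<theta> = inv (s _)\<close>, the connection terms of the torsion
  take values in the Lie algebra of \<open>Q\<close> and drop out in \<open>\<Lambda>\<^sup>2V\<^sup>* \<otimes> T/V\<close>; the intrinsic torsion is the
  restriction of \<open>d(snd \<circ> \<theta>)\<close> to the distribution.

  Its vanishing is the integrability condition of the Frobenius theorem. Writing the distribution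
  locally as a field of graphs \<open>L(a, b)\<close>, an integral manifold is the graph of a solution of
  \<open>D\<phi>(a) = L(a, \<phi>(a))\<close>; a continuous solution of the equation along rays is found with Banach's fixed
  point theorem, involutivity shows that it is differentiable with the required derivative, and it is
  then smooth because the equation bootstraps.

  A triple of one-forms defining the distribution has the form \<open>C \<circ> snd \<circ> \<theta>\<close> with \<open>C\<close> invertible, and
  its exterior derivative on the distribution is \<open>C\<close> applied to the intrinsic torsion. Hence qc
  structures have torsion in the orbit of the model. For the converse, \<open>C\<close> has to be chosen smoothly:
  traces of products of the endomorphisms that relate the components of the torsion recover a
  conformal metric on \<open>T/V\<close>, and a smooth orthonormal frame for it, suitably oriented, is a
  valid choice.\<close>

subsection \<open>Calculus of smooth maps\<close>

text \<open>Two features of the definitions shape the proof. \<open>intrinsic_torsion\<close> is a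
  definite description over all connections near \<open>x\<close>, so besides independence of the
  connection one has to be exhibited: otherwise every value would satisfy the description. A section
  declared parallel provides one over its own domain. Membership in the orbit is pointwise: at each
  point it yields some \<kappa> and some \<open>D\<close>, which may jump from point to point. In a
  qc structure, however, only the one-forms must be smooth, while the frame \<open>u\<close> of the
  distribution is chosen point by point; so only the action on \<open>T/V\<close> calls for a smooth
  choice. The stabilizer of the model acts on \<open>T/V\<close> by positive multiples of rotations,
  which is why a conformal metric and an orientation are exactly the data to be recovered. The scale
  is fixed by giving \<open>axis 1 1\<close> length one; the resulting factor is absorbed in
  \<kappa>, in which the forms are quadratic. The sign of a product of three endomorphisms detects
  the orientation.\<close>

lemma Ck_on_cong:
  assumes "open S" "\<And>x. x \<in> S \<Longrightarrow> f x = g x" "Ck_on k f S"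
  shows "Ck_on k g S"
  using assms(2,3)
proof (induction k arbitrary: f g)
  case 0
  then show ?case by (simp cong: continuous_on_cong)
next
  case (Suc k)
  have d: "(g has_derivative frechet_derivative f (at x)) (at x)" if "x \<in> S" for x
  proof -
    have "(f has_derivative frechet_derivative f (at x)) (at x)"
      using Suc.prems(2) that by (simp add: frechet_derivative_works)
    then show ?thesis
      by (rule has_derivative_transform_within_open[OF _ assms(1) that]) (use Suc.prems(1) in auto)
  qed
  then have e: "frechet_derivative g (at x) = frechet_derivative f (at x)" if "x \<in> S" for x
    using frechet_derivative_at that by metis
  have "Ck_on k (\<lambda>x. frechet_derivative g (at x) v) S" for v
    by (rule Suc.IH[of "\<lambda>x. frechet_derivative f (at x) v"]) (use e Suc.prems(2) in auto)
  with d show ?case by (auto simp: differentiable_def)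
qed

text \<open>\<open>Ck_on\<close> speaks of \<open>frechet_derivative\<close>; this rule accepts any
  explicit derivative formula instead. Most regularity proofs below are inductions in which that
  formula is seen to be C^k again.\<close>

lemma Ck_on_SucI:
  assumes "open S" "\<And>x. x \<in> S \<Longrightarrow> (f has_derivative f' x) (at x)"
    "\<And>v. Ck_on k (\<lambda>x. f' x v) S"
  shows "Ck_on (Suc k) f S"
proof -
  have "Ck_on k (\<lambda>x. frechet_derivative f (at x) v) S" for v
    by (rule Ck_on_cong[OF assms(1) _ assms(3)[of v]]) (metis assms(2) frechet_derivative_at)
  with assms(2) show ?thesis by (auto simp: differentiable_def)
qed

lemma Ck_on_subset: "Ck_on k f T \<Longrightarrow> S \<subseteq> T \<Longrightarrow> Ck_on k f S"
  by (induction k arbitrary: f) (auto intro: continuous_on_subset)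

lemma Ck_on_continuous: "Ck_on k f S \<Longrightarrow> continuous_on S f"
proof (cases k)
  case (Suc l)
  then show "Ck_on k f S \<Longrightarrow> continuous_on S f"
    by (auto intro!: differentiable_imp_continuous_on differentiable_at_imp_differentiable_on)
qed auto

lemma Ck_on_Suc_imp: "Ck_on (Suc k) f S \<Longrightarrow> Ck_on k f S"
proof (induction k arbitrary: f)
  case 0
  then show ?case using Ck_on_continuous[OF 0] by simp
next
  case (Suc k)
  then show ?case by (subst Ck_on.simps, subst (asm) Ck_on.simps) blast
qed

lemma Ck_on_const: "open S \<Longrightarrow> Ck_on k (\<lambda>x. c) S"
proof (induction k arbitrary: c)
  case (Suc k)
  show ?case by (rule Ck_on_SucI[where f' = "\<lambda>x v. 0"]) (use Suc in auto)
qed simp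

lemma Ck_on_linear:
  assumes "open S" "bounded_linear h"
  shows "Ck_on k h S"
proof (cases k)
  case 0
  then show ?thesis using assms by (simp add: bounded_linear.linear linear_continuous_on)
next
  case (Suc l)
  show ?thesis unfolding Suc
    by (rule Ck_on_SucI[where f' = "\<lambda>x. h"])
      (use assms in \<open>auto intro: bounded_linear_imp_has_derivative Ck_on_const\<close>)
qed

lemma Ck_on_compose_linear:
  assumes "open S" "bounded_linear h" "Ck_on k f S"
  shows "Ck_on k (\<lambda>x. h (f x)) S"
  using assms(3)
proof (induction k arbitrary: f)
  case 0
  then show ?case using assms(2) by (auto intro: continuous_on_compose2[OF linear_continuous_on])
next
  case (Suc k)
  show ?case
  proof (rule Ck_on_SucI[OF assms(1)])
    fix x assume "x \<in> S"
    then have "(f has_derivative frechet_derivative f (at x)) (at x)"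
      using Suc.prems by (simp add: frechet_derivative_works)
    then show "((\<lambda>x. h (f x)) has_derivative (\<lambda>v. h (frechet_derivative f (at x) v))) (at x)"
      using bounded_linear.has_derivative[OF assms(2)] by blast
  next
    fix v show "Ck_on k (\<lambda>x. h (frechet_derivative f (at x) v)) S"
      using Suc by auto
  qed
qed

lemma Ck_on_add:
  assumes "open S" "Ck_on k f S" "Ck_on k g S"
  shows "Ck_on k (\<lambda>x. f x + g x) S"
  using assms(2,3)
proof (induction k arbitrary: f g)
  case (Suc k)
  show ?case
    by (rule Ck_on_SucI[OF assms(1), where
          f' = "\<lambda>x v. frechet_derivative f (at x) v + frechet_derivative g (at x) v"])
      (use Suc in \<open>auto intro!: has_derivative_add simp: frechet_derivative_works\<close>)
qed (auto intro: continuous_intros)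

lemma Ck_on_sum:
  assumes "open S" "\<And>i. i \<in> I \<Longrightarrow> Ck_on k (f i) S"
  shows "Ck_on k (\<lambda>x. \<Sum>i\<in>I. f i x) S"
  using assms(2)
  by (induction I rule: infinite_finite_induct) (auto intro: Ck_on_add Ck_on_const assms(1))

lemma Ck_on_bilinear:
  assumes "open S" "bounded_bilinear h" "Ck_on k f S" "Ck_on k g S"
  shows "Ck_on k (\<lambda>x. h (f x) (g x)) S"
  using assms(3,4)
proof (induction k arbitrary: f g)
  case 0
  then show ?case using bounded_bilinear.continuous_on[OF assms(2)] by auto
next
  case (Suc k)
  show ?case
  proof (rule Ck_on_SucI[OF assms(1)])
    fix x assume "x \<in> S"
    then show "((\<lambda>x. h (f x) (g x)) has_derivative
        (\<lambda>v. h (f x) (frechet_derivative g (at x) v) + h (frechet_derivative f (at x) v) (g x))) (at x)"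
      using Suc.prems by (intro bounded_bilinear.FDERIV[OF assms(2)]) (auto simp: frechet_derivative_works)
  next
    fix v
    show "Ck_on k (\<lambda>x. h (f x) (frechet_derivative g (at x) v) +
        h (frechet_derivative f (at x) v) (g x)) S"
      using Suc.prems Ck_on_Suc_imp[OF Suc.prems(1)] Ck_on_Suc_imp[OF Suc.prems(2)]
      by (auto intro!: Ck_on_add assms(1) Suc.IH)
  qed
qed

lemma linear_euclidean_expansion:
  fixes f :: "'a::euclidean_space \<Rightarrow> 'b::real_vector"
  assumes "linear f"
  shows "f v = (\<Sum>b\<in>Basis. (v \<bullet> b) *\<^sub>R f b)"
proof -
  have "f v = f (\<Sum>b\<in>Basis. (v \<bullet> b) *\<^sub>R b)" by (simp add: euclidean_representation)
  also have "\<dots> = (\<Sum>b\<in>Basis. (v \<bullet> b) *\<^sub>R f b)"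
    by (simp add: linear_sum[OF assms] linear_scale[OF assms])
  finally show ?thesis .
qed

lemma linear_frechet_derivative:
  "f differentiable at x \<Longrightarrow> linear (frechet_derivative f (at x))"
  by (simp add: frechet_derivative_works has_derivative_linear)

lemma Ck_on_scaleR:
  "open S \<Longrightarrow> Ck_on k f S \<Longrightarrow> Ck_on k g S \<Longrightarrow> Ck_on k (\<lambda>x. f x *\<^sub>R g x) S"
  by (rule Ck_on_bilinear[OF _ bounded_bilinear_scaleR])

lemma Ck_on_inner_left:
  "open S \<Longrightarrow> Ck_on k f S \<Longrightarrow> Ck_on k (\<lambda>x. f x \<bullet> b) S"
  by (rule Ck_on_compose_linear[OF _ bounded_linear_inner_left])

text \<open>Families of linear maps are kept as functions and tested on one fixed argument at a
  time. Expanding \<open>Y x\<close> in the standard basis shows that in finite dimension this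
  suffices for a moving argument as well.\<close>

lemma Ck_on_apply:
  fixes M :: "'a::euclidean_space \<Rightarrow> 'b::euclidean_space \<Rightarrow> 'c::real_normed_vector"
  assumes "open S" "\<And>x. x \<in> S \<Longrightarrow> linear (M x)" "\<And>b. Ck_on k (\<lambda>x. M x b) S" "Ck_on k Y S"
  shows "Ck_on k (\<lambda>x. M x (Y x)) S"
proof (rule Ck_on_cong[OF assms(1)])
  show "Ck_on k (\<lambda>x. \<Sum>b\<in>Basis. (Y x \<bullet> b) *\<^sub>R M x b) S"
    by (intro Ck_on_sum Ck_on_scaleR Ck_on_inner_left assms)
  show "(\<Sum>b\<in>Basis. (Y x \<bullet> b) *\<^sub>R M x b) = M x (Y x)" if "x \<in> S" for x
    by (simp add: linear_euclidean_expansion[OF assms(2)[OF that], of "Y x"])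
qed

lemma Ck_on_compose:
  fixes f :: "'a::euclidean_space \<Rightarrow> 'b::euclidean_space"
  assumes "open S" "open T" "f ` S \<subseteq> T" "Ck_on k f S" "Ck_on k g T"
  shows "Ck_on k (\<lambda>x. g (f x)) S"
  using assms(4,5)
proof (induction k arbitrary: g)
  case 0
  then show ?case using assms(3) by (auto intro: continuous_on_compose2)
next
  case (Suc k)
  have gd: "g differentiable at (f x)" if "x \<in> S" for x
    using that Suc.prems(2) assms(3) by auto
  show ?case
  proof (rule Ck_on_SucI[OF assms(1)])
    fix x assume "x \<in> S"
    then show "((\<lambda>x. g (f x)) has_derivative
        (\<lambda>v. frechet_derivative g (at (f x)) (frechet_derivative f (at x) v))) (at x)"
      using gd Suc.prems(1)
      by (intro has_derivative_compose[of f "frechet_derivative f (at x)" x UNIV g])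
        (auto simp: frechet_derivative_works)
  next
    fix v
    show "Ck_on k (\<lambda>x. frechet_derivative g (at (f x)) (frechet_derivative f (at x) v)) S"
    proof (rule Ck_on_apply[OF assms(1)])
      show "Ck_on k (\<lambda>x. frechet_derivative g (at (f x)) b) S" for b
        by (rule Suc.IH) (use Suc.prems Ck_on_Suc_imp[OF Suc.prems(1)] in auto)
    qed (use gd linear_frechet_derivative Suc.prems(1) in auto)
  qed
qed

lemma smooth_on_cong:
  "open S \<Longrightarrow> smooth_on f S \<Longrightarrow> (\<And>x. x \<in> S \<Longrightarrow> f x = g x) \<Longrightarrow> smooth_on g S"
  unfolding smooth_on_def by (intro allI, rule Ck_on_cong[of S f g]) auto

lemma smooth_on_subset: "smooth_on f T \<Longrightarrow> S \<subseteq> T \<Longrightarrow> smooth_on f S"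
  unfolding smooth_on_def by (blast intro: Ck_on_subset)

lemma smooth_on_continuous: "smooth_on f S \<Longrightarrow> continuous_on S f"
  unfolding smooth_on_def by (drule spec[of _ 0]) simp

lemma smooth_on_differentiable: "smooth_on f S \<Longrightarrow> x \<in> S \<Longrightarrow> f differentiable at x"
  unfolding smooth_on_def by (drule spec[of _ "Suc 0"]) simp

lemma smooth_on_has_derivative:
  "smooth_on f S \<Longrightarrow> x \<in> S \<Longrightarrow> (f has_derivative frechet_derivative f (at x)) (at x)"
  using smooth_on_differentiable[of f S x] by (simp add: frechet_derivative_works)

lemma smooth_on_frechet_derivative:
  "smooth_on f S \<Longrightarrow> smooth_on (\<lambda>x. frechet_derivative f (at x) v) S"
  unfolding smooth_on_def by (intro allI, drule_tac x = "Suc k" in spec) simp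

lemma smooth_on_const [simp]: "open S \<Longrightarrow> smooth_on (\<lambda>x. c) S"
  by (simp add: smooth_on_def Ck_on_const)

lemma smooth_on_linear: "open S \<Longrightarrow> bounded_linear h \<Longrightarrow> smooth_on h S"
  by (simp add: smooth_on_def Ck_on_linear)

lemma smooth_on_compose_linear:
  "open S \<Longrightarrow> bounded_linear h \<Longrightarrow> smooth_on f S \<Longrightarrow> smooth_on (\<lambda>x. h (f x)) S"
  by (simp add: smooth_on_def Ck_on_compose_linear)

lemma smooth_on_add:
  "open S \<Longrightarrow> smooth_on f S \<Longrightarrow> smooth_on g S \<Longrightarrow> smooth_on (\<lambda>x. f x + g x) S"
  by (simp add: smooth_on_def Ck_on_add)

lemma smooth_on_sum:
  "open S \<Longrightarrow> (\<And>i. i \<in> I \<Longrightarrow> smooth_on (f i) S) \<Longrightarrow> smooth_on (\<lambda>x. \<Sum>i\<in>I. f i x) S"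
  by (simp add: smooth_on_def Ck_on_sum)

lemma smooth_on_bilinear:
  "open S \<Longrightarrow> bounded_bilinear h \<Longrightarrow> smooth_on f S \<Longrightarrow> smooth_on g S \<Longrightarrow>
    smooth_on (\<lambda>x. h (f x) (g x)) S"
  by (simp add: smooth_on_def Ck_on_bilinear)

lemmas smooth_on_scaleR = smooth_on_bilinear[OF _ bounded_bilinear_scaleR]
lemmas smooth_on_mult = smooth_on_bilinear[OF _ bounded_bilinear_mult]
lemmas smooth_on_inner = smooth_on_bilinear[OF _ bounded_bilinear_inner]
lemmas smooth_on_minus = smooth_on_compose_linear[OF _ bounded_linear_minus[OF bounded_linear_ident]]

lemma smooth_on_diff:
  "open S \<Longrightarrow> smooth_on f S \<Longrightarrow> smooth_on g S \<Longrightarrow> smooth_on (\<lambda>x. f x - g x) S"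
  unfolding diff_conv_add_uminus by (rule smooth_on_add[OF _ _ smooth_on_minus])

lemma smooth_on_apply:
  fixes M :: "'a::euclidean_space \<Rightarrow> 'b::euclidean_space \<Rightarrow> 'c::real_normed_vector"
  assumes "open S" "\<And>x. x \<in> S \<Longrightarrow> linear (M x)" "\<And>b. smooth_on (\<lambda>x. M x b) S" "smooth_on Y S"
  shows "smooth_on (\<lambda>x. M x (Y x)) S"
  unfolding smooth_on_def
  by (rule allI, rule Ck_on_apply[OF assms(1,2)]) (use assms(3,4) in \<open>auto simp: smooth_on_def\<close>)

lemma smooth_on_compose:
  fixes f :: "'a::euclidean_space \<Rightarrow> 'b::euclidean_space"
  shows "open S \<Longrightarrow> open T \<Longrightarrow> f ` S \<subseteq> T \<Longrightarrow> smooth_on f S \<Longrightarrow> smooth_on g T \<Longrightarrow>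
    smooth_on (\<lambda>x. g (f x)) S"
  unfolding smooth_on_def by (intro allI, rule Ck_on_compose[of S T f _ g]) auto

section \<open>Derivatives of families of linear maps\<close>

lemma linear_derivative_family:
  assumes "open S" "x \<in> S" "\<And>y. y \<in> S \<Longrightarrow> linear (M y)"
    "\<And>b. ((\<lambda>y. M y b) has_derivative M' b) (at x)"
  shows "linear (\<lambda>b. M' b v)"
proof
  fix b c and r :: real
  have "((\<lambda>y. M y (b + c)) has_derivative (\<lambda>v. M' b v + M' c v)) (at x)"
    by (rule has_derivative_transform_within_open[OF has_derivative_add[OF assms(4)[of b] assms(4)[of c]]
          assms(1,2)]) (simp add: assms(3) linear_add)
  from has_derivative_unique[OF assms(4) this] show "M' (b + c) v = M' b v + M' c v" by simp
  have "((\<lambda>y. M y (r *\<^sub>R b)) has_derivative (\<lambda>v. r *\<^sub>R M' b v)) (at x)"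
    by (rule has_derivative_transform_within_open[OF has_derivative_scaleR_right[OF assms(4)[of b]]
          assms(1,2)]) (simp add: assms(3) linear_scale)
  from has_derivative_unique[OF assms(4) this] show "M' (r *\<^sub>R b) v = r *\<^sub>R M' b v" by simp
qed

lemma has_derivative_apply:
  fixes M :: "'a::real_normed_vector \<Rightarrow> 'b::euclidean_space \<Rightarrow> 'c::real_normed_vector"
  assumes "open S" "x \<in> S" "\<And>y. y \<in> S \<Longrightarrow> linear (M y)"
    "\<And>b. ((\<lambda>y. M y b) has_derivative M' b) (at x)" "(Y has_derivative Y') (at x)"
  shows "((\<lambda>y. M y (Y y)) has_derivative (\<lambda>v. M' (Y x) v + M x (Y' v))) (at x)"
proof -
  have lin: "linear (\<lambda>b. M' b v)" for v
    by (rule linear_derivative_family[OF assms(1-4)])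
  have "((\<lambda>y. \<Sum>b\<in>Basis. (Y y \<bullet> b) *\<^sub>R M y b) has_derivative
      (\<lambda>v. \<Sum>b\<in>Basis. (Y x \<bullet> b) *\<^sub>R M' b v + (Y' v \<bullet> b) *\<^sub>R M x b)) (at x)"
    by (auto intro!: derivative_eq_intros assms(4,5))
  then have "((\<lambda>y. M y (Y y)) has_derivative
      (\<lambda>v. \<Sum>b\<in>Basis. (Y x \<bullet> b) *\<^sub>R M' b v + (Y' v \<bullet> b) *\<^sub>R M x b)) (at x)"
    by (rule has_derivative_transform_within_open[OF _ assms(1,2)])
      (simp add: linear_euclidean_expansion[OF assms(3), symmetric])
  moreover have "(\<lambda>v. \<Sum>b\<in>Basis. (Y x \<bullet> b) *\<^sub>R M' b v + (Y' v \<bullet> b) *\<^sub>R M x b) =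
      (\<lambda>v. M' (Y x) v + M x (Y' v))"
    by (simp only: sum.distrib linear_euclidean_expansion[OF lin, of "Y x", symmetric]
        linear_euclidean_expansion[OF assms(3)[OF assms(2)], symmetric])
  ultimately show ?thesis by simp
qed

text \<open>The derivative is a polynomial in \<open>inverse\<close> itself, so one order of
  regularity gives the next.\<close>

lemma Ck_on_inverse: "open S \<Longrightarrow> 0 \<notin> S \<Longrightarrow> Ck_on k (inverse :: real \<Rightarrow> real) S"
proof (induction k)
  case 0
  then show ?case by (auto intro: continuous_intros)
next
  case (Suc k)
  show ?case
  proof (rule Ck_on_SucI[OF Suc.prems(1), where f' = "\<lambda>x v. - (inverse x * v * inverse x)"])
    show "Ck_on k (\<lambda>x. - (inverse x * v * inverse x)) S" for v :: real
      using Suc by (intro Ck_on_compose_linear[OF _ bounded_linear_minus[OF bounded_linear_ident]]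
          Ck_on_bilinear[OF _ bounded_bilinear_mult] Ck_on_const) auto
    show "(inverse has_derivative (\<lambda>v. - (inverse x * v * inverse x))) (at x)" if "x \<in> S" for x :: real
      using that Suc.prems(2) by (intro has_derivative_inverse') auto
  qed
qed

lemma Ck_on_sqrt: "open S \<Longrightarrow> S \<subseteq> {0<..} \<Longrightarrow> Ck_on k sqrt S"
proof (induction k)
  case 0
  then show ?case by (auto intro: continuous_intros)
next
  case (Suc k)
  show ?case
  proof (rule Ck_on_SucI[OF Suc.prems(1), where f' = "\<lambda>x v. v * (inverse (sqrt x) / 2)"])
    have "Ck_on k (\<lambda>x. inverse (sqrt x)) S"
      by (rule Ck_on_compose[where T = "{0<..}"]) (use Suc in \<open>auto intro: Ck_on_inverse\<close>)
    then show "Ck_on k (\<lambda>x. v * (inverse (sqrt x) / 2)) S" for v :: real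
      using Suc by (intro Ck_on_bilinear[OF _ bounded_bilinear_mult] Ck_on_const
          Ck_on_compose_linear[OF _ bounded_linear_divide]) auto
    show "(sqrt has_derivative (\<lambda>v. v * (inverse (sqrt x) / 2))) (at x)" if "x \<in> S" for x
      by (rule has_derivative_eq_rhs[OF DERIV_real_sqrt[of x, unfolded has_field_derivative_def]])
        (use that Suc.prems(2) in \<open>auto simp: fun_eq_iff\<close>)
  qed
qed

lemma smooth_on_inverse:
  fixes f :: "'a::euclidean_space \<Rightarrow> real"
  assumes "open S" "smooth_on f S" "\<And>x. x \<in> S \<Longrightarrow> f x \<noteq> 0"
  shows "smooth_on (\<lambda>x. inverse (f x)) S"
  by (rule smooth_on_compose[where T = "- {0}" and g = inverse])
    (use assms in \<open>auto simp: smooth_on_def intro: Ck_on_inverse\<close>)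

lemma smooth_on_sqrt:
  fixes f :: "'a::euclidean_space \<Rightarrow> real"
  assumes "open S" "smooth_on f S" "\<And>x. x \<in> S \<Longrightarrow> f x > 0"
  shows "smooth_on (\<lambda>x. sqrt (f x)) S"
  by (rule smooth_on_compose[where T = "{0<..}" and g = sqrt])
    (use assms in \<open>auto simp: smooth_on_def intro: Ck_on_sqrt\<close>)

text \<open>A product rule with one factor merely continuous: at a zero of \<open>u\<close> the
  derivative of \<open>k\<close> would have coefficient zero. In
  \<open>has_derivative_inv_family\<close>, \<open>k\<close> is an inverse whose differentiability
  is still to be proved.\<close>

lemma has_derivative_scaleR_zero:
  fixes u :: "'a::real_normed_vector \<Rightarrow> real" and k :: "'a \<Rightarrow> 'b::real_normed_vector"
  assumes "(u has_derivative u') (at x)" "u x = 0" "isCont k x"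
  shows "((\<lambda>y. u y *\<^sub>R k y) has_derivative (\<lambda>v. u' v *\<^sub>R k x)) (at x)"
  unfolding has_derivative_at_alt
proof (intro conjI allI impI)
  have bl: "bounded_linear u'" using assms(1) has_derivative_bounded_linear by blast
  then show "bounded_linear (\<lambda>v. u' v *\<^sub>R k x)" by (rule bounded_linear_scaleR_const)
  fix e :: real assume e: "e > 0"
  obtain U where U: "U > 0" "\<And>v. norm (u' v) \<le> norm v * U"
    using bounded_linear.pos_bounded[OF bl] by blast
  \<comment> \<open>Half of \<open>e\<close> pays for the error of \<open>u\<close>, where
    \<open>norm (k y)\<close> is at most \<open>norm (k x) + 1\<close> because \<open>e2\<close> is
    at most 1; the other half pays for the oscillation of \<open>k\<close>.\<close>
  define e1 where "e1 = e / (2 * (norm (k x) + 1))"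
  define e2 where "e2 = min 1 (e / (2 * U))"
  have pos: "e1 > 0" "e2 > 0" using e U(1) by (auto simp: e1_def e2_def add_nonneg_pos)
  obtain d1 where d1: "d1 > 0"
    "\<And>y. norm (y - x) < d1 \<Longrightarrow> norm (u y - u x - u' (y - x)) \<le> e1 * norm (y - x)"
    using assms(1) pos(1) unfolding has_derivative_at_alt by blast
  obtain d2 where d2: "d2 > 0" "\<And>y. norm (y - x) < d2 \<Longrightarrow> norm (k y - k x) < e2"
    using assms(3) pos(2) unfolding continuous_at_eps_delta dist_norm by blast
  show "\<exists>d>0. \<forall>y. norm (y - x) < d \<longrightarrow>
      norm (u y *\<^sub>R k y - u x *\<^sub>R k x - u' (y - x) *\<^sub>R k x) \<le> e * norm (y - x)"
  proof (intro exI[of _ "min d1 d2"] conjI allI impI)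
    fix y assume y: "norm (y - x) < min d1 d2"
    have "u y *\<^sub>R k y - u x *\<^sub>R k x - u' (y - x) *\<^sub>R k x =
        (u y - u x - u' (y - x)) *\<^sub>R k y + u' (y - x) *\<^sub>R (k y - k x)"
      by (simp add: assms(2) algebra_simps)
    also have "norm \<dots> \<le> norm (u y - u x - u' (y - x)) * norm (k y) + norm (u' (y - x)) * norm (k y - k x)"
      by (intro order_trans[OF norm_triangle_ineq] add_mono) auto
    also have "\<dots> \<le> (e1 * norm (y - x)) * (norm (k x) + 1) + (norm (y - x) * U) * (e / (2 * U))"
    proof (intro add_mono mult_mono)
      have "norm (k y - k x) < e2" using d2(2) y by simp
      then show "norm (k y) \<le> norm (k x) + 1" "norm (k y - k x) \<le> e / (2 * U)"
        using norm_triangle_ineq2[of "k y" "k x"] by (auto simp: e2_def)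
    qed (use d1(2) y U e pos in auto)
    also have "\<dots> = e * norm (y - x)"
    proof -
      have "norm (k x) + 1 \<noteq> 0" by (metis add_nonneg_pos less_irrefl norm_ge_zero zero_less_one)
      then show ?thesis using U(1) by (simp add: e1_def field_simps)
    qed
    finally show "norm (u y *\<^sub>R k y - u x *\<^sub>R k x - u' (y - x) *\<^sub>R k x) \<le> e * norm (y - x)" .
  qed (use d1 d2 in auto)
qed

section \<open>Inverses of families of linear maps\<close>

lemma linear_family_bounded_below:
  fixes M :: "'a::euclidean_space \<Rightarrow> 'b::euclidean_space \<Rightarrow> 'c::euclidean_space"
  assumes S: "open S" and lin: "\<And>x. x \<in> S \<Longrightarrow> linear (M x)"
    and cont: "\<And>b. continuous_on S (\<lambda>x. M x b)" and x: "x \<in> S" and inj: "inj (M x)"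
  shows "\<exists>B>0. eventually (\<lambda>y. \<forall>v. B * norm v \<le> norm (M y v)) (nhds x)"
proof -
  obtain B where B: "B > 0" "\<And>v. B * norm v \<le> norm (M x v)"
    using linear_inj_bounded_below_pos[OF lin[OF x] inj] by auto
  have "((\<lambda>y. \<Sum>b\<in>Basis. norm (M y b - M x b)) \<longlongrightarrow> (\<Sum>b\<in>Basis. norm (M x b - M x b))) (nhds x)"
    using cont x S
    by (intro tendsto_sum tendsto_norm tendsto_diff tendsto_const)
      (auto simp: continuous_on_eq_continuous_at isCont_def tendsto_nhds_iff)
  \<comment> \<open>A perturbation smaller than half of the lower bound \<open>B\<close> at
    \<open>x\<close> leaves the lower bound \<open>B / 2\<close>. This yields injectivity near
    \<open>x\<close> and, later, local boundedness of the inverses.\<close>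
  then have "eventually (\<lambda>y. (\<Sum>b\<in>Basis. norm (M y b - M x b)) < B / 2) (nhds x)"
    using B(1) by (intro order_tendstoD) auto
  moreover have "eventually (\<lambda>y. y \<in> S) (nhds x)"
    using eventually_nhds S x by blast
  ultimately have "eventually (\<lambda>y. \<forall>v. B / 2 * norm v \<le> norm (M y v)) (nhds x)"
  proof eventually_elim
    case (elim y)
    have "B / 2 * norm v \<le> norm (M y v)" for v
    proof -
      have "M y v - M x v = (\<Sum>b\<in>Basis. (v \<bullet> b) *\<^sub>R (M y b - M x b))"
        by (simp add: linear_euclidean_expansion[OF lin[OF elim(2)], of v]
            linear_euclidean_expansion[OF lin[OF x], of v] scaleR_diff_right sum_subtractf)
      also have "norm \<dots> \<le> (\<Sum>b\<in>Basis. norm v * norm (M y b - M x b))"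
        by (rule sum_norm_le) (simp add: Basis_le_norm mult_right_mono)
      also have "\<dots> \<le> norm v * (B / 2)"
        unfolding sum_distrib_left[symmetric] by (rule mult_left_mono) (use elim in auto)
      finally show ?thesis
        using B(2)[of v] norm_triangle_ineq2[of "M x v" "M y v"]
        by (simp add: norm_minus_commute mult.commute)
    qed
    then show ?case by blast
  qed
  then show ?thesis using B(1) by (intro exI[of _ "B / 2"]) auto
qed

lemma linear_family_inj_nhd:
  fixes M :: "'a::euclidean_space \<Rightarrow> 'b::euclidean_space \<Rightarrow> 'c::euclidean_space"
  assumes S: "open S" and lin: "\<And>x. x \<in> S \<Longrightarrow> linear (M x)"
    and cont: "\<And>b. continuous_on S (\<lambda>x. M x b)" and x: "x \<in> S" and inj: "inj (M x)"
  obtains U where "open U" "x \<in> U" "U \<subseteq> S" "\<And>y. y \<in> U \<Longrightarrow> inj (M y)"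
proof -
  obtain B U where B: "B > 0" and U: "open U" "x \<in> U" "\<And>y v. y \<in> U \<Longrightarrow> B * norm v \<le> norm (M y v)"
    using linear_family_bounded_below[OF assms] unfolding eventually_nhds by metis
  have "inj (M y)" if "y \<in> U \<inter> S" for y
  proof -
    have "v = 0" if "M y v = 0" for v
      using U(3)[of y v] \<open>y \<in> U \<inter> S\<close> B that by (simp add: mult_le_0_iff)
    then show ?thesis using linear_injective_0[OF lin[of y]] that by blast
  qed
  then show thesis using that[of "U \<inter> S"] U S x by blast
qed

context
  fixes M :: "'a::euclidean_space \<Rightarrow> 'b::euclidean_space \<Rightarrow> 'c::euclidean_space" and S
  assumes S: "open S"
    and lin: "\<And>x. x \<in> S \<Longrightarrow> linear (M x)" and bij: "\<And>x. x \<in> S \<Longrightarrow> bij (M x)"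
begin

lemma linear_inv_family: "x \<in> S \<Longrightarrow> linear (inv (M x))"
proof -
  assume x: "x \<in> S"
  have inj: "M x u = M x w \<Longrightarrow> u = w" for u w
    using bij[OF x] by (simp add: bij_def inj_eq)
  have inv: "M x (inv (M x) u) = u" for u
    using bij[OF x] by (simp add: bij_def surj_f_inv_f)
  show ?thesis
    by (rule linearI; rule inj) (simp_all add: inv linear_add[OF lin[OF x]] linear_scale[OF lin[OF x]])
qed

lemma inv_family_locally_bounded:
  assumes cont: "\<And>b. continuous_on S (\<lambda>x. M x b)" and x: "x \<in> S"
  shows "\<exists>K>0. eventually (\<lambda>y. \<forall>c. norm (inv (M y) c) \<le> K * norm c) (at x)"
proof -
  obtain B where B: "B > 0" "eventually (\<lambda>y. \<forall>v. B * norm v \<le> norm (M y v)) (nhds x)"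
    using linear_family_bounded_below[OF S lin cont x] bij[OF x] by (auto simp: bij_def)
  have "eventually (\<lambda>y. \<forall>v. B * norm v \<le> norm (M y v)) (at x)"
    using B(2) by (simp add: eventually_nhds_conv_at)
  moreover have "eventually (\<lambda>y. y \<in> S) (at x)"
    using eventually_at_topological S x by blast
  ultimately have "eventually (\<lambda>y. \<forall>c. norm (inv (M y) c) \<le> 1 / B * norm c) (at x)"
  proof eventually_elim
    case (elim y)
    have "norm (inv (M y) c) \<le> 1 / B * norm c" for c
    proof -
      have "M y (inv (M y) c) = c" using bij[OF elim(2)] by (simp add: bij_def surj_f_inv_f)
      then have "B * norm (inv (M y) c) \<le> norm c" using elim(1) by metis
      then show ?thesis using B(1) by (simp add: field_simps)
    qed
    then show ?case by blast
  qed
  then show ?thesis using B(1) by (intro exI[of _ "1 / B"]) auto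
qed

text \<open>The resolvent identity N^-1 - M^-1 = N^-1 (M - N) M^-1, evaluated at \<open>c\<close>.
  As the inverses are locally bounded, it yields first their continuity and then their
  derivative.\<close>

lemma inv_family_diff:
  assumes "x \<in> S" "y \<in> S"
  shows "inv (M y) c = inv (M x) c + inv (M y) (M x (inv (M x) c) - M y (inv (M x) c))"
proof -
  have "M x (inv (M x) c) = c" by (metis assms(1) bij bij_inv_eq_iff)
  moreover have "inv (M y) (M y (inv (M x) c)) = inv (M x) c" by (metis assms(2) bij bij_inv_eq_iff)
  ultimately show ?thesis by (simp add: linear_diff[OF linear_inv_family[OF assms(2)]])
qed

lemma continuous_inv_family:
  assumes cont: "\<And>b. continuous_on S (\<lambda>x. M x b)" and x: "x \<in> S"
  shows "isCont (\<lambda>x. inv (M x) c) x"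
proof -
  let ?g = "\<lambda>y. M x (inv (M x) c) - M y (inv (M x) c)"
  obtain K where K: "K > 0" "eventually (\<lambda>y. \<forall>c. norm (inv (M y) c) \<le> K * norm c) (at x)"
    using inv_family_locally_bounded[OF assms] by blast
  have "((\<lambda>y. ?g y) \<longlongrightarrow> ?g x) (at x)"
    using cont x S by (intro tendsto_diff tendsto_const) (auto simp: continuous_on_eq_continuous_at isCont_def)
  then have "((\<lambda>y. K * norm (?g y)) \<longlongrightarrow> K * norm (?g x)) (at x)"
    by (intro tendsto_mult tendsto_norm tendsto_const)
  then have "((\<lambda>y. K * norm (?g y)) \<longlongrightarrow> 0) (at x)" by simp
  moreover have "eventually (\<lambda>y. norm (inv (M y) (?g y)) \<le> K * norm (?g y)) (at x)"
    using K(2) by eventually_elim auto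
  ultimately have "((\<lambda>y. inv (M y) (?g y)) \<longlongrightarrow> 0) (at x)" by (rule Lim_null_comparison[rotated])
  then have "((\<lambda>y. inv (M x) c + inv (M y) (?g y)) \<longlongrightarrow> inv (M x) c + 0) (at x)"
    by (intro tendsto_add tendsto_const)
  moreover have "eventually (\<lambda>y. inv (M x) c + inv (M y) (?g y) = inv (M y) c) (at x)"
    using eventually_at_topological S x inv_family_diff by (metis (mono_tags, lifting))
  ultimately show ?thesis by (simp add: isCont_def filterlim_cong)
qed

lemma has_derivative_inv_family:
  assumes der: "\<And>b. ((\<lambda>y. M y b) has_derivative M' b) (at x)" and x: "x \<in> S"
    and cont: "\<And>b. continuous_on S (\<lambda>x. M x b)"
  shows "((\<lambda>y. inv (M y) c) has_derivative (\<lambda>v. inv (M x) (- M' (inv (M x) c) v))) (at x)"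
proof -
  let ?w = "inv (M x) c"
  let ?g = "\<lambda>y. M x ?w - M y ?w"
  have g: "(?g has_derivative (\<lambda>v. - M' ?w v)) (at x)"
    using has_derivative_diff[OF has_derivative_const der] by simp
  have "((\<lambda>y. ?w + (\<Sum>b\<in>Basis. (?g y \<bullet> b) *\<^sub>R inv (M y) b)) has_derivative
      (\<lambda>v. 0 + (\<Sum>b\<in>Basis. (- M' ?w v \<bullet> b) *\<^sub>R inv (M x) b))) (at x)"
    by (intro has_derivative_add has_derivative_const has_derivative_sum has_derivative_scaleR_zero
        has_derivative_inner_left g continuous_inv_family[OF cont x]) auto
  then have "((\<lambda>y. inv (M y) c) has_derivative
      (\<lambda>v. 0 + (\<Sum>b\<in>Basis. (- M' ?w v \<bullet> b) *\<^sub>R inv (M x) b))) (at x)"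
  proof (rule has_derivative_transform_within_open[OF _ S x])
    fix y assume y: "y \<in> S"
    show "?w + (\<Sum>b\<in>Basis. (?g y \<bullet> b) *\<^sub>R inv (M y) b) = inv (M y) c"
      by (simp only: linear_euclidean_expansion[OF linear_inv_family[OF y], of "?g y", symmetric]
          inv_family_diff[OF x y, of c, symmetric])
  qed
  then show ?thesis
    unfolding linear_euclidean_expansion[OF linear_inv_family[OF x], symmetric] by simp
qed

text \<open>The derivative - M^-1 M' M^-1 is as regular as M' and the inverse are, so the induction
  on \<open>k\<close> closes.\<close>

lemma Ck_on_inv_family:
  assumes "\<And>b. Ck_on k (\<lambda>x. M x b) S"
  shows "Ck_on k (\<lambda>x. inv (M x) c) S"
  using assms
proof (induction k arbitrary: c)
  case 0
  then show ?case
    using continuous_inv_family by (auto intro: continuous_at_imp_continuous_on)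
next
  case (Suc k)
  have d: "((\<lambda>x. M x b) has_derivative frechet_derivative (\<lambda>x. M x b) (at x)) (at x)"
    if "x \<in> S" for x b
    using Suc.prems[of b] that by (simp add: frechet_derivative_works)
  have ck: "Ck_on k (\<lambda>x. inv (M x) c) S" for c
    using Suc.IH Ck_on_Suc_imp[OF Suc.prems] by blast
  have cont: "continuous_on S (\<lambda>x. M x b)" for b
    by (rule Ck_on_continuous[OF Suc.prems])
  show ?case
  proof (rule Ck_on_SucI[OF S has_derivative_inv_family[OF d _ cont]])
    fix v
    have lin': "linear (\<lambda>b. frechet_derivative (\<lambda>x. M x b) (at x) v)" if x: "x \<in> S" for x
      by (rule linear_derivative_family[OF S x lin d[OF x]])
    have "Ck_on k (\<lambda>x. (\<lambda>b. frechet_derivative (\<lambda>x. M x b) (at x) v) (inv (M x) c)) S"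
      by (rule Ck_on_apply[OF S lin' _ ck]) (use Suc.prems in auto)
    then have "Ck_on k (\<lambda>x. - frechet_derivative (\<lambda>y. M y (inv (M x) c)) (at x) v) S"
      by (rule Ck_on_compose_linear[OF S bounded_linear_minus[OF bounded_linear_ident]])
    from Ck_on_apply[OF S linear_inv_family ck this] show "Ck_on k (\<lambda>x. inv (M x) (- frechet_derivative (\<lambda>y. M y (inv (M x) c)) (at x) v)) S" .
  qed
qed

lemma smooth_on_inv_family:
  assumes "\<And>b. smooth_on (\<lambda>x. M x b) S"
  shows "smooth_on (\<lambda>x. inv (M x) c) S"
  using assms unfolding smooth_on_def by (simp add: Ck_on_inv_family)

end

subsection \<open>Symmetry of second derivatives and exterior derivatives\<close>

text \<open>The second difference is symmetric in \<open>v\<close> and \<open>w\<close>, so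
  exchanging them expresses one number by both mixed derivatives. The mean value theorem is used in
  direction \<open>v\<close> on \<open>?phi\<close>, then in direction \<open>w\<close>.\<close>

lemma second_difference_mvt:
  fixes f :: "'a::euclidean_space \<Rightarrow> real"
  assumes f: "Ck_on 2 f S" and s: "s > 0"
    and sq: "\<And>a b. 0 \<le> a \<Longrightarrow> a \<le> s \<Longrightarrow> 0 \<le> b \<Longrightarrow> b \<le> s \<Longrightarrow> x + a *\<^sub>R v + b *\<^sub>R w \<in> S"
  shows "\<exists>a b. 0 < a \<and> a < s \<and> 0 < b \<and> b < s \<and>
    f (x + s *\<^sub>R v + s *\<^sub>R w) - f (x + s *\<^sub>R v) - f (x + s *\<^sub>R w) + f x =
    s * (s * frechet_derivative (\<lambda>y. frechet_derivative f (at y) v) (at (x + a *\<^sub>R v + b *\<^sub>R w)) w)"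
proof -
  let ?fv = "\<lambda>y. frechet_derivative f (at y) v"
  have d: "(f has_derivative frechet_derivative f (at y)) (at y)"
    "(?fv has_derivative frechet_derivative ?fv (at y)) (at y)" if "y \<in> S" for y
    using f that by (auto simp: numeral_2_eq_2 frechet_derivative_works)
  have line: "((\<lambda>t. g (p + t *\<^sub>R u)) has_real_derivative frechet_derivative g (at (p + t *\<^sub>R u)) u) (at t)"
    if "(g has_derivative frechet_derivative g (at (p + t *\<^sub>R u))) (at (p + t *\<^sub>R u))"
    for g :: "'a \<Rightarrow> real" and p u t
  proof -
    have "((\<lambda>t. g (p + t *\<^sub>R u)) has_derivative (\<lambda>r. frechet_derivative g (at (p + t *\<^sub>R u)) (r *\<^sub>R u))) (at t)"
      by (rule has_derivative_compose[where g = g and f = "\<lambda>t. p + t *\<^sub>R u"])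
        (use that in \<open>auto intro!: derivative_eq_intros\<close>)
    moreover have "(\<lambda>r. frechet_derivative g (at (p + t *\<^sub>R u)) (r *\<^sub>R u)) =
        (*) (frechet_derivative g (at (p + t *\<^sub>R u)) u)"
      using linear_scale[OF has_derivative_linear[OF that]] by (simp add: fun_eq_iff)
    ultimately show ?thesis unfolding has_field_derivative_def by simp
  qed
  let ?phi = "\<lambda>a. f (x + s *\<^sub>R w + a *\<^sub>R v) - f (x + a *\<^sub>R v)"
  have "\<exists>a>0. a < s \<and> ?phi s - ?phi 0 = (s - 0) * (?fv (x + s *\<^sub>R w + a *\<^sub>R v) - ?fv (x + a *\<^sub>R v))"
  proof (rule MVT2[OF s])
    fix a assume "0 \<le> a" "a \<le> s"
    then have "x + s *\<^sub>R w + a *\<^sub>R v \<in> S" "x + a *\<^sub>R v \<in> S"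
      using sq[of a s] sq[of a 0] s by (simp_all add: add_ac)
    then show "(?phi has_real_derivative ?fv (x + s *\<^sub>R w + a *\<^sub>R v) - ?fv (x + a *\<^sub>R v)) (at a)"
      by (intro DERIV_diff line d)
  qed
  then obtain a where a: "0 < a" "a < s"
    "?phi s - ?phi 0 = s * (?fv (x + s *\<^sub>R w + a *\<^sub>R v) - ?fv (x + a *\<^sub>R v))" by auto
  have "\<exists>b>0. b < s \<and> ?fv (x + a *\<^sub>R v + s *\<^sub>R w) - ?fv (x + a *\<^sub>R v + 0 *\<^sub>R w) =
      (s - 0) * frechet_derivative ?fv (at (x + a *\<^sub>R v + b *\<^sub>R w)) w"
    by (rule MVT2[OF s], rule line, rule d(2)) (use sq a in auto)
  then obtain b where b: "0 < b" "b < s" "?fv (x + a *\<^sub>R v + s *\<^sub>R w) - ?fv (x + a *\<^sub>R v) =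
      s * frechet_derivative ?fv (at (x + a *\<^sub>R v + b *\<^sub>R w)) w" by auto
  have "f (x + s *\<^sub>R v + s *\<^sub>R w) - f (x + s *\<^sub>R v) - f (x + s *\<^sub>R w) + f x = ?phi s - ?phi 0"
    by (simp add: add_ac)
  also have "\<dots> = s * (?fv (x + a *\<^sub>R v + s *\<^sub>R w) - ?fv (x + a *\<^sub>R v))"
    unfolding a(3) by (simp add: add_ac)
  finally show ?thesis using a b by auto
qed

lemma second_derivative_symmetric_real:
  fixes f :: "'a::euclidean_space \<Rightarrow> real"
  assumes "open S" "Ck_on 2 f S" "x \<in> S"
  shows "frechet_derivative (\<lambda>y. frechet_derivative f (at y) v) (at x) w =
    frechet_derivative (\<lambda>y. frechet_derivative f (at y) w) (at x) v" (is "?A x = ?B x")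
proof -
  have cont: "isCont ?A x" "isCont ?B x"
    using assms by (auto simp: numeral_2_eq_2 continuous_on_eq_continuous_at)
  have "\<bar>?A x - ?B x\<bar> \<le> 2 * e" if e: "e > 0" for e
  proof -
    obtain d1 where d1: "d1 > 0" "\<And>y. dist y x < d1 \<Longrightarrow> dist (?A y) (?A x) < e"
      using cont(1) e unfolding continuous_at_eps_delta by blast
    obtain d2 where d2: "d2 > 0" "\<And>y. dist y x < d2 \<Longrightarrow> dist (?B y) (?B x) < e"
      using cont(2) e unfolding continuous_at_eps_delta by blast
    obtain d3 where d3: "d3 > 0" "ball x d3 \<subseteq> S"
      using assms(1,3) open_contains_ball by blast
    define d where "d = Min {d1, d2, d3}"
    have d: "d > 0" "d \<le> d1" "d \<le> d2" "d \<le> d3" using d1 d2 d3 by (auto simp: d_def)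
    \<comment> \<open>A side length for which the whole parallelogram spanned by
      \<open>s *\<^sub>R v\<close> and \<open>s *\<^sub>R w\<close> stays within distance
      \<open>d\<close> of \<open>x\<close>; the summand 1 covers v = w = 0.\<close>
    define s where "s = d / (norm v + norm w + 1)"
    have s: "s > 0" using d by (simp add: s_def add_nonneg_pos)
    have near: "dist (x + a *\<^sub>R v + b *\<^sub>R w) x < d" if "0 \<le> a" "a \<le> s" "0 \<le> b" "b \<le> s" for a b
    proof -
      have "dist (x + a *\<^sub>R v + b *\<^sub>R w) x = norm (a *\<^sub>R v + b *\<^sub>R w)" by (simp add: dist_norm)
      also have "\<dots> \<le> s * norm v + s * norm w"
        using that by (intro order_trans[OF norm_triangle_ineq] add_mono) (auto simp: mult_right_mono)
      also have "\<dots> < s * (norm v + norm w + 1)" using s by (simp add: algebra_simps)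
      also have "\<dots> = d"
      proof -
        have "norm v + norm w + 1 > 0" by (simp add: add_nonneg_pos)
        then show ?thesis by (simp add: s_def)
      qed
      finally show ?thesis .
    qed
    have inS: "x + a *\<^sub>R v + b *\<^sub>R w \<in> S" "x + a *\<^sub>R w + b *\<^sub>R v \<in> S"
      if "0 \<le> a" "a \<le> s" "0 \<le> b" "b \<le> s" for a b
      using near[of a b] near[of b a] that d3(2) d by (auto simp: dist_commute subset_eq add_ac)
    obtain a b where ab: "0 < a" "a < s" "0 < b" "b < s"
      "f (x + s *\<^sub>R v + s *\<^sub>R w) - f (x + s *\<^sub>R v) - f (x + s *\<^sub>R w) + f x =
       s * (s * ?A (x + a *\<^sub>R v + b *\<^sub>R w))"
      using second_difference_mvt[OF assms(2) s inS(1)] by blast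
    obtain a' b' where ab': "0 < a'" "a' < s" "0 < b'" "b' < s"
      "f (x + s *\<^sub>R w + s *\<^sub>R v) - f (x + s *\<^sub>R w) - f (x + s *\<^sub>R v) + f x =
       s * (s * ?B (x + a' *\<^sub>R w + b' *\<^sub>R v))"
      using second_difference_mvt[OF assms(2) s inS(2)] by blast
    have "s * (s * ?A (x + a *\<^sub>R v + b *\<^sub>R w)) = s * (s * ?B (x + a' *\<^sub>R w + b' *\<^sub>R v))"
      unfolding ab(5)[symmetric] ab'(5)[symmetric] by (simp add: add_ac)
    then have "?A (x + a *\<^sub>R v + b *\<^sub>R w) = ?B (x + a' *\<^sub>R w + b' *\<^sub>R v)"
      using s by simp
    moreover have "x + a' *\<^sub>R w + b' *\<^sub>R v = x + b' *\<^sub>R v + a' *\<^sub>R w"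
      by (simp add: add_ac)
    ultimately have "?A (x + a *\<^sub>R v + b *\<^sub>R w) = ?B (x + b' *\<^sub>R v + a' *\<^sub>R w)"
      by simp
    moreover have "dist (?A (x + a *\<^sub>R v + b *\<^sub>R w)) (?A x) < e"
      using d1(2) near[of a b] ab d by auto
    moreover have "dist (?B (x + b' *\<^sub>R v + a' *\<^sub>R w)) (?B x) < e"
      using d2(2) near[of b' a'] ab' d by auto
    ultimately show ?thesis by (simp add: dist_real_def)
  qed
  note le = this
  have "\<bar>?A x - ?B x\<bar> \<le> 0 + e" if "e > 0" for e
    using le[of "e / 2"] that by simp
  then have "\<bar>?A x - ?B x\<bar> \<le> 0" using field_le_epsilon by blast
  then show ?thesis by simp
qed

lemma second_derivative_symmetric:
  fixes f :: "'a::euclidean_space \<Rightarrow> 'b::euclidean_space"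
  assumes "open S" "smooth_on f S" "x \<in> S"
  shows "frechet_derivative (\<lambda>y. frechet_derivative f (at y) v) (at x) w =
    frechet_derivative (\<lambda>y. frechet_derivative f (at y) w) (at x) v"
proof (rule euclidean_eqI)
  fix b :: 'b
  have 1: "frechet_derivative (\<lambda>y. f y \<bullet> b) (at y) u = frechet_derivative f (at y) u \<bullet> b" if "y \<in> S" for y u
    by (rule fun_cong[OF frechet_derivative_at[symmetric]])
      (intro has_derivative_inner_left smooth_on_has_derivative[OF assms(2) that])
  have 2: "frechet_derivative (\<lambda>y. frechet_derivative (\<lambda>y. f y \<bullet> b) (at y) u) (at x) t =
      frechet_derivative (\<lambda>y. frechet_derivative f (at y) u) (at x) t \<bullet> b" for u t
  proof (rule fun_cong[OF frechet_derivative_at[symmetric]])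
    have "((\<lambda>y. frechet_derivative f (at y) u \<bullet> b) has_derivative
        (\<lambda>t. frechet_derivative (\<lambda>y. frechet_derivative f (at y) u) (at x) t \<bullet> b)) (at x)"
      by (intro has_derivative_inner_left smooth_on_has_derivative[OF smooth_on_frechet_derivative[OF assms(2)] assms(3)])
    then show "((\<lambda>y. frechet_derivative (\<lambda>y. f y \<bullet> b) (at y) u) has_derivative
        (\<lambda>t. frechet_derivative (\<lambda>y. frechet_derivative f (at y) u) (at x) t \<bullet> b)) (at x)"
      by (rule has_derivative_transform_within_open[OF _ assms(1,3)]) (simp add: 1)
  qed
  have "smooth_on (\<lambda>y. f y \<bullet> b) S"
    by (rule smooth_on_compose_linear[OF assms(1) bounded_linear_inner_left assms(2)])
  then have "Ck_on 2 (\<lambda>y. f y \<bullet> b) S" unfolding smooth_on_def by blast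
  from second_derivative_symmetric_real[OF assms(1) this assms(3)]
  show "frechet_derivative (\<lambda>y. frechet_derivative f (at y) v) (at x) w \<bullet> b =
    frechet_derivative (\<lambda>y. frechet_derivative f (at y) w) (at x) v \<bullet> b"
    unfolding 2 .
qed

text \<open>The coordinate expression inside \<open>ext_deriv\<close>; there is no bracket term
  because \<open>v\<close> and \<open>w\<close> stand for constant fields.\<close>

definition dform :: "('a::real_normed_vector \<Rightarrow> 'a \<Rightarrow> 'b::real_normed_vector) \<Rightarrow> 'a \<Rightarrow> 'a \<Rightarrow> 'a \<Rightarrow> 'b" where
  "dform \<beta> p v w = frechet_derivative (\<lambda>q. \<beta> q w) (at p) v - frechet_derivative (\<lambda>q. \<beta> q v) (at p) w"

lemma dform_eqI:
  assumes "((\<lambda>q. \<beta> q w) has_derivative D) (at p)" "((\<lambda>q. \<beta> q v) has_derivative E) (at p)"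
  shows "dform \<beta> p v w = D v - E w"
  unfolding dform_def frechet_derivative_at[OF assms(1), symmetric]
    frechet_derivative_at[OF assms(2), symmetric] ..

lemma dform_cong:
  assumes "open S" "p \<in> S" "\<And>q w. q \<in> S \<Longrightarrow> \<alpha> q w = \<beta> q w" "\<And>w. (\<lambda>q. \<alpha> q w) differentiable (at p)"
  shows "dform \<alpha> p = dform \<beta> p"
proof (intro ext)
  fix v w
  have "((\<lambda>q. \<beta> q u) has_derivative frechet_derivative (\<lambda>q. \<alpha> q u) (at p)) (at p)" for u
    by (rule has_derivative_transform_within_open[of "\<lambda>q. \<alpha> q u", OF _ assms(1,2)])
      (simp_all add: assms(3,4) frechet_derivative_works[symmetric])
  from dform_eqI[of \<beta>, OF this this] show "dform \<alpha> p v w = dform \<beta> p v w"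
    by (simp add: dform_def)
qed

text \<open>The second derivatives of \<open>f\<close> enter symmetrically and cancel; what is left
  is the naturality of the exterior derivative.\<close>

lemma dform_pullback:
  fixes f :: "'a::euclidean_space \<Rightarrow> 'b::euclidean_space"
    and \<beta> :: "'b \<Rightarrow> 'b \<Rightarrow> 'c::real_normed_vector"
  assumes "open S" "smooth_on f S" "x \<in> S" "\<And>y. y \<in> S \<Longrightarrow> linear (\<beta> (f y))"
    "\<And>w. (\<lambda>q. \<beta> q w) differentiable (at (f x))"
  shows "dform (\<lambda>y v. \<beta> (f y) (frechet_derivative f (at y) v)) x v w =
    dform \<beta> (f x) (frechet_derivative f (at x) v) (frechet_derivative f (at x) w)"
proof -
  let ?D = "\<lambda>y. frechet_derivative f (at y)"
  have *: "((\<lambda>y. \<beta> (f y) (?D y w)) has_derivative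
      (\<lambda>v. frechet_derivative (\<lambda>q. \<beta> q (?D x w)) (at (f x)) (?D x v) +
        \<beta> (f x) (frechet_derivative (\<lambda>y. ?D y w) (at x) v))) (at x)" for w
  proof (rule has_derivative_apply[OF assms(1,3,4)])
    show "((\<lambda>y. \<beta> (f y) b) has_derivative
        (\<lambda>v. frechet_derivative (\<lambda>q. \<beta> q b) (at (f x)) (?D x v))) (at x)" for b
      by (rule has_derivative_compose[OF smooth_on_has_derivative[OF assms(2,3)]])
        (use assms(5) frechet_derivative_works in blast)
    show "((\<lambda>y. ?D y w) has_derivative frechet_derivative (\<lambda>y. ?D y w) (at x)) (at x)"
      by (rule smooth_on_has_derivative[OF smooth_on_frechet_derivative[OF assms(2)] assms(3)])
  qed
  show ?thesis
    unfolding dform_eqI[OF * *] second_derivative_symmetric[OF assms(1-3), of w v] by (simp add: dform_def)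
qed

text \<open>The Leibniz rule for an operator-valued function times a form. It is used for changes of
  sections and for one-forms that factor through the coframe.\<close>

lemma dform_apply:
  fixes M :: "'a::euclidean_space \<Rightarrow> 'b::euclidean_space \<Rightarrow> 'c::real_normed_vector"
  assumes "open S" "x \<in> S" "\<And>y. y \<in> S \<Longrightarrow> linear (M y)"
    "\<And>b. ((\<lambda>y. M y b) has_derivative M' b) (at x)" "\<And>w. (\<lambda>q. \<beta> q w) differentiable (at x)"
  shows "dform (\<lambda>y v. M y (\<beta> y v)) x v w = M x (dform \<beta> x v w) + M' (\<beta> x w) v - M' (\<beta> x v) w"
proof -
  have *: "((\<lambda>y. M y (\<beta> y u)) has_derivative
      (\<lambda>v. M' (\<beta> x u) v + M x (frechet_derivative (\<lambda>q. \<beta> q u) (at x) v))) (at x)" for u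
    by (rule has_derivative_apply[OF assms(1-4)]) (simp_all add: assms(5) frechet_derivative_works[symmetric])
  show ?thesis unfolding dform_eqI[OF * *] by (simp add: dform_def linear_diff[OF assms(3)[OF assms(2)]])
qed

lemma bilinear_dform:
  assumes "open S" "x \<in> S" "\<And>y. y \<in> S \<Longrightarrow> linear (\<beta> y)"
    "\<And>w. (\<lambda>q. \<beta> q w) differentiable (at x)"
  shows "linear (\<lambda>v. dform \<beta> x v w)" "linear (dform \<beta> x v)"
proof -
  let ?D = "\<lambda>w. frechet_derivative (\<lambda>q. \<beta> q w) (at x)"
  have d: "((\<lambda>q. \<beta> q w) has_derivative ?D w) (at x)" for w
    using assms(4) frechet_derivative_works by blast
  have l1: "linear (?D w)" for w using d has_derivative_linear by blast
  have l2: "linear (\<lambda>w. ?D w v)" for v by (rule linear_derivative_family[OF assms(1-3) d])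
  show "linear (\<lambda>v. dform \<beta> x v w)" "linear (dform \<beta> x v)"
    by (auto intro!: linearI simp: dform_def linear_add[OF l2] linear_scale[OF l2] linear_add[OF l1] linear_scale[OF l1] scaleR_diff_right)
qed

subsection \<open>Charts and tangent vectors\<close>

definition local_form ::
  "('m, 'e::euclidean_space) chart set \<Rightarrow> ('m \<Rightarrow> ('m, 'e) tvec \<Rightarrow> 'b) \<Rightarrow> ('m, 'e) chart \<Rightarrow> 'e \<Rightarrow> 'e \<Rightarrow> 'b"
  where "local_form A \<alpha> c p \<xi> = \<alpha> (chart_inv c p) (tvec_of A c (chart_inv c p) \<xi>)"

locale atlas =
  fixes A :: "('m::{t2_space,second_countable_topology}, 'e::euclidean_space) chart set"
  assumes smooth_atlas: "smooth_atlas A"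
begin

abbreviation change :: "('m, 'e) chart \<Rightarrow> ('m, 'e) chart \<Rightarrow> 'e \<Rightarrow> 'e" where
  "change c c' \<equiv> snd c' \<circ> chart_inv c"

abbreviation Dchange :: "('m, 'e) chart \<Rightarrow> ('m, 'e) chart \<Rightarrow> 'e \<Rightarrow> 'e \<Rightarrow> 'e" where
  "Dchange c c' p \<equiv> frechet_derivative (change c c') (at p)"

lemma is_chart: "c \<in> A \<Longrightarrow> is_chart c"
  using smooth_atlas by (simp add: smooth_atlas_def)

lemma open_chart: "c \<in> A \<Longrightarrow> open (fst c)"
  using is_chart by (auto simp: is_chart_def)

lemma chart_inv_snd [simp]: "c \<in> A \<Longrightarrow> x \<in> fst c \<Longrightarrow> chart_inv c (snd c x) = x"
  using is_chart by (auto simp: is_chart_def homeomorphism_def)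

lemma inj_chart: "c \<in> A \<Longrightarrow> inj_on (snd c) (fst c)"
  by (rule inj_on_inverseI[of _ "chart_inv c"]) simp

lemma continuous_on_chart: "c \<in> A \<Longrightarrow> continuous_on (fst c) (snd c)"
  using is_chart by (auto simp: is_chart_def homeomorphism_def)

lemma continuous_on_chart_inv: "c \<in> A \<Longrightarrow> continuous_on (snd c ` fst c) (chart_inv c)"
  using is_chart by (auto simp: is_chart_def homeomorphism_def)

lemma open_chart_image:
  assumes "c \<in> A" "open U"
  shows "open (snd c ` (fst c \<inter> U))"
proof -
  have "open (snd c ` fst c)" using is_chart[OF assms(1)] by (simp add: is_chart_def)
  then have "open (chart_inv c -` U \<inter> snd c ` fst c)"
    using continuous_on_chart_inv[OF assms(1)] assms(2) continuous_on_open_vimage by blast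
  moreover have "chart_inv c -` U \<inter> snd c ` fst c = snd c ` (fst c \<inter> U)"
    using assms(1) by auto
  ultimately show ?thesis by simp
qed

lemma chart_image_iff: "c \<in> A \<Longrightarrow> x \<in> fst c \<Longrightarrow> snd c x \<in> snd c ` (fst c \<inter> U) \<longleftrightarrow> x \<in> U"
  by (auto dest: inj_onD[OF inj_chart])

lemma charts_atD: "c \<in> charts_at A x \<Longrightarrow> c \<in> A" "c \<in> charts_at A x \<Longrightarrow> x \<in> fst c"
  by (auto simp: charts_at_def)

lemma charts_atI: "c \<in> A \<Longrightarrow> x \<in> fst c \<Longrightarrow> c \<in> charts_at A x"
  by (auto simp: charts_at_def)

lemma some_chart: "some_chart A x \<in> charts_at A x"
proof -
  have "x \<in> (\<Union>c\<in>A. fst c)" using smooth_atlas by (simp add: smooth_atlas_def)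
  then have "\<exists>c. c \<in> charts_at A x" by (auto simp: charts_at_def)
  then show ?thesis unfolding some_chart_def by (rule someI_ex)
qed

lemma smooth_change: "c \<in> A \<Longrightarrow> c' \<in> A \<Longrightarrow> smooth_on (change c c') (snd c ` (fst c \<inter> fst c'))"
  using smooth_atlas by (simp add: smooth_atlas_def)

lemma change_has_derivative:
  assumes "c \<in> charts_at A x" "c' \<in> charts_at A x"
  shows "(change c c' has_derivative Dchange c c' (snd c x)) (at (snd c x))"
  by (rule smooth_on_has_derivative[OF smooth_change]) (use assms in \<open>auto simp: charts_at_def\<close>)

lemma change_cong_has_derivative:
  assumes "c \<in> charts_at A x" "c' \<in> charts_at A x"
    and "((\<lambda>p. f (chart_inv c' p)) has_derivative D) (at (snd c' x))"
  shows "((\<lambda>p. f (chart_inv c p)) has_derivative (\<lambda>\<xi>. D (Dchange c c' (snd c x) \<xi>))) (at (snd c x))"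
proof -
  note A = charts_atD[OF assms(1)] charts_atD[OF assms(2)]
  have "((\<lambda>p. f (chart_inv c' (change c c' p))) has_derivative
      (\<lambda>\<xi>. D (Dchange c c' (snd c x) \<xi>))) (at (snd c x))"
    by (rule has_derivative_compose[OF change_has_derivative[OF assms(1,2)]]) (use A assms(3) in simp)
  then show ?thesis
    by (rule has_derivative_transform_within_open[OF _ open_chart_image[OF A(1) open_chart[OF A(3)]]])
      (use A in auto)
qed

text \<open>The chain rule for three charts; it is what makes \<open>tvec_of\<close> satisfy the
  compatibility condition of \<open>tangent_space\<close>.\<close>

lemma Dchange_cocycle:
  assumes "c \<in> charts_at A x" "c' \<in> charts_at A x" "c'' \<in> charts_at A x"
  shows "Dchange c c'' (snd c x) \<xi> = Dchange c' c'' (snd c' x) (Dchange c c' (snd c x) \<xi>)"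
  using change_cong_has_derivative[OF assms(1,2), of "snd c''"] change_has_derivative[OF assms(2,3)]
  by (metis (no_types, lifting) comp_def ext frechet_derivative_at)

lemma Dchange_self:
  assumes "c \<in> charts_at A x"
  shows "Dchange c c (snd c x) \<xi> = \<xi>"
proof -
  note A = charts_atD[OF assms]
  have "(change c c has_derivative (\<lambda>\<xi>. \<xi>)) (at (snd c x))"
    by (rule has_derivative_transform_within_open[OF has_derivative_ident open_chart_image[OF A(1) open_UNIV]])
      (use A in auto)
  from frechet_derivative_at[OF this] show ?thesis by metis
qed

lemma tvec_of_chart: "c \<in> charts_at A x \<Longrightarrow> tvec_of A c x \<xi> c = \<xi>"
  by (simp add: tvec_of_def Dchange_self)

lemma tvec_of_in_tangent_space: "c \<in> charts_at A x \<Longrightarrow> tvec_of A c x \<xi> \<in> tangent_space A x"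
  unfolding tangent_space_def tvec_of_def
  by (auto simp del: comp_apply split_paired_All intro: Dchange_cocycle)

lemma tangent_space_component:
  "v \<in> tangent_space A x \<Longrightarrow> c \<in> charts_at A x \<Longrightarrow> c' \<in> charts_at A x \<Longrightarrow>
    v c' = Dchange c c' (snd c x) (v c)"
  unfolding tangent_space_def by blast

lemma tvec_of_component:
  assumes "v \<in> tangent_space A x" "c \<in> charts_at A x"
  shows "tvec_of A c x (v c) = v"
proof
  fix c'
  have "c' \<notin> charts_at A x \<Longrightarrow> v c' = 0" using assms(1) unfolding tangent_space_def by blast
  then show "tvec_of A c x (v c) c' = v c'"
    using tangent_space_component[OF assms, of c'] by (simp add: tvec_of_def)
qed

lemma tangent_space_eqI:
  "v \<in> tangent_space A x \<Longrightarrow> w \<in> tangent_space A x \<Longrightarrow> c \<in> charts_at A x \<Longrightarrow> v c = w c \<Longrightarrow> v = w"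
  using tvec_of_component by metis

lemma tvec_of_change:
  assumes "c \<in> charts_at A x" "c' \<in> charts_at A x"
  shows "tvec_of A c x \<xi> = tvec_of A c' x (Dchange c c' (snd c x) \<xi>)"
  by (rule tangent_space_eqI[OF tvec_of_in_tangent_space tvec_of_in_tangent_space assms(2)])
    (use assms tvec_of_chart in \<open>auto simp: tvec_of_def Dchange_self\<close>)

subsection \<open>Differentials and exterior derivatives in charts\<close>

lemma differential_chart:
  assumes "c \<in> charts_at A x" "((\<lambda>p. f (chart_inv c p)) has_derivative D) (at (snd c x))"
    "v \<in> tangent_space A x"
  shows "differential A f x v = D (v c)"
  using frechet_derivative_at[OF change_cong_has_derivative[OF some_chart[of x] assms(1,2)]]
    tangent_space_component[OF assms(3) some_chart assms(1)]
  by (simp add: differential_def Let_def comp_def) metis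

lemma smooth_one_form_onD:
  assumes "smooth_one_form_on A U \<alpha>" "c \<in> A"
  shows "p \<in> snd c ` (fst c \<inter> U) \<Longrightarrow> linear (local_form A \<alpha> c p)"
    "smooth_on (\<lambda>p. local_form A \<alpha> c p \<xi>) (snd c ` (fst c \<inter> U))" "open (snd c ` (fst c \<inter> U))"
  using assms open_chart_image unfolding smooth_one_form_on_def local_form_def[abs_def]
  by (force, blast, blast)

lemma smooth_one_form_onI:
  assumes "open U" "\<And>c p. c \<in> A \<Longrightarrow> p \<in> snd c ` (fst c \<inter> U) \<Longrightarrow> linear (local_form A \<alpha> c p)"
    "\<And>c \<xi>. c \<in> A \<Longrightarrow> smooth_on (\<lambda>p. local_form A \<alpha> c p \<xi>) (snd c ` (fst c \<inter> U))"
  shows "smooth_one_form_on A U \<alpha>"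
  unfolding smooth_one_form_on_def
proof (intro conjI ballI allI assms(1))
  fix c x assume "c \<in> A" "x \<in> fst c \<inter> U"
  with assms(2)[OF this(1), of "snd c x"] show "linear (\<lambda>\<xi>. \<alpha> x (tvec_of A c x \<xi>))"
    by (simp add: local_form_def[abs_def])
qed (use assms(3) in \<open>simp add: local_form_def\<close>)

lemma local_form_at:
  "c \<in> charts_at A x \<Longrightarrow> v \<in> tangent_space A x \<Longrightarrow> local_form A \<alpha> c (snd c x) (v c) = \<alpha> x v"
  by (simp add: local_form_def charts_atD tvec_of_component)

lemma local_form_change:
  assumes "c \<in> A" "c' \<in> A" "p \<in> snd c ` (fst c \<inter> fst c')"
  shows "local_form A \<alpha> c p \<xi> = local_form A \<alpha> c' (change c c' p) (Dchange c c' p \<xi>)"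
proof -
  obtain y where y: "y \<in> fst c" "y \<in> fst c'" "p = snd c y" using assms(3) by auto
  then have "c \<in> charts_at A y" "c' \<in> charts_at A y" using assms by (auto simp: charts_at_def)
  from tvec_of_change[OF this] show ?thesis using y assms by (simp add: local_form_def)
qed

lemma ext_deriv_some_chart:
  "ext_deriv A \<alpha> x v w =
    dform (local_form A \<alpha> (some_chart A x)) (snd (some_chart A x) x) (v (some_chart A x)) (w (some_chart A x))"
  by (simp add: ext_deriv_def dform_def local_form_def Let_def)

text \<open>Local forms in two charts are pull-backs of each other along the change of charts
  (\<open>local_form_change\<close>), so \<open>dform_pullback\<close> removes the dependence on
  \<open>some_chart\<close>.\<close>

lemma ext_deriv_chart:
  assumes "smooth_one_form_on A U \<alpha>" "x \<in> U" "c \<in> charts_at A x"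
    "v \<in> tangent_space A x" "w \<in> tangent_space A x"
  shows "ext_deriv A \<alpha> x v w = dform (local_form A \<alpha> c) (snd c x) (v c) (w c)"
proof -
  let ?c = "some_chart A x"
  have s: "?c \<in> charts_at A x" by (rule some_chart)
  note A = charts_atD[OF s] charts_atD[OF assms(3)]
  let ?S = "snd ?c ` (fst ?c \<inter> (fst c \<inter> U))"
  have U: "open U" using assms(1) by (simp add: smooth_one_form_on_def)
  have opS: "open ?S" using open_chart_image[OF A(1)] open_chart[OF A(3)] U by blast
  have sm: "smooth_on (change ?c c) ?S"
    by (rule smooth_on_subset[OF smooth_change[OF A(1,3)]]) auto
  have xS: "snd ?c x \<in> ?S" using A assms(2) by auto
  have im: "change ?c c p \<in> snd c ` (fst c \<inter> U)" if "p \<in> ?S" for p using that A by auto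
  have cx: "change ?c c (snd ?c x) = snd c x" using A by simp
  have diff: "(\<lambda>q. local_form A \<alpha> c q w) differentiable at (change ?c c (snd ?c x))" for w
    by (rule smooth_on_differentiable[OF smooth_one_form_onD(2)[OF assms(1) A(3)] im[OF xS]])
  have lf: "local_form A \<alpha> c (change ?c c p) (Dchange ?c c p \<xi>) = local_form A \<alpha> ?c p \<xi>" if "p \<in> ?S" for p \<xi>
    by (rule local_form_change[OF A(1,3), symmetric]) (use that in blast)
  have "dform (\<lambda>p \<xi>. local_form A \<alpha> c (change ?c c p) (Dchange ?c c p \<xi>)) (snd ?c x) =
      dform (local_form A \<alpha> ?c) (snd ?c x)"
  proof (rule dform_cong[OF opS xS lf])
    fix w
    have "smooth_on (\<lambda>q. local_form A \<alpha> c (change ?c c q) (Dchange ?c c q w)) ?S"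
    proof (rule smooth_on_cong[OF opS _ lf[symmetric]])
      show "smooth_on (\<lambda>q. local_form A \<alpha> ?c q w) ?S"
        by (rule smooth_on_subset[OF smooth_one_form_onD(2)[OF assms(1) A(1)]]) auto
    qed
    then show "(\<lambda>q. local_form A \<alpha> c (change ?c c q) (Dchange ?c c q w)) differentiable at (snd ?c x)"
      by (rule smooth_on_differentiable[OF _ xS])
  qed
  moreover have "dform (\<lambda>p \<xi>. local_form A \<alpha> c (change ?c c p) (Dchange ?c c p \<xi>)) (snd ?c x) a b =
      dform (local_form A \<alpha> c) (snd c x) (Dchange ?c c (snd ?c x) a) (Dchange ?c c (snd ?c x) b)" for a b
    unfolding cx[symmetric]
    by (rule dform_pullback[OF opS sm xS smooth_one_form_onD(1)[OF assms(1) A(3) im] diff])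
  ultimately show ?thesis
    unfolding ext_deriv_some_chart
    using tangent_space_component[OF assms(4) s assms(3)] tangent_space_component[OF assms(5) s assms(3)]
    by simp
qed

lemma bilinear_ext_deriv:
  assumes "smooth_one_form_on A U \<alpha>" "x \<in> U" "tlinear u" "tlinear u'"
    "range u \<subseteq> tangent_space A x" "range u' \<subseteq> tangent_space A x"
  shows "linear (\<lambda>a. ext_deriv A \<alpha> x (u a) (u' b))" "linear (\<lambda>b. ext_deriv A \<alpha> x (u a) (u' b))"
proof -
  let ?c = "some_chart A x"
  note s = some_chart[of x]
  note A = charts_atD[OF s]
  have xS: "snd ?c x \<in> snd ?c ` (fst ?c \<inter> U)" using A assms(2) by auto
  have d: "(\<lambda>q. local_form A \<alpha> ?c q w) differentiable at (snd ?c x)" for w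
    by (rule smooth_on_differentiable[OF smooth_one_form_onD(2)[OF assms(1) A(1)] xS])
  note l = bilinear_dform[OF smooth_one_form_onD(3)[OF assms(1) A(1)] xS smooth_one_form_onD(1)[OF assms(1) A(1)] d]
  have lu: "linear (\<lambda>t. u t ?c)" "linear (\<lambda>t. u' t ?c)" using assms(3,4) unfolding tlinear_def by blast+
  show "linear (\<lambda>a. ext_deriv A \<alpha> x (u a) (u' b))" "linear (\<lambda>b. ext_deriv A \<alpha> x (u a) (u' b))"
    unfolding ext_deriv_some_chart
    using linear_compose[OF lu(1) l(1)] linear_compose[OF lu(2) l(2)] by (simp_all add: comp_def)
qed

subsection \<open>Frames in charts\<close>

definition local_frame :: "('m, 'e) chart \<Rightarrow> ('m \<Rightarrow> ('t, 'm, 'e) frame) \<Rightarrow> 'e \<Rightarrow> 't \<Rightarrow> 'e" where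
  "local_frame c s p t = s (chart_inv c p) t c"

lemma framesD:
  assumes "u \<in> frames A x"
  shows "tlinear u" "inj u" "range u = tangent_space A x" "u t \<in> tangent_space A x"
    "inv u (u t) = t" "v \<in> tangent_space A x \<Longrightarrow> u (inv u v) = v"
  using assms unfolding frames_def bij_betw_def by (auto simp: f_inv_into_f)

lemma frame_component:
  assumes "u \<in> frames A x" "c \<in> charts_at A x"
  shows "linear (\<lambda>t. u t c)" "bij (\<lambda>t. u t c)" "inv u (tvec_of A c x \<xi>) = inv (\<lambda>t. u t c) \<xi>"
proof -
  note u = framesD[OF assms(1)]
  show "linear (\<lambda>t. u t c)" using u(1) unfolding tlinear_def by blast
  have inj: "inj (\<lambda>t. u t c)"
    by (rule injI) (metis assms(2) injD tangent_space_eqI u(2,4))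
  have c: "u (inv u (tvec_of A c x \<xi>)) c = \<xi>" for \<xi>
    by (simp add: u(6) tvec_of_in_tangent_space tvec_of_chart assms(2))
  then have "surj (\<lambda>t. u t c)" by (rule surjI)
  with inj show "bij (\<lambda>t. u t c)" by (rule bijI)
  show "inv u (tvec_of A c x \<xi>) = inv (\<lambda>t. u t c) \<xi>"
    using inv_f_eq[OF inj c] by metis
qed

end

locale section_on = atlas A for A :: "('m::{t2_space,second_countable_topology}, 'e::euclidean_space) chart set" +
  fixes U :: "'m set" and s :: "'m \<Rightarrow> ('t::euclidean_space, 'm, 'e) frame"
  assumes smooth_section: "smooth_tlinear_on A U s" and frame: "\<And>y. y \<in> U \<Longrightarrow> s y \<in> frames A y"
begin

lemma open_U: "open U" using smooth_section by (simp add: smooth_tlinear_on_def)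

context
  fixes c assumes c: "c \<in> A"
begin

lemma open_image: "open (snd c ` (fst c \<inter> U))"
  by (rule open_chart_image[OF c open_U])

lemma smooth_local_frame: "smooth_on (\<lambda>p. local_frame c s p t) (snd c ` (fst c \<inter> U))"
  using smooth_section c by (simp add: smooth_tlinear_on_def local_frame_def)

lemma local_frame:
  assumes "p \<in> snd c ` (fst c \<inter> U)"
  shows "linear (local_frame c s p)" "bij (local_frame c s p)"
    "local_form A (\<lambda>y. inv (s y)) c p = inv (local_frame c s p)"
proof -
  obtain y where y: "y \<in> fst c" "y \<in> U" "p = snd c y" using assms by auto
  have "local_frame c s p = (\<lambda>t. s y t c)" using y c by (simp add: local_frame_def[abs_def])
  then show "linear (local_frame c s p)" "bij (local_frame c s p)"
    "local_form A (\<lambda>y. inv (s y)) c p = inv (local_frame c s p)"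
    using frame_component[OF frame[OF y(2)] charts_atI[OF c y(1)]] y c
    by (auto simp: local_form_def[abs_def])
qed

lemma smooth_local_coframe: "smooth_on (\<lambda>p. inv (local_frame c s p) \<xi>) (snd c ` (fst c \<inter> U))"
  by (rule smooth_on_inv_family[OF open_image local_frame(1) local_frame(2) smooth_local_frame])

lemma linear_local_coframe: "p \<in> snd c ` (fst c \<inter> U) \<Longrightarrow> linear (inv (local_frame c s p))"
  by (rule linear_inv_family[OF open_image local_frame(1) local_frame(2)])

end

text \<open>In coordinates the coframe is the inverse of a smooth family of linear
  bijections.\<close>

lemma smooth_coframe: "smooth_one_form_on A U (\<lambda>y. inv (s y))"
proof (rule smooth_one_form_onI[OF open_U])
  fix c p \<xi> assume c: "c \<in> A"
  show "linear (local_form A (\<lambda>y. inv (s y)) c p)" if "p \<in> snd c ` (fst c \<inter> U)"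
    using linear_local_coframe[OF c that] local_frame(3)[OF c that] by simp
  show "smooth_on (\<lambda>p. local_form A (\<lambda>y. inv (s y)) c p \<xi>) (snd c ` (fst c \<inter> U))"
    by (rule smooth_on_cong[OF open_image[OF c] smooth_local_coframe[OF c]]) (simp add: local_frame(3)[OF c])
qed

end

subsection \<open>Changes of sections\<close>

context atlas
begin

context
  fixes U U' :: "'m set" and s s' :: "'m \<Rightarrow> ('t::euclidean_space, 'm, 'e) frame"
  assumes sec: "section_on A U s" and sec': "section_on A U' s'"
begin

interpretation s: section_on A U s by (rule sec)
interpretation s': section_on A U' s' by (rule sec')

text \<open>A single chart component presents the transition as a composition of coordinate
  matrices, from which its linearity and smoothness are read off.\<close>

lemma transition_component:
  assumes "y \<in> U" "y \<in> U'" "c \<in> charts_at A y"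
  shows "transition s s' y t = inv (\<lambda>t. s y t c) (s' y t c)"
proof -
  have "s' y t = tvec_of A c y (s' y t c)"
    using framesD(4)[OF s'.frame[OF assms(2)]] tvec_of_component assms(3) by metis
  then have "transition s s' y t = inv (s y) (tvec_of A c y (s' y t c))" by (simp add: transition_def)
  then show ?thesis
    by (simp only: frame_component(3)[OF s.frame[OF assms(1)] assms(3)])
qed

lemma transition:
  assumes "y \<in> U" "y \<in> U'"
  shows "linear (transition s s' y)" "bij (transition s s' y)"
    "s' y t = s y (transition s s' y t)"
    "v \<in> tangent_space A y \<Longrightarrow> inv (s y) v = transition s s' y (inv (s' y) v)"
proof -
  note f = framesD[OF s.frame[OF assms(1)]] and f' = framesD[OF s'.frame[OF assms(2)]]
  let ?c = "some_chart A y"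
  note c = frame_component[OF s.frame[OF assms(1)] some_chart]
    and c' = frame_component[OF s'.frame[OF assms(2)] some_chart]
  have tr: "transition s s' y = inv (\<lambda>t. s y t ?c) \<circ> (\<lambda>t. s' y t ?c)"
    using transition_component[OF assms some_chart] by (simp add: fun_eq_iff)
  have "linear (inv (\<lambda>t. s y t ?c))"
    by (rule linear_inv_family[of UNIV "\<lambda>_. \<lambda>t. s y t ?c"]) (use c in auto)
  then show "linear (transition s s' y)" unfolding tr by (rule linear_compose[OF c'(1)])
  show "bij (transition s s' y)" unfolding tr by (rule bij_comp[OF c'(2) bij_imp_bij_inv[OF c(2)]])
  show "s' y t = s y (transition s s' y t)" unfolding transition_def comp_def using f(6) f'(4) by metis
  show "v \<in> tangent_space A y \<Longrightarrow> inv (s y) v = transition s s' y (inv (s' y) v)"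
    unfolding transition_def comp_def using f'(6) by metis
qed

lemma transition_eq_id: "x \<in> U \<Longrightarrow> s x = s' x \<Longrightarrow> transition s s' x = id"
  unfolding transition_def comp_def using framesD(5)[OF s.frame, of x] by (auto simp del: fun_eq_iff)

lemma smooth_transition:
  assumes c: "c \<in> A"
  shows "smooth_on (\<lambda>p. transition s s' (chart_inv c p) t) (snd c ` (fst c \<inter> (U \<inter> U')))"
proof -
  let ?S = "snd c ` (fst c \<inter> (U \<inter> U'))"
  have S: "open ?S" using open_chart_image[OF c] s.open_U s'.open_U by blast
  have sub: "?S \<subseteq> snd c ` (fst c \<inter> U)" "?S \<subseteq> snd c ` (fst c \<inter> U')" by auto
  have "smooth_on (\<lambda>p. inv (local_frame c s p) (local_frame c s' p t)) ?S"
  proof (rule smooth_on_apply[OF S, where M = "\<lambda>p. inv (local_frame c s p)"])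
    show "smooth_on (\<lambda>p. inv (local_frame c s p) b) ?S" for b
      by (rule smooth_on_subset[OF s.smooth_local_coframe[OF c] sub(1)])
    show "smooth_on (\<lambda>p. local_frame c s' p t) ?S"
      by (rule smooth_on_subset[OF s'.smooth_local_frame[OF c] sub(2)])
    show "linear (inv (local_frame c s p))" if "p \<in> ?S" for p
      by (rule s.linear_local_coframe[OF c subsetD[OF sub(1) that]])
  qed
  then show ?thesis
  proof (rule smooth_on_cong[OF S])
    fix p assume "p \<in> ?S"
    then obtain y where "y \<in> fst c" "y \<in> U" "y \<in> U'" "p = snd c y" by auto
    then show "inv (local_frame c s p) (local_frame c s' p t) = transition s s' (chart_inv c p) t"
      using transition_component[OF _ _ charts_atI[OF c]] c by (simp add: local_frame_def[abs_def])
  qed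
qed

lemma transition_has_derivative:
  assumes "x \<in> U" "x \<in> U'" "c \<in> charts_at A x"
  shows "((\<lambda>p. transition s s' (chart_inv c p) t) has_derivative
    frechet_derivative (\<lambda>p. transition s s' (chart_inv c p) t) (at (snd c x))) (at (snd c x))"
  by (rule smooth_on_has_derivative[OF smooth_transition]) (use assms charts_atD in auto)

lemma differential_transition:
  assumes "x \<in> U" "x \<in> U'" "c \<in> charts_at A x" "v \<in> tangent_space A x"
  shows "differential A (\<lambda>y. transition s s' y t) x v =
    frechet_derivative (\<lambda>p. transition s s' (chart_inv c p) t) (at (snd c x)) (v c)"
  by (rule differential_chart[OF assms(3) transition_has_derivative[OF assms(1-3)] assms(4)])

text \<open>With g = \<open>transition s s'\<close> the coframes satisfy \<theta> = g \<theta>'. The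
  Leibniz rule, with g the identity at \<open>x\<close>, gives two correction terms; the same terms
  arise from the change of the connection form, so the torsion does not notice the section.\<close>

lemma ext_deriv_coframe_transition:
  assumes x: "x \<in> U" "x \<in> U'" and eq: "s x = s' x"
    and v: "v \<in> tangent_space A x" "w \<in> tangent_space A x"
  shows "ext_deriv A (\<lambda>y. inv (s y)) x v w = ext_deriv A (\<lambda>y. inv (s' y)) x v w +
    differential A (\<lambda>y. transition s s' y (inv (s x) w)) x v -
    differential A (\<lambda>y. transition s s' y (inv (s x) v)) x w"
proof -
  let ?c = "some_chart A x"
  note s = some_chart[of x]
  note A = charts_atD[OF s]
  let ?S = "snd ?c ` (fst ?c \<inter> (U \<inter> U'))"
  let ?g = "\<lambda>p. transition s s' (chart_inv ?c p)"
  let ?\<theta> = "local_form A (\<lambda>y. inv (s y)) ?c" and ?\<theta>' = "local_form A (\<lambda>y. inv (s' y)) ?c"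
  have S: "open ?S" using open_chart_image[OF A(1)] s.open_U s'.open_U by blast
  have xS: "snd ?c x \<in> ?S" using x A by auto
  have th: "?g p (?\<theta>' p \<xi>) = ?\<theta> p \<xi>" if pS: "p \<in> ?S" for p \<xi>
  proof -
    obtain y where y: "y \<in> fst ?c" "y \<in> U" "y \<in> U'" "p = snd ?c y" using pS by blast
    show ?thesis
      using transition(4)[OF y(2,3) tvec_of_in_tangent_space[OF charts_atI[OF A(1) y(1)]]] y A(1)
      by (simp add: local_form_def)
  qed
  have diff': "(\<lambda>q. ?\<theta>' q w) differentiable at (snd ?c x)" for w
    by (rule smooth_on_differentiable[OF smooth_one_form_onD(2)[OF s'.smooth_coframe A(1)]])
      (use xS in auto)
  have diff: "(\<lambda>q. ?\<theta> q w) differentiable at (snd ?c x)" for w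
    by (rule smooth_on_differentiable[OF smooth_one_form_onD(2)[OF s.smooth_coframe A(1)]])
      (use xS in auto)
  have lin: "linear (?g p)" if "p \<in> ?S" for p
    using that transition(1) A(1) by auto
  have "dform ?\<theta> (snd ?c x) (v ?c) (w ?c) =
      dform (\<lambda>p \<xi>. ?g p (?\<theta>' p \<xi>)) (snd ?c x) (v ?c) (w ?c)"
    using dform_cong[OF S xS th[symmetric] diff] by simp
  also have "\<dots> = ?g (snd ?c x) (dform ?\<theta>' (snd ?c x) (v ?c) (w ?c)) +
      frechet_derivative (\<lambda>p. ?g p (?\<theta>' (snd ?c x) (w ?c))) (at (snd ?c x)) (v ?c) -
      frechet_derivative (\<lambda>p. ?g p (?\<theta>' (snd ?c x) (v ?c))) (at (snd ?c x)) (w ?c)"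
    by (rule dform_apply[OF S xS lin transition_has_derivative[OF x s] diff'])
  also have "?\<theta>' (snd ?c x) (w ?c) = inv (s x) w"
    using local_form_at[OF s v(2)] eq by auto
  also have "?\<theta>' (snd ?c x) (v ?c) = inv (s x) v"
    using local_form_at[OF s v(1)] eq by auto
  also have "?g (snd ?c x) = id" using transition_eq_id[OF x(1) eq] A by simp
  finally show ?thesis
    unfolding ext_deriv_some_chart differential_transition[OF x s v(1)] differential_transition[OF x s v(2)]
    by simp
qed

end

end

subsection \<open>The group Q\<close>

lemma Q_groupD:
  assumes "g \<in> Q_group"
  shows "linear g" "bij g" "snd (g (v, 0)) = 0" "snd (inv g (v, 0)) = 0" "linear (inv g)"
proof -
  show g: "linear g" "bij g" using assms by (auto simp: Q_group_def)
  have V: "g ` V_sub = V_sub" using assms by (simp add: Q_group_def)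
  have "(v, 0) \<in> V_sub" by (simp add: V_sub_def)
  then have "g (v, 0) \<in> V_sub" using V by blast
  then show "snd (g (v, 0)) = 0" by (simp add: V_sub_def mem_Times_iff)
  obtain t where t: "t \<in> V_sub" "(v, 0) = g t" using V \<open>(v, 0) \<in> V_sub\<close> by blast
  then have "inv g (v, 0) = t" using g(2) by (metis bij_inv_eq_iff)
  then show "snd (inv g (v, 0)) = 0" using t(1) by (auto simp: V_sub_def)
  show "linear (inv g)"
    by (rule linear_inv_family[of UNIV "\<lambda>_. g"]) (use g in auto)
qed

lemma Q_groupI:
  assumes "linear g" "bij g" "\<And>v. snd (g (v, 0)) = 0" "\<And>v. snd (inv g (v, 0)) = 0"
  shows "g \<in> Q_group"
proof -
  have "t \<in> g ` V_sub" if "t \<in> V_sub" for t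
  proof (rule image_eqI)
    show "t = g (inv g t)" using assms(2) by (simp add: bij_def surj_f_inv_f)
    show "inv g t \<in> V_sub" using that assms(4)[of "fst t"] by (cases t) (simp add: V_sub_def mem_Times_iff)
  qed
  moreover have "g t \<in> V_sub" if "t \<in> V_sub" for t
    using that assms(3)[of "fst t"] by (cases t) (simp add: V_sub_def mem_Times_iff)
  ultimately show ?thesis using assms(1,2) by (auto simp: Q_group_def)
qed

lemma linear_bij_finite:
  fixes g :: "'a::euclidean_space \<Rightarrow> 'a"
  assumes "linear g" "inj g"
  shows "bij g"
  using assms linear_injective_imp_surjective by (auto simp: bij_def)

text \<open>By dimension, an injective linear map sending V into V sends it onto V; this supplies
  the condition on the inverse in \<open>Q_groupI\<close>.\<close>

lemma Q_groupI':
  fixes g :: "'n::finite T \<Rightarrow> 'n T"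
  assumes g: "linear g" "inj g" and V: "\<And>v. snd (g (v, 0)) = 0"
  shows "g \<in> Q_group"
proof -
  let ?h = "\<lambda>v. fst (g (v, 0))"
  have gh: "g (v, 0) = (?h v, 0)" for v using V by (simp add: prod_eq_iff)
  have "linear ?h"
    by (rule linear_compose[of "\<lambda>v. (v, 0)", unfolded comp_def])
      (auto intro!: linearI linear_compose[OF g(1) linear_fst, unfolded comp_def] simp: linear_fst)
  moreover have "inj ?h"
    by (rule injI) (metis gh injD[OF g(2)] Pair_inject)
  ultimately have "surj ?h" using linear_injective_imp_surjective by blast
  moreover have b: "bij g" by (rule linear_bij_finite[OF g])
  ultimately have "snd (inv g (v, 0)) = 0" for v
    using surjD[of ?h v] by (metis bij_inv_eq_iff gh snd_conv)
  then show ?thesis by (intro Q_groupI g V b)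
qed

lemma Q_group_comp: "g \<in> Q_group \<Longrightarrow> h \<in> Q_group \<Longrightarrow> g \<circ> h \<in> Q_group"
  unfolding Q_group_def by (auto simp: linear_compose bij_comp image_comp[symmetric] simp del: o_apply)

lemma Q_group_inv:
  assumes "g \<in> Q_group"
  shows "inv g \<in> Q_group"
  by (rule Q_groupI)
    (use Q_groupD[OF assms] in \<open>auto simp: bij_imp_bij_inv inv_inv_eq\<close>)

lemma id_Q_group: "id \<in> Q_group"
  by (auto simp: Q_group_def linear_id)

lemma lie_algebra_Q:
  fixes B :: "'n::finite T \<Rightarrow> 'n T"
  shows "B \<in> lie_algebra Q_group \<longleftrightarrow> linear B \<and> (\<forall>v. snd (B (v, 0)) = 0)"
proof
  assume "B \<in> lie_algebra Q_group"
  then obtain \<gamma> :: "real \<Rightarrow> 'n T \<Rightarrow> 'n T" where \<gamma>: "linear B" "\<And>r. \<gamma> r \<in> Q_group"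
    "\<And>t. ((\<lambda>r. \<gamma> r t) has_vector_derivative B t) (at 0)"
    by (auto simp: lie_algebra_def)
  have "snd (B (v, 0)) = 0" for v
  proof -
    have "((\<lambda>r. snd (\<gamma> r (v, 0))) has_vector_derivative snd (B (v, 0))) (at 0)"
      by (rule bounded_linear.has_vector_derivative[OF bounded_linear_snd \<gamma>(3)])
    then have "((\<lambda>r. 0) has_vector_derivative snd (B (v, 0))) (at (0::real))"
      using Q_groupD(3)[OF \<gamma>(2)] by simp
    then show ?thesis
      using has_vector_derivative_const vector_derivative_unique_at by blast
  qed
  with \<gamma>(1) show "linear B \<and> (\<forall>v. snd (B (v, 0)) = 0)" by simp
next
  assume B: "linear B \<and> (\<forall>v. snd (B (v, 0)) = 0)"
  then obtain K where K: "K > 0" "\<And>t. norm (B t) \<le> K * norm t"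
    using linear_bounded_pos by blast
  \<comment> \<open>The straight path id + r B is known to be invertible while |r| K < 1. For larger
    r it is replaced by the identity, since \<open>lie_algebra\<close> asks for membership at every
    r but looks at the derivative at 0 only.\<close>
  let ?\<gamma> = "\<lambda>r t. if \<bar>r\<bar> * K < 1 then t + r *\<^sub>R B t else t"
  have lin: "linear (\<lambda>t. t + r *\<^sub>R B t)" for r
    using B by (intro linear_compose_add linear_compose_scale_right linear_ident) auto
  have Q: "?\<gamma> r \<in> Q_group" for r
  proof (cases "\<bar>r\<bar> * K < 1")
    case True
    have "inj (\<lambda>t. t + r *\<^sub>R B t)"
      unfolding linear_injective_0[OF lin]
    proof (intro allI impI)
      fix t assume "t + r *\<^sub>R B t = 0"
      then have "norm t = norm (r *\<^sub>R B t)" by (metis add_eq_0_iff norm_minus_cancel)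
      also have "\<dots> \<le> \<bar>r\<bar> * K * norm t" using mult_left_mono[OF K(2)[of t], of "\<bar>r\<bar>"] by (simp add: mult.assoc)
      finally have "(1 - \<bar>r\<bar> * K) * norm t \<le> 0" by (simp add: algebra_simps)
      then show "t = 0" using True by (simp add: mult_le_0_iff)
    qed
    then have "(\<lambda>t. t + r *\<^sub>R B t) \<in> Q_group"
      by (rule Q_groupI'[OF lin]) (use B in simp)
    then show ?thesis using True by simp
  next
    case False
    then show ?thesis using id_Q_group by (simp add: id_def)
  qed
  have der: "((\<lambda>r. ?\<gamma> r t) has_vector_derivative B t) (at 0)" for t
  proof -
    have "((\<lambda>r. t + r *\<^sub>R B t) has_vector_derivative B t) (at 0)"
      by (auto intro!: derivative_eq_intros)
    then show ?thesis
      by (rule has_vector_derivative_transform_within_open[where S = "{-1/K<..<1/K}"])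
        (use K(1) in \<open>auto simp: field_simps abs_less_iff abs_mult_pos'\<close>)
  qed
  have "?\<gamma> 0 = id" by auto
  with Q der B show "B \<in> lie_algebra Q_group"
    unfolding lie_algebra_def mem_Collect_eq by (intro conjI exI[of _ ?\<gamma>]) auto
qed

subsection \<open>Intrinsic torsion in terms of a section\<close>

locale Q_structure = atlas A
  for A :: "('m::{t2_space,second_countable_topology}, 'e::euclidean_space) chart set" +
  fixes P :: "'m \<Rightarrow> ('n::finite T, 'm, 'e) frame set"
  assumes G_structure: "G_structure A Q_group P"
begin

lemma P_frames: "u \<in> P x \<Longrightarrow> u \<in> frames A x"
  using G_structure by (auto simp: G_structure_def)

lemma section_on: "local_section A P U s \<Longrightarrow> section_on A U s"
  by unfold_locales (auto simp: local_section_def P_frames)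

lemma local_sectionD:
  assumes "local_section A P U s"
  shows "open U" "y \<in> U \<Longrightarrow> s y \<in> P y"
  using assms by (auto simp: local_section_def smooth_tlinear_on_def)

lemma P_orbit:
  assumes "u \<in> P x"
  shows "P x = (\<lambda>g. u \<circ> g) ` Q_group"
proof -
  obtain s where s: "P x = (\<lambda>g. s x \<circ> g) ` Q_group"
    using G_structure unfolding G_structure_def by metis
  then obtain g where g: "g \<in> Q_group" "u = s x \<circ> g" using assms by auto
  have "s x \<circ> h = u \<circ> (inv g \<circ> h)" for h
    using Q_groupD(2)[OF g(1)] by (simp add: g(2) fun_eq_iff bij_def surj_f_inv_f)
  then have "(\<lambda>g. s x \<circ> g) ` Q_group \<subseteq> (\<lambda>g. u \<circ> g) ` Q_group"
    using Q_group_comp[OF Q_group_inv[OF g(1)]] by auto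
  moreover have "(\<lambda>g. u \<circ> g) ` Q_group \<subseteq> (\<lambda>g. s x \<circ> g) ` Q_group"
    using Q_group_comp[OF g(1)] by (auto simp: g(2) comp_assoc)
  ultimately show ?thesis using s by simp
qed

text \<open>Every frame is reached by translating a local section by a constant element of Q, so
  statements about \<open>u\<close> may be proved for values of sections.\<close>

lemma section_through:
  assumes "u \<in> P x"
  obtains U s where "local_section A P U s" "x \<in> U" "s x = u"
proof -
  obtain U s where s: "x \<in> U" "local_section A P U s"
    using G_structure unfolding G_structure_def by metis
  obtain g where g: "g \<in> Q_group" "u = s x \<circ> g"
    using assms P_orbit[OF local_sectionD(2)[OF s(2,1)]] by auto
  have "local_section A P U (\<lambda>y. s y \<circ> g)"
    unfolding local_section_def smooth_tlinear_on_def
  proof (intro conjI ballI allI)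
    fix y assume y: "y \<in> U"
    have sy: "tlinear (s y)" "range (s y) \<subseteq> tangent_space A y"
      using s(2) y unfolding local_section_def smooth_tlinear_on_def by auto
    show "range (s y \<circ> g) \<subseteq> tangent_space A y" using sy(2) by auto
    show "tlinear (s y \<circ> g)"
      unfolding tlinear_def
    proof
      fix c
      have "linear (\<lambda>t. s y t c)" using sy(1) unfolding tlinear_def by blast
      from linear_compose[OF Q_groupD(1)[OF g(1)] this]
      show "linear (\<lambda>t. (s y \<circ> g) t c)" by (simp add: comp_def)
    qed
    show "s y \<circ> g \<in> P y" using P_orbit[OF local_sectionD(2)[OF s(2) y]] g(1) by auto
  next
    show "open U" using s(2) local_sectionD by blast
  next
    fix c v assume "c \<in> A"
    then show "smooth_on (\<lambda>p. (s (chart_inv c p) \<circ> g) v c) (snd c ` (fst c \<inter> U))"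
      using s(2) unfolding local_section_def smooth_tlinear_on_def comp_def by blast
  qed
  with s(1) g(2) that show thesis by blast
qed

lemma transition_Q:
  assumes "local_section A P U s" "local_section A P U' s'" "y \<in> U" "y \<in> U'"
  shows "transition s s' y \<in> Q_group"
proof -
  obtain g where g: "g \<in> Q_group" "s' y = s y \<circ> g"
    using P_orbit[OF local_sectionD(2)[OF assms(1,3)]] local_sectionD(2)[OF assms(2,4)] by auto
  have "transition s s' y = g"
    using framesD(5)[OF P_frames[OF local_sectionD(2)[OF assms(1,3)]]]
    by (simp add: transition_def g(2) fun_eq_iff)
  with g(1) show ?thesis by simp
qed

text \<open>Provides the uniqueness behind the \<open>THE\<close> in \<open>torsion\<close>. As the
  transition is the identity at \<open>x\<close>, the connection form changes there just by the
  differential of the transition.\<close>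

lemma section_torsion_eq:
  assumes conn: "connection_on A Q_group P U0 \<omega>" and x: "x \<in> U0" "x \<in> U" "x \<in> U'"
    and s: "local_section A P U s" "local_section A P U' s'" and eq: "s x = s' x"
  shows "section_torsion A \<omega> s x = section_torsion A \<omega> s' x"
proof (intro ext)
  fix a b
  note sec = section_on[OF s(1)] section_on[OF s(2)]
  have fr: "s x \<in> frames A x" using P_frames local_sectionD(2)[OF s(1) x(2)] .
  have tan: "s x t \<in> tangent_space A x" for t by (rule framesD(4)[OF fr])
  have w: "\<omega> s' x v t = \<omega> s x v t + differential A (\<lambda>y. transition s s' y t) x v"
    if "v \<in> tangent_space A x" for v t
  proof -
    have "\<omega> s' x v t = inv (transition s s' x)
        (\<omega> s x v (transition s s' x t) + differential A (\<lambda>y. transition s s' y t) x v)"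
      using conn s x that unfolding connection_on_def by blast
    then show ?thesis unfolding transition_eq_id[OF sec x(2) eq] by simp
  qed
  show "section_torsion A \<omega> s x a b = section_torsion A \<omega> s' x a b"
    unfolding section_torsion_def ext_deriv_coframe_transition[OF sec x(2,3) eq tan tan]
      framesD(5)[OF fr] eq[symmetric] w[OF tan] by (simp add: algebra_simps)
qed

lemma torsion_section:
  assumes "connection_on A Q_group P U0 \<omega>" "x \<in> U0" "local_section A P U s" "x \<in> U"
  shows "torsion A P \<omega> x (s x) = section_torsion A \<omega> s x"
  unfolding torsion_def
proof (rule the_equality)
  show "\<forall>U' s'. local_section A P U' s' \<longrightarrow> x \<in> U' \<longrightarrow> s' x = s x \<longrightarrow>
      section_torsion A \<omega> s x = section_torsion A \<omega> s' x"
    using section_torsion_eq[OF assms(1,2)] assms(3,4) by metis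
qed (use assms(3,4) in blast)

lemma coker_proj_torsion:
  assumes "connection_on A Q_group P U0 \<omega>" "x \<in> U0" "local_section A P U s" "x \<in> U"
  shows "coker_proj (torsion A P \<omega> x (s x)) v w =
    snd (ext_deriv A (\<lambda>y. inv (s y)) x (s x (v, 0)) (s x (w, 0)))"
proof -
  have "s x t \<in> tangent_space A x" for t
    by (rule framesD(4)[OF P_frames[OF local_sectionD(2)[OF assms(3,4)]]])
  then have "\<omega> s x (s x t) \<in> lie_algebra Q_group" for t
    using assms unfolding connection_on_def by blast
  then have "snd (\<omega> s x (s x t) (v, 0)) = 0" for t v
    by (simp add: lie_algebra_Q)
  then show ?thesis
    by (simp add: coker_proj_def torsion_section[OF assms] section_torsion_def)
qed

text \<open>The connection for which the section \<open>s0\<close> is parallel.\<close>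

lemma flat_connection:
  assumes s0: "local_section A P U0 s0"
  defines "\<omega> \<equiv> \<lambda>s x v t. inv (transition s0 s x) (differential A (\<lambda>y. transition s0 s y t) x v)"
  shows "connection_on A Q_group P U0 \<omega>"
  unfolding connection_on_def
proof (intro conjI allI impI ballI)
  note sec0 = section_on[OF s0]
  show "open U0" by (rule local_sectionD(1)[OF s0])
  fix U s assume s: "local_section A P U s"
  note sec = section_on[OF s]
  note open_U = local_sectionD(1)[OF s] local_sectionD(1)[OF s0]
  have der: "((\<lambda>p. transition s0 s (chart_inv c p) t) has_derivative
      frechet_derivative (\<lambda>p. transition s0 s (chart_inv c p) t) (at (snd c x))) (at (snd c x))"
    if "x \<in> U \<inter> U0" "c \<in> charts_at A x" for x c t
    by (rule transition_has_derivative[OF sec0 sec]) (use that in auto)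
  have diff: "differential A (\<lambda>y. transition s0 s y t) x v =
      frechet_derivative (\<lambda>p. transition s0 s (chart_inv c p) t) (at (snd c x)) (v c)"
    if "x \<in> U \<inter> U0" "c \<in> charts_at A x" "v \<in> tangent_space A x" for x c t v
    by (rule differential_transition[OF sec0 sec]) (use that in auto)
  have S: "open (snd c ` (fst c \<inter> (U0 \<inter> U)))" if "c \<in> A" for c
    using open_chart_image[OF that] open_U by blast
  have lin: "linear (transition s0 s (chart_inv c p))" "transition s0 s (chart_inv c p) \<in> Q_group"
    if "c \<in> A" "p \<in> snd c ` (fst c \<inter> (U0 \<inter> U))" for c p
    using that transition(1)[OF sec0 sec] transition_Q[OF s0 s] by auto
  {
    fix x v assume x: "x \<in> U \<inter> U0" and v: "v \<in> tangent_space A x"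
    let ?c = "some_chart A x"
    note c = some_chart[of x]
    note cA = charts_atD[OF c]
    let ?D = "\<lambda>t. frechet_derivative (\<lambda>p. transition s0 s (chart_inv ?c p) t) (at (snd ?c x)) (v ?c)"
    have xS: "snd ?c x \<in> snd ?c ` (fst ?c \<inter> (U0 \<inter> U))" using x cA by auto
    have g: "transition s0 s x \<in> Q_group" using transition_Q[OF s0 s] x by auto
    have "linear ?D"
      by (rule linear_derivative_family[OF S[OF cA(1)] xS lin(1)[OF cA(1)] der[OF x c]])
    from linear_compose[OF this Q_groupD(5)[OF g]]
    have l: "linear (\<omega> s x v)"
      unfolding \<omega>_def diff[OF x c v] comp_def .
    \<comment> \<open>Transitions take values in Q, so on V their \<open>T/V\<close> component is
      constantly zero, and so is its derivative. The inverse of the transition preserves V, which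
      puts the result into the Lie algebra.\<close>
    have "snd (?D (w, 0)) = 0" for w
    proof -
      have "((\<lambda>p. snd (transition s0 s (chart_inv ?c p) (w, 0))) has_derivative (\<lambda>\<xi>. snd
          (frechet_derivative (\<lambda>p. transition s0 s (chart_inv ?c p) (w, 0)) (at (snd ?c x)) \<xi>))) (at (snd ?c x))"
        by (rule has_derivative_snd[OF der[OF x c]])
      moreover have "((\<lambda>p. snd (transition s0 s (chart_inv ?c p) (w, 0))) has_derivative (\<lambda>\<xi>. 0)) (at (snd ?c x))"
        by (rule has_derivative_transform_within_open[OF has_derivative_const S[OF cA(1)] xS])
          (use Q_groupD(3)[OF lin(2)[OF cA(1)]] in simp)
      ultimately show ?thesis by (metis has_derivative_unique)
    qed
    then have "snd (\<omega> s x v (w, 0)) = 0" for w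
      unfolding \<omega>_def diff[OF x c v] using Q_groupD(4)[OF g] by (metis prod.collapse)
    with l show "\<omega> s x v \<in> lie_algebra Q_group" by (simp add: lie_algebra_Q)
  }
  {
    fix t
    show "smooth_one_form_on A (U \<inter> U0) (\<lambda>x v. \<omega> s x v t)"
    proof (rule smooth_one_form_onI)
      show "open (U \<inter> U0)" using open_U by auto
      fix c assume c: "c \<in> A"
      let ?D = "\<lambda>p. frechet_derivative (\<lambda>p. transition s0 s (chart_inv c p) t) (at p)"
      have eq: "local_form A (\<lambda>x v. \<omega> s x v t) c p \<xi> = inv (transition s0 s (chart_inv c p)) (?D p \<xi>)"
        if p: "p \<in> snd c ` (fst c \<inter> (U \<inter> U0))" for p \<xi>
      proof -
        obtain y where y: "y \<in> fst c" "y \<in> U \<inter> U0" "p = snd c y" using p by auto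
        note cy = charts_atI[OF c y(1)]
        show ?thesis
          using diff[OF y(2) cy tvec_of_in_tangent_space[OF cy]] y c
          by (simp add: local_form_def \<omega>_def tvec_of_chart[OF cy])
      qed
      have linv: "linear (inv (transition s0 s (chart_inv c p)))"
        if "p \<in> snd c ` (fst c \<inter> (U \<inter> U0))" for p
        by (rule Q_groupD(5)[OF lin(2)[OF c]]) (use that in auto)
      show "linear (local_form A (\<lambda>x v. \<omega> s x v t) c p)" if p: "p \<in> snd c ` (fst c \<inter> (U \<inter> U0))" for p
      proof -
        obtain y where y: "y \<in> fst c" "y \<in> U \<inter> U0" "p = snd c y" using p by auto
        have "linear (?D p)" using has_derivative_linear[OF der[OF y(2) charts_atI[OF c y(1)]]] y(3) by simp
        moreover have "local_form A (\<lambda>x v. \<omega> s x v t) c p = inv (transition s0 s (chart_inv c p)) \<circ> ?D p"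
          unfolding comp_def eq[OF p, symmetric] ..
        ultimately show ?thesis using linear_compose[OF _ linv[OF p]] by simp
      qed
      fix \<xi>
      have com: "U \<inter> U0 = U0 \<inter> U" by auto
      have sm: "smooth_on (\<lambda>p. transition s0 s (chart_inv c p) t) (snd c ` (fst c \<inter> (U \<inter> U0)))" for t
        unfolding com by (rule smooth_transition[OF sec0 sec c])
      have "smooth_on (\<lambda>p. inv (transition s0 s (chart_inv c p)) (?D p \<xi>)) (snd c ` (fst c \<inter> (U \<inter> U0)))"
      proof (rule smooth_on_apply[where M = "\<lambda>p. inv (transition s0 s (chart_inv c p))",
            OF _ linv _ smooth_on_frechet_derivative[OF sm]])
        show op: "open (snd c ` (fst c \<inter> (U \<inter> U0)))" unfolding com by (rule S[OF c])
        show "smooth_on (\<lambda>p. inv (transition s0 s (chart_inv c p)) b) (snd c ` (fst c \<inter> (U \<inter> U0)))" for b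
          by (rule smooth_on_inv_family[OF op _ _ sm])
            (use lin[OF c] Q_groupD(2) in \<open>auto simp: com\<close>)
      qed
      then show "smooth_on (\<lambda>p. local_form A (\<lambda>x v. \<omega> s x v t) c p \<xi>) (snd c ` (fst c \<inter> (U \<inter> U0)))"
        by (rule smooth_on_cong[rotated]) (use S[OF c] eq in \<open>auto simp: com\<close>)
    qed
  }
next
  note sec0 = section_on[OF s0]
  fix U s U' s' x v t
  assume s: "local_section A P U s" and s': "local_section A P U' s'"
    and x: "x \<in> U \<inter> U' \<inter> U0" and v: "v \<in> tangent_space A x"
  note sec = section_on[OF s] and sec' = section_on[OF s']
  let ?c = "some_chart A x"
  note c = some_chart[of x]
  note cA = charts_atD[OF c]
  let ?g = "\<lambda>p. transition s0 s (chart_inv ?c p)" and ?g' = "\<lambda>p. transition s0 s' (chart_inv ?c p)"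
    and ?h = "\<lambda>p. transition s s' (chart_inv ?c p)"
  let ?S = "snd ?c ` (fst ?c \<inter> (U \<inter> U' \<inter> U0))"
  have S: "open ?S"
    by (intro open_chart_image cA(1) open_Int local_sectionD(1)[OF s] local_sectionD(1)[OF s']
        local_sectionD(1)[OF s0])
  have xS: "snd ?c x \<in> ?S" using x cA by auto
  \<comment> \<open>With g, g' and h for the transitions from s0 to s, from s0 to s' and from s to
    s', this is g' = g h. Its product rule is the law g'^-1 dg' = h^-1 (g^-1 dg) h + h^-1 dh
    required of a connection.\<close>
  have comp: "transition s0 s' y t = transition s0 s y (transition s s' y t)" if "y \<in> U" "y \<in> U'" for y t
    using transition(3)[OF sec sec' that] by (simp add: transition_def)
  have "((\<lambda>p. ?g p (?h p t)) has_derivative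
      (\<lambda>\<xi>. frechet_derivative (\<lambda>p. ?g p (?h (snd ?c x) t)) (at (snd ?c x)) \<xi> +
        ?g (snd ?c x) (frechet_derivative (\<lambda>p. ?h p t) (at (snd ?c x)) \<xi>))) (at (snd ?c x))"
  proof (rule has_derivative_apply[where M = ?g, OF S xS])
    show "linear (?g p)" if "p \<in> ?S" for p
      using that transition(1)[OF sec0 sec] cA by auto
    show "((\<lambda>p. ?g p b) has_derivative frechet_derivative (\<lambda>p. ?g p b) (at (snd ?c x))) (at (snd ?c x))" for b
      by (rule transition_has_derivative[OF sec0 sec _ _ c]) (use x in auto)
    show "((\<lambda>p. ?h p t) has_derivative frechet_derivative (\<lambda>p. ?h p t) (at (snd ?c x))) (at (snd ?c x))"
      by (rule transition_has_derivative[OF sec sec' _ _ c]) (use x in auto)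
  qed
  then have "((\<lambda>p. ?g' p t) has_derivative
      (\<lambda>\<xi>. frechet_derivative (\<lambda>p. ?g p (?h (snd ?c x) t)) (at (snd ?c x)) \<xi> +
        ?g (snd ?c x) (frechet_derivative (\<lambda>p. ?h p t) (at (snd ?c x)) \<xi>))) (at (snd ?c x))"
    by (rule has_derivative_transform_within_open[OF _ S xS]) (use cA(1) in \<open>auto simp: comp\<close>)
  from differential_chart[OF c this v]
  have d: "differential A (\<lambda>y. transition s0 s' y t) x v =
      differential A (\<lambda>y. transition s0 s y (transition s s' x t)) x v +
      transition s0 s x (differential A (\<lambda>y. transition s s' y t) x v)"
    using differential_transition[OF sec0 sec _ _ c v] differential_transition[OF sec sec' _ _ c v] x cA
    by simp
  have g: "transition s0 s x \<in> Q_group" using transition_Q[OF s0 s] x by auto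
  have h: "transition s s' x \<in> Q_group" using transition_Q[OF s s'] x by auto
  have "transition s0 s' x = transition s0 s x \<circ> transition s s' x"
    using comp x by (simp add: fun_eq_iff)
  then have inv: "inv (transition s0 s' x) = inv (transition s s' x) \<circ> inv (transition s0 s x)"
    using o_inv_distrib Q_groupD(2)[OF g] Q_groupD(2)[OF h] by metis
  have "inv (transition s0 s x) (transition s0 s x b) = b" for b
    using Q_groupD(2)[OF g] by (simp add: bij_def)
  then show "\<omega> s' x v t = inv (transition s s' x)
      (\<omega> s x v (transition s s' x t) + differential A (\<lambda>y. transition s s' y t) x v)"
    unfolding \<omega>_def d inv comp_def linear_add[OF Q_groupD(5)[OF g]] by simp
qed

proposition intrinsic_torsion_section:
  assumes "local_section A P U s" "x \<in> U"
  shows "intrinsic_torsion A P x (s x) v w =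
    snd (ext_deriv A (\<lambda>y. inv (s y)) x (s x (v, 0)) (s x (w, 0)))"
proof -
  let ?\<Theta> = "\<lambda>v w. snd (ext_deriv A (\<lambda>y. inv (s y)) x (s x (v, 0)) (s x (w, 0)))"
  have "intrinsic_torsion A P x (s x) = ?\<Theta>"
    unfolding intrinsic_torsion_def
  proof (rule the_equality)
    show eq: "\<forall>U \<omega>. connection_on A Q_group P U \<omega> \<longrightarrow> x \<in> U \<longrightarrow> ?\<Theta> = coker_proj (torsion A P \<omega> x (s x))"
      using coker_proj_torsion[OF _ _ assms] by (simp add: fun_eq_iff)
    \<comment> \<open>Here a connection must exist: a candidate is compared with the value at the
      flat connection over the domain of \<open>s\<close>.\<close>
    fix \<Theta> assume *: "\<forall>U \<omega>. connection_on A Q_group P U \<omega> \<longrightarrow> x \<in> U \<longrightarrow> \<Theta> = coker_proj (torsion A P \<omega> x (s x))"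
    show "\<Theta> = ?\<Theta>"
      using *[rule_format, OF flat_connection[OF assms(1)] assms(2)]
        eq[rule_format, OF flat_connection[OF assms(1)] assms(2)] by simp
  qed
  then show ?thesis by simp
qed

end

subsection \<open>Total differential equations\<close>

lemma Ck_on_Pair:
  assumes "open S" "Ck_on k f S" "Ck_on k g S"
  shows "Ck_on k (\<lambda>x. (f x, g x)) S"
proof -
  have l: "bounded_linear (\<lambda>v. (v, 0))" "bounded_linear (\<lambda>w. (0, w))"
    by (auto intro!: bounded_linear_Pair bounded_linear_ident bounded_linear_zero)
  have "Ck_on k (\<lambda>x. (f x, 0) + (0, g x)) S"
    by (rule Ck_on_add[OF assms(1) Ck_on_compose_linear[OF assms(1) l(1) assms(2)]
          Ck_on_compose_linear[OF assms(1) l(2) assms(3)]])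
  then show ?thesis by simp
qed

lemma smooth_on_Pair:
  "open S \<Longrightarrow> smooth_on f S \<Longrightarrow> smooth_on g S \<Longrightarrow> smooth_on (\<lambda>x. (f x, g x)) S"
  by (simp add: smooth_on_def Ck_on_Pair)

section \<open>Uniform estimates on compact sets\<close>

lemma continuous_family_bounded:
  fixes M :: "'a::metric_space \<Rightarrow> 'b::euclidean_space \<Rightarrow> 'c::real_normed_vector"
  assumes "compact K" "\<And>z. z \<in> K \<Longrightarrow> linear (M z)" "\<And>b. continuous_on K (\<lambda>z. M z b)"
  shows "\<exists>C\<ge>0. \<forall>z\<in>K. \<forall>v. norm (M z v) \<le> C * norm v"
proof -
  have "bounded ((\<lambda>z. M z b) ` K)" for b
    by (intro compact_imp_bounded compact_continuous_image assms)
  then have "\<exists>c. \<forall>z\<in>K. norm (M z b) \<le> c" for b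
    unfolding bounded_iff by auto
  then obtain c where c: "\<And>z b. z \<in> K \<Longrightarrow> norm (M z b) \<le> c b" by metis
  show ?thesis
  proof (intro exI[of _ "\<Sum>b\<in>Basis. \<bar>c b\<bar>"] conjI ballI allI)
    fix z v assume z: "z \<in> K"
    have "norm (M z v) = norm (\<Sum>b\<in>Basis. (v \<bullet> b) *\<^sub>R M z b)"
      by (simp only: linear_euclidean_expansion[OF assms(2)[OF z], symmetric])
    also have "\<dots> \<le> (\<Sum>b\<in>Basis. \<bar>c b\<bar> * norm v)"
    proof (rule sum_norm_le)
      fix b :: 'b assume "b \<in> Basis"
      then have "\<bar>v \<bullet> b\<bar> * norm (M z b) \<le> norm v * \<bar>c b\<bar>"
        by (intro mult_mono) (use c[OF z, of b] Basis_le_norm in auto)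
      then show "norm ((v \<bullet> b) *\<^sub>R M z b) \<le> \<bar>c b\<bar> * norm v" by (simp add: mult.commute)
    qed
    finally show "norm (M z v) \<le> (\<Sum>b\<in>Basis. \<bar>c b\<bar>) * norm v" by (simp add: sum_distrib_right)
  qed (simp add: sum_nonneg)
qed

lemma smooth_derivative_bounded:
  assumes "smooth_on g S" "K \<subseteq> S" "compact K"
  shows "\<exists>C\<ge>0. \<forall>z\<in>K. \<forall>v. norm (frechet_derivative g (at z) v) \<le> C * norm v"
  by (rule continuous_family_bounded[OF assms(3)])
    (use assms linear_frechet_derivative smooth_on_differentiable
      continuous_on_subset[OF smooth_on_continuous[OF smooth_on_frechet_derivative[OF assms(1)]]] in blast)+

lemma smooth_lipschitz:
  assumes "smooth_on g S" "K \<subseteq> S" "compact K" "convex K"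
  shows "\<exists>C\<ge>0. \<forall>z\<in>K. \<forall>z'\<in>K. norm (g z' - g z) \<le> C * norm (z' - z)"
proof -
  obtain C where C: "C \<ge> 0" "\<And>z v. z \<in> K \<Longrightarrow> norm (frechet_derivative g (at z) v) \<le> C * norm v"
    using smooth_derivative_bounded[OF assms(1-3)] by blast
  have "norm (g z' - g z) \<le> C * norm (z' - z)" if "z \<in> K" "z' \<in> K" for z z'
  proof (rule differentiable_bound[OF assms(4)])
    show "(g has_derivative frechet_derivative g (at y)) (at y within K)" if "y \<in> K" for y
      using smooth_on_has_derivative[OF assms(1)] that assms(2) has_derivative_at_withinI by blast
    show "onorm (frechet_derivative g (at y)) \<le> C" if "y \<in> K" for y
      by (rule onorm_le[OF C(2)[OF that]])
  qed (use that in auto)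
  with C(1) show ?thesis by blast
qed

text \<open>The mean value inequality is applied to \<open>g\<close> minus its linear part at
  \<open>z\<close>. On the segment to \<open>z'\<close> the derivative of this difference is O(|z' -
  z|), because the derivative of \<open>g\<close> is Lipschitz on \<open>K\<close>.\<close>

lemma smooth_taylor:
  fixes g :: "'a::euclidean_space \<Rightarrow> 'b::real_normed_vector"
  assumes "smooth_on g S" "K \<subseteq> S" "compact K" "convex K"
  shows "\<exists>C\<ge>0. \<forall>z\<in>K. \<forall>z'\<in>K.
    norm (g z' - g z - frechet_derivative g (at z) (z' - z)) \<le> C * (norm (z' - z))\<^sup>2"
proof -
  let ?D = "\<lambda>z. frechet_derivative g (at z)"
  have "\<exists>C\<ge>0. \<forall>z\<in>K. \<forall>z'\<in>K. norm (?D z' b - ?D z b) \<le> C * norm (z' - z)" for b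
    by (rule smooth_lipschitz[OF smooth_on_frechet_derivative[OF assms(1)] assms(2-4)])
  then obtain C where C: "\<And>b. C b \<ge> 0"
    "\<And>b z z'. z \<in> K \<Longrightarrow> z' \<in> K \<Longrightarrow> norm (?D z' b - ?D z b) \<le> C b * norm (z' - z)"
    by metis
  let ?C = "\<Sum>b\<in>Basis. C b"
  have lin: "linear (?D z)" if "z \<in> K" for z
    using that assms(1,2) linear_frechet_derivative smooth_on_differentiable by blast
  have D: "norm (?D z' v - ?D z v) \<le> ?C * norm (z' - z) * norm v" if z: "z \<in> K" "z' \<in> K" for z z' v
  proof -
    have "?D z' v - ?D z v = (\<Sum>b\<in>Basis. (v \<bullet> b) *\<^sub>R (?D z' b - ?D z b))"
      by (simp add: linear_euclidean_expansion[OF lin[OF z(1)], of v]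
          linear_euclidean_expansion[OF lin[OF z(2)], of v] scaleR_diff_right sum_subtractf)
    also have "norm \<dots> \<le> (\<Sum>b\<in>Basis. C b * norm (z' - z) * norm v)"
    proof (rule sum_norm_le)
      fix b :: 'a assume "b \<in> Basis"
      then have "\<bar>v \<bullet> b\<bar> * norm (?D z' b - ?D z b) \<le> norm v * (C b * norm (z' - z))"
        by (intro mult_mono C(2) z) (simp_all add: Basis_le_norm)
      then show "norm ((v \<bullet> b) *\<^sub>R (?D z' b - ?D z b)) \<le> C b * norm (z' - z) * norm v"
        by (simp add: mult_ac)
    qed
    finally show ?thesis by (simp add: sum_distrib_right)
  qed
  have "norm (g z' - g z - ?D z (z' - z)) \<le> ?C * (norm (z' - z))\<^sup>2" if z: "z \<in> K" "z' \<in> K" for z z'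
  proof -
    have seg: "closed_segment z z' \<subseteq> K" using z assms(4) by (simp add: closed_segment_subset)
    have "norm ((g z' - ?D z z') - (g z - ?D z z)) \<le> ?C * norm (z' - z) * norm (z' - z)"
    proof (rule differentiable_bound[where S = "closed_segment z z'"])
      fix y assume y: "y \<in> closed_segment z z'"
      then have yK: "y \<in> K" using seg by auto
      then have "(g has_derivative ?D y) (at y)"
        using smooth_on_has_derivative[OF assms(1)] assms(2) by blast
      then have "((\<lambda>y. g y - ?D z y) has_derivative (\<lambda>v. ?D y v - ?D z v)) (at y)"
        by (intro has_derivative_diff linear_imp_has_derivative lin z)
      then show "((\<lambda>y. g y - ?D z y) has_derivative (\<lambda>v. ?D y v - ?D z v)) (at y within closed_segment z z')"
        by (rule has_derivative_at_withinI)
      have "norm (y - z) \<le> norm (z' - z)" using segment_bound(1)[OF y] by simp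
      then have "?C * norm (y - z) * norm v \<le> ?C * norm (z' - z) * norm v" for v :: 'a
        by (intro mult_right_mono mult_left_mono sum_nonneg C) auto
      then show "onorm (\<lambda>v. ?D y v - ?D z v) \<le> ?C * norm (z' - z)"
        using D[OF z(1) yK] by (intro onorm_le) (meson order_trans)
    qed auto
    then show ?thesis by (simp add: linear_diff[OF lin[OF z(1)]] power2_eq_square algebra_simps)
  qed
  moreover have "?C \<ge> 0" by (simp add: C sum_nonneg)
  ultimately show ?thesis by blast
qed

text \<open>A form of Gronwall's inequality that suffices on short rays.\<close>

lemma small_growth_bound:
  fixes d :: "real \<Rightarrow> 'w::real_normed_vector"
  assumes "d 0 = 0" "\<And>t. t \<in> {0..1} \<Longrightarrow> (d has_vector_derivative d' t) (at t within {0..1})"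
    "\<And>t. t \<in> {0..1} \<Longrightarrow> norm (d' t) \<le> norm (d t) / 2 + m" "t \<in> {0..1}"
  shows "norm (d t) \<le> 2 * m"
proof -
  have "continuous_on {0..1} d"
    using assms(2) has_vector_derivative_continuous continuous_on_eq_continuous_within by blast
  then have "continuous_on {0..1} (\<lambda>t. norm (d t))" by (intro continuous_intros)
  \<comment> \<open>At a maximum of the norm of \<open>d\<close> the mean value inequality reads |d
    t0| \<le> |d t0| / 2 + m, since the interval has length one.\<close>
  then obtain t0 where t0: "t0 \<in> {0..1}" "\<And>t. t \<in> {0..1} \<Longrightarrow> norm (d t) \<le> norm (d t0)"
    using continuous_attains_sup[of "{0..1::real}" "\<lambda>t. norm (d t)"] by auto
  have "norm (d t0 - d 0) \<le> (norm (d t0) / 2 + m) * norm (t0 - 0)"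
  proof (rule differentiable_bound[where S = "{0..1}"])
    fix t :: real assume t: "t \<in> {0..1}"
    show "(d has_derivative (\<lambda>h. h *\<^sub>R d' t)) (at t within {0..1})"
      using assms(2)[OF t] by (simp add: has_vector_derivative_def)
    have "norm (d' t) \<le> norm (d t0) / 2 + m"
      using assms(3)[OF t] t0(2)[OF t] by linarith
    then show "onorm (\<lambda>h. h *\<^sub>R d' t) \<le> norm (d t0) / 2 + m"
      by (intro onorm_le) (simp add: mult.commute mult_left_mono)
  qed (use t0 in auto)
  also have "\<dots> \<le> (norm (d t0) / 2 + m) * 1"
  proof (rule mult_left_mono)
    have "0 \<le> norm (d' t0)" by simp
    then show "0 \<le> norm (d t0) / 2 + m" using assms(3)[OF t0(1)] by linarith
  qed (use t0 in auto)
  finally have "norm (d t0) \<le> 2 * m" using assms(1) by simp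
  then show ?thesis using t0(2)[OF assms(4)] by linarith
qed

text \<open>Along a solution of D\<phi>(a) = L(a, \<phi>(a)), the pair (k, L z k) is the velocity of
  the graph in direction k. So \<open>involutive\<close> says that the second derivative which the
  equation prescribes for \<phi> is symmetric.\<close>

locale total_differential_equation =
  fixes L :: "'v::euclidean_space \<times> 'w::euclidean_space \<Rightarrow> 'v \<Rightarrow> 'w" and S
  assumes S: "open S" "0 \<in> S"
    and linear_L: "\<And>z. z \<in> S \<Longrightarrow> linear (L z)"
    and smooth_L: "\<And>h. smooth_on (\<lambda>z. L z h) S"
    and involutive: "\<And>z h k. z \<in> S \<Longrightarrow>
      frechet_derivative (\<lambda>z. L z h) (at z) (k, L z k) = frechet_derivative (\<lambda>z. L z k) (at z) (h, L z h)"
begin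

abbreviation DL :: "'v \<Rightarrow> 'v \<times> 'w \<Rightarrow> 'v \<times> 'w \<Rightarrow> 'w" where
  "DL h z \<equiv> frechet_derivative (\<lambda>z. L z h) (at z)"

lemma L_has_derivative: "z \<in> S \<Longrightarrow> ((\<lambda>z. L z h) has_derivative DL h z) (at z)"
  by (rule smooth_on_has_derivative[OF smooth_L])

lemma linear_DL: "z \<in> S \<Longrightarrow> linear (DL h z)" "z \<in> S \<Longrightarrow> linear (\<lambda>h. DL h z \<zeta>)"
  using has_derivative_linear[OF L_has_derivative]
    linear_derivative_family[OF S(1) _ linear_L L_has_derivative] by blast+

lemma estimates:
  obtains \<rho> C where "\<rho> > 0" "C \<ge> 1" "cball 0 \<rho> \<times> cball 0 \<rho> \<subseteq> S"
    "\<And>z h. z \<in> cball 0 \<rho> \<times> cball 0 \<rho> \<Longrightarrow> norm (L z h) \<le> C * norm h"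
    "\<And>z h \<zeta>. z \<in> cball 0 \<rho> \<times> cball 0 \<rho> \<Longrightarrow> norm (DL h z \<zeta>) \<le> C * norm h * norm \<zeta>"
    "\<And>z z' h. z \<in> cball 0 \<rho> \<times> cball 0 \<rho> \<Longrightarrow> z' \<in> cball 0 \<rho> \<times> cball 0 \<rho> \<Longrightarrow>
      norm (L z' h - L z h) \<le> C * norm h * norm (z' - z)"
    "\<And>z z' h. z \<in> cball 0 \<rho> \<times> cball 0 \<rho> \<Longrightarrow> z' \<in> cball 0 \<rho> \<times> cball 0 \<rho> \<Longrightarrow>
      norm (L z' h - L z h - DL h z (z' - z)) \<le> C * norm h * (norm (z' - z))\<^sup>2"
proof -
  obtain \<epsilon> where \<epsilon>: "\<epsilon> > 0" "ball 0 \<epsilon> \<subseteq> S" using S open_contains_ball by blast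
  \<comment> \<open>A pair in the product of the two balls has norm at most 2 \<epsilon> / 3, hence
    lies in the ball of radius \<epsilon>.\<close>
  define \<rho> where "\<rho> = \<epsilon> / 3"
  let ?K = "cball 0 \<rho> \<times> cball 0 \<rho> :: ('v \<times> 'w) set"
  have \<rho>: "\<rho> > 0" using \<epsilon> by (simp add: \<rho>_def)
  have KS: "?K \<subseteq> S"
  proof
    fix z assume "z \<in> ?K"
    then have "norm z < \<epsilon>" using norm_Pair_le[of "fst z" "snd z"] \<epsilon>(1) by (auto simp: \<rho>_def)
    then show "z \<in> S" using \<epsilon>(2) by auto
  qed
  have K: "compact ?K" "convex ?K" by (auto intro: compact_Times convex_Times)
  have cont: "continuous_on ?K (\<lambda>z. L z h)" for h
    using continuous_on_subset[OF smooth_on_continuous[OF smooth_L] KS] .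
  obtain c0 where c0: "c0 \<ge> 0" "\<And>z h. z \<in> ?K \<Longrightarrow> norm (L z h) \<le> c0 * norm h"
    using continuous_family_bounded[OF K(1) linear_L[OF subsetD[OF KS]] cont] by blast
  obtain c1 where c1: "\<And>b. c1 b \<ge> 0" "\<And>b z \<zeta>. z \<in> ?K \<Longrightarrow> norm (DL b z \<zeta>) \<le> c1 b * norm \<zeta>"
    using smooth_derivative_bounded[OF smooth_L KS K(1)] by metis
  obtain c2 where c2: "\<And>b. c2 b \<ge> 0"
    "\<And>b z z'. z \<in> ?K \<Longrightarrow> z' \<in> ?K \<Longrightarrow> norm (L z' b - L z b) \<le> c2 b * norm (z' - z)"
    using smooth_lipschitz[OF smooth_L KS K] by metis
  obtain c3 where c3: "\<And>b. c3 b \<ge> 0"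
    "\<And>b z z'. z \<in> ?K \<Longrightarrow> z' \<in> ?K \<Longrightarrow> norm (L z' b - L z b - DL b z (z' - z)) \<le> c3 b * (norm (z' - z))\<^sup>2"
    using smooth_taylor[OF smooth_L KS K] by metis
  \<comment> \<open>The constants \<open>c1\<close>, \<open>c2\<close> and \<open>c3\<close> belong
    to a fixed second argument of \<open>L\<close>. Summing over the basis makes the bounds linear
    in \<open>h\<close>, and \<open>C\<close> dominates all the sums at once.\<close>
  have sum_bound: "norm (f h) \<le> (\<Sum>b\<in>Basis. c b) * norm h * m"
    if f: "linear f" "\<And>b. norm (f b) \<le> c b * m" for f :: "'v \<Rightarrow> 'w" and c m h
  proof -
    have "norm (f h) = norm (\<Sum>b\<in>Basis. (h \<bullet> b) *\<^sub>R f b)"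
      by (simp only: linear_euclidean_expansion[OF f(1), symmetric])
    also have "\<dots> \<le> (\<Sum>b\<in>Basis. c b * norm h * m)"
    proof (rule sum_norm_le)
      fix b :: 'v assume "b \<in> Basis"
      then have "\<bar>h \<bullet> b\<bar> * norm (f b) \<le> norm h * (c b * m)"
        by (intro mult_mono f(2)) (auto simp: Basis_le_norm)
      then show "norm ((h \<bullet> b) *\<^sub>R f b) \<le> c b * norm h * m" by (simp add: mult_ac)
    qed
    finally show ?thesis by (simp add: sum_distrib_right)
  qed
  define C where "C = 1 + c0 + (\<Sum>b\<in>Basis. c1 b) + (\<Sum>b\<in>Basis. c2 b) + (\<Sum>b\<in>Basis. c3 b)"
  have nn: "(\<Sum>b\<in>Basis. c1 b) \<ge> 0" "(\<Sum>b\<in>Basis. c2 b) \<ge> 0" "(\<Sum>b\<in>Basis. c3 b) \<ge> 0"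
    by (simp_all add: sum_nonneg c1 c2 c3)
  have C: "C \<ge> 1" "c0 \<le> C" "(\<Sum>b\<in>Basis. c1 b) \<le> C" "(\<Sum>b\<in>Basis. c2 b) \<le> C" "(\<Sum>b\<in>Basis. c3 b) \<le> C"
    using nn c0(1) by (simp_all add: C_def)
  have lift: "norm x \<le> C * norm h * m" if "norm x \<le> c * norm h * m" "c \<le> C" "m \<ge> 0"
    for x :: 'w and c h m
    using that(1) mult_right_mono[OF mult_right_mono[OF that(2), of "norm h"] that(3)] by simp
  show thesis
  proof (rule that[OF \<rho> C(1) KS])
    fix z h assume z: "z \<in> ?K"
    then have zS: "z \<in> S" using KS by auto
    show "norm (L z h) \<le> C * norm h"
      using c0(2)[OF z, of h] mult_right_mono[OF C(2), of "norm h"] by simp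
    show "norm (DL h z \<zeta>) \<le> C * norm h * norm \<zeta>" for \<zeta>
      by (rule lift[OF sum_bound[OF linear_DL(2)[OF zS] c1(2)[OF z]] C(3)]) simp
    fix z' assume z': "z' \<in> ?K"
    then have zS': "z' \<in> S" using KS by auto
    have l: "linear (\<lambda>h. L z' h - L z h)"
      by (intro linear_compose_sub linear_L zS zS')
    show "norm (L z' h - L z h) \<le> C * norm h * norm (z' - z)"
      by (rule lift[OF sum_bound[OF l c2(2)[OF z z']] C(4)]) simp
    show "norm (L z' h - L z h - DL h z (z' - z)) \<le> C * norm h * (norm (z' - z))\<^sup>2"
      by (rule lift[OF sum_bound[OF linear_compose_sub[OF l linear_DL(2)[OF zS]] c3(2)[OF z z']] C(5)]) simp
  qed
qed

lemma smooth_solution: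
  assumes U: "open U" and gr: "\<And>a. a \<in> U \<Longrightarrow> (a, \<phi> a) \<in> S"
    and der: "\<And>a. a \<in> U \<Longrightarrow> (\<phi> has_derivative L (a, \<phi> a)) (at a)"
  shows "smooth_on \<phi> U"
proof -
  have "Ck_on k \<phi> U" for k
  proof (induction k)
    case 0
    show ?case using has_derivative_continuous[OF der] by (auto intro: continuous_at_imp_continuous_on)
  next
    case (Suc k)
    show ?case
    proof (rule Ck_on_SucI[OF U der])
      fix h
      have "Ck_on k (\<lambda>a. (a, \<phi> a)) U"
        by (rule Ck_on_Pair[OF U Ck_on_linear[OF U bounded_linear_ident] Suc])
      then show "Ck_on k (\<lambda>a. L (a, \<phi> a) h) U"
        by (rule Ck_on_compose[where T = S and g = "\<lambda>z. L z h", rotated 3])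
          (use smooth_L S U gr in \<open>auto simp: smooth_on_def\<close>)
    qed
  qed
  then show ?thesis by (simp add: smooth_on_def)
qed

text \<open>Integrating the equation along rays turns it into a fixed point problem. That the solution
  along rays solves the full equation is the only place where involutivity is used: with
  \<open>\<delta>(t) = \<phi>(t(a + h)) - \<phi>(ta) - t L(h)\<close> it gives \<open>|\<delta>'| \<le> |\<delta>|/2 + O(|h|\<^sup>2)\<close>.\<close>

theorem solution:
  obtains r \<phi> where "r > 0" "smooth_on \<phi> (ball 0 r)" "\<phi> 0 = 0" "\<And>a. a \<in> ball 0 r \<Longrightarrow> (a, \<phi> a) \<in> S"
    "\<And>a. a \<in> ball 0 r \<Longrightarrow> (\<phi> has_derivative L (a, \<phi> a)) (at a)"
proof -
  obtain \<rho> C where \<rho>: "\<rho> > 0" and C: "C \<ge> 1" and KS: "cball 0 \<rho> \<times> cball 0 \<rho> \<subseteq> S"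
    and L0: "\<And>z h. z \<in> cball 0 \<rho> \<times> cball 0 \<rho> \<Longrightarrow> norm (L z h) \<le> C * norm h"
    and L1: "\<And>z h \<zeta>. z \<in> cball 0 \<rho> \<times> cball 0 \<rho> \<Longrightarrow> norm (DL h z \<zeta>) \<le> C * norm h * norm \<zeta>"
    and L2: "\<And>z z' h. z \<in> cball 0 \<rho> \<times> cball 0 \<rho> \<Longrightarrow> z' \<in> cball 0 \<rho> \<times> cball 0 \<rho> \<Longrightarrow>
      norm (L z' h - L z h) \<le> C * norm h * norm (z' - z)"
    and L3: "\<And>z z' h. z \<in> cball 0 \<rho> \<times> cball 0 \<rho> \<Longrightarrow> z' \<in> cball 0 \<rho> \<times> cball 0 \<rho> \<Longrightarrow>
      norm (L z' h - L z h - DL h z (z' - z)) \<le> C * norm h * (norm (z' - z))\<^sup>2"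
    by (rule estimates) blast
  let ?K = "cball 0 \<rho> \<times> cball 0 \<rho> :: ('v \<times> 'w) set"
  define r where "r = min (\<rho> / C) (1 / (2 * C))"
  have r: "r > 0" "C * r \<le> \<rho>" "C * r \<le> 1 / 2" using \<rho> C by (auto simp: r_def min_def field_simps)
  have "r \<le> C * r" using C r(1) by simp
  then have r\<rho>: "r \<le> \<rho>" using r(2) by linarith
  have contL: "continuous_on ?K (\<lambda>z. L z h)" for h
    using continuous_on_subset[OF smooth_on_continuous[OF smooth_L] KS] .
  \<comment> \<open>Retracting to the closed ball extends the integrand to all of \<open>'v\<close>,
    so that the fixed point can be sought in the complete space of bounded continuous
    functions.\<close>
  define \<pi> where "\<pi> = closest_point (cball 0 r :: 'v set)"
  have \<pi>: "\<pi> a \<in> cball 0 r" "norm (\<pi> a) \<le> r" for a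
    using closest_point_in_set[of "cball 0 r :: 'v set" a] r(1) by (auto simp: \<pi>_def)
  have \<pi>_self: "\<pi> a = a" if "a \<in> cball 0 r" for a
    using that by (simp add: \<pi>_def closest_point_self)
  have cont\<pi>: "continuous_on UNIV \<pi>"
    unfolding \<pi>_def by (rule continuous_on_closest_point) (use r in auto)
  define X where "X = {f :: 'v \<Rightarrow>\<^sub>C 'w. \<forall>a. f a \<in> cball 0 \<rho>}"
  define G where "G f a t = L (t *\<^sub>R \<pi> a, f (t *\<^sub>R \<pi> a)) (\<pi> a)" for f :: "'v \<Rightarrow> 'w" and a and t :: real
  have scaled: "t *\<^sub>R a \<in> cball 0 r" if "a \<in> cball 0 r" "t \<in> {0..1}" for t :: real and a :: 'v
    using that mult_mono[of "\<bar>t\<bar>" 1 "norm a" r] r(1) by auto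
  have inK: "(t *\<^sub>R a, f (t *\<^sub>R a)) \<in> ?K" if "f \<in> X" "a \<in> cball 0 r" "t \<in> {0..1}"
    for t :: real and a :: 'v and f :: "'v \<Rightarrow>\<^sub>C 'w"
    using scaled[OF that(2,3)] r\<rho> that(1) by (auto simp: X_def)
  have GL: "norm (G f a t) \<le> C * r" if "f \<in> X" "t \<in> {0..1}" for f :: "'v \<Rightarrow>\<^sub>C 'w" and a t
  proof -
    have "norm (G f a t) \<le> C * norm (\<pi> a)"
      unfolding G_def by (rule L0[OF inK[OF that(1) \<pi>(1) that(2)]])
    also have "\<dots> \<le> C * r" using C by (intro mult_left_mono \<pi>(2)) auto
    finally show ?thesis .
  qed
  have contG: "continuous_on (UNIV \<times> {0..1}) (\<lambda>(a, t). G f a t)" if f: "f \<in> X" for f :: "'v \<Rightarrow>\<^sub>C 'w"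
  proof -
    have z: "continuous_on (UNIV \<times> {0..1}) (\<lambda>(a, t). (t *\<^sub>R \<pi> a, f (t *\<^sub>R \<pi> a)))"
      unfolding split_beta
      by (intro continuous_on_Pair continuous_intros continuous_on_compose2[OF cont\<pi>]
          continuous_on_compose2[OF continuous_on_apply_bcontfun[of UNIV f]]) auto
    have c: "continuous_on (UNIV \<times> {0..1})
        (\<lambda>(a, t). \<Sum>b\<in>Basis. (\<pi> a \<bullet> b) *\<^sub>R L (t *\<^sub>R \<pi> a, f (t *\<^sub>R \<pi> a)) b)"
      unfolding split_beta
      by (intro continuous_on_sum continuous_on_scaleR continuous_on_inner continuous_on_const
          continuous_on_compose2[OF cont\<pi>] continuous_on_fst continuous_on_id
          continuous_on_compose2[OF contL z[unfolded split_beta]])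
        (use inK[OF f \<pi>(1)] in \<open>auto simp: mem_Times_iff\<close>)
    have "(\<Sum>b\<in>Basis. (\<pi> a \<bullet> b) *\<^sub>R L (t *\<^sub>R \<pi> a, f (t *\<^sub>R \<pi> a)) b) = G f a t"
      if "t \<in> {0..1}" for a t
    proof -
      have "(t *\<^sub>R \<pi> a, f (t *\<^sub>R \<pi> a)) \<in> S" using inK[OF f \<pi>(1)] KS that by auto
      from linear_euclidean_expansion[OF linear_L[OF this], of "\<pi> a"] show ?thesis by (simp add: G_def)
    qed
    then show ?thesis
      by (intro continuous_on_eq[OF c]) auto
  qed
  have contG': "continuous_on {0..1} (G f a)" if f: "f \<in> X" for f :: "'v \<Rightarrow>\<^sub>C 'w" and a
  proof -
    have "continuous_on {0..1} (\<lambda>t. (\<lambda>(a, t). G f a t) (a, t))"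
      by (rule continuous_on_compose2[OF contG[OF f]]) (auto intro!: continuous_intros)
    then show ?thesis by simp
  qed
  define \<Phi> where "\<Phi> f = Bcontfun (\<lambda>a. integral ({0..1}) (G (apply_bcontfun f) a))" for f :: "'v \<Rightarrow>\<^sub>C 'w"
  have bound: "norm (integral ({0..1}) (G f a)) \<le> C * r" if f: "f \<in> X" for f :: "'v \<Rightarrow>\<^sub>C 'w" and a
    using integral_bound[OF zero_le_one contG'[OF f], where B = "C * r"] GL[OF f] by simp
  have \<Phi>: "\<Phi> f a = integral ({0..1}) (G f a)" if f: "f \<in> X" for f :: "'v \<Rightarrow>\<^sub>C 'w" and a
  proof -
    have "continuous_on UNIV (\<lambda>a. integral ({0..1}) (G f a))"
      by (rule integral_continuous_on_param[where a = "0::real" and b = 1, unfolded box_real, OF contG[OF f]])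
    moreover have "bounded (range (\<lambda>a. integral ({0..1}) (G f a)))"
      using bound[OF f] unfolding bounded_iff by blast
    ultimately have "(\<lambda>a. integral ({0..1}) (G f a)) \<in> bcontfun" by (simp add: bcontfun_def)
    then show ?thesis by (simp add: \<Phi>_def Bcontfun_inverse)
  qed
  have "\<exists>!f\<in>X. \<Phi> f = f"
  proof (rule Banach_fix[where c = "1 / 2"])
    have "X = PiC UNIV (\<lambda>_. cball 0 \<rho>)" by (auto simp: X_def mem_PiC_iff Pi_iff)
    then have "closed X" using closed_PiC[of UNIV "\<lambda>_. cball 0 \<rho> :: 'w set"] by simp
    then show "complete X" by (simp add: complete_eq_closed)
    have "const_bcontfun 0 \<in> X" using \<rho> by (simp add: X_def const_bcontfun.rep_eq)
    then show "X \<noteq> {}" by blast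
    show "\<Phi> ` X \<subseteq> X"
    proof (rule image_subsetI)
      fix f assume f: "f \<in> X"
      have "norm (\<Phi> f a) \<le> \<rho>" for a
        unfolding \<Phi>[OF f] using bound[OF f, of a] r(2) by linarith
      then show "\<Phi> f \<in> X" by (simp add: X_def)
    qed
    show "dist (\<Phi> f) (\<Phi> g) \<le> 1 / 2 * dist f g" if fg: "f \<in> X" "g \<in> X" for f g
    proof (rule dist_bound)
      fix a
      have int: "G f a integrable_on {0..1}" "G g a integrable_on {0..1}"
        by (rule integrable_continuous_interval[OF contG'[OF fg(1)]] integrable_continuous_interval[OF contG'[OF fg(2)]])+
      have "dist (\<Phi> f a) (\<Phi> g a) = norm (integral ({0..1}) (\<lambda>t. G f a t - G g a t))"
        by (simp add: \<Phi>[OF fg(1)] \<Phi>[OF fg(2)] dist_norm integral_diff[OF int])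
      also have "\<dots> \<le> integral ({0..1}) (\<lambda>t::real. 1 / 2 * dist f g)"
      proof (rule integral_norm_bound_integral[OF integrable_diff[OF int] integrable_const[where a = "0::real" and b = 1, unfolded box_real]])
        fix t :: real assume t: "t \<in> {0..1}"
        let ?z = "(t *\<^sub>R \<pi> a, f (t *\<^sub>R \<pi> a))" and ?z' = "(t *\<^sub>R \<pi> a, g (t *\<^sub>R \<pi> a))"
        have "norm (G f a t - G g a t) \<le> C * norm (\<pi> a) * norm (?z - ?z')"
          unfolding G_def by (rule L2[OF inK[OF fg(2) \<pi>(1) t] inK[OF fg(1) \<pi>(1) t]])
        also have "norm (?z - ?z') = dist (f (t *\<^sub>R \<pi> a)) (g (t *\<^sub>R \<pi> a))"
          by (simp add: norm_Pair dist_norm)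
        also have "C * norm (\<pi> a) * \<dots> \<le> C * r * dist f g"
          using C \<pi>(2)[of a] r(1) by (intro mult_mono dist_bounded) auto
        also have "\<dots> \<le> 1 / 2 * dist f g" by (rule mult_right_mono[OF r(3)]) simp
        finally show "norm (G f a t - G g a t) \<le> 1 / 2 * dist f g" .
      qed
      also have "\<dots> = 1 / 2 * dist f g" by simp
      finally show "dist (\<Phi> f a) (\<Phi> g a) \<le> 1 / 2 * dist f g" .
    qed
  qed auto
  then obtain f where f: "f \<in> X" "\<Phi> f = f" by blast
  define \<phi> where "\<phi> = apply_bcontfun f"
  have cont\<phi>: "continuous_on T \<phi>" for T by (simp add: \<phi>_def)
  have K: "(t *\<^sub>R a, \<phi> (t *\<^sub>R a)) \<in> ?K" if "a \<in> cball 0 r" "t \<in> {0..1}" for a and t :: real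
    using inK[OF f(1) that] by (simp add: \<phi>_def)
  have K1: "(a, \<phi> a) \<in> ?K" if "a \<in> cball 0 r" for a
    using K[OF that, of 1] by simp
  have \<phi>: "\<phi> a = integral ({0..1}) (\<lambda>t. L (t *\<^sub>R a, \<phi> (t *\<^sub>R a)) a)" if "a \<in> cball 0 r" for a
    using \<Phi>[OF f(1), of a] f(2) \<pi>_self[OF that] by (simp add: \<phi>_def G_def[abs_def])
  have "L (0, \<phi> 0) 0 = 0"
    by (rule linear_0[OF linear_L]) (use subsetD[OF KS K1[of 0]] r(1) in simp)
  then have \<phi>0: "\<phi> 0 = 0" by (subst \<phi>) (use r(1) in simp_all)
  have ray: "((\<lambda>s. \<phi> (s *\<^sub>R a)) has_vector_derivative L (s *\<^sub>R a, \<phi> (s *\<^sub>R a)) a) (at s within {0..1})"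
    if a: "a \<in> cball 0 r" and s: "s \<in> {0..1}" for a s
  proof -
    let ?g = "\<lambda>t. L (t *\<^sub>R a, \<phi> (t *\<^sub>R a)) a"
    let ?F = "\<lambda>s. integral {0..s} ?g"
    have "continuous_on {0..1} ?g"
      using contG'[OF f(1), of a] \<pi>_self[OF a] by (simp add: \<phi>_def G_def[abs_def])
    then have F: "(?F has_vector_derivative ?g t) (at t within {0..1})" if "t \<in> {0..1}" for t
      using integral_has_vector_derivative that by blast
    \<comment> \<open>A substitution turns the fixed point equation at \<open>s *\<^sub>R a\<close>,
      an integral over [0, 1], into an integral over [0, s] along the ray through \<open>a\<close>,
      which can be differentiated in \<open>s\<close>.\<close>
    have eq: "\<phi> (s *\<^sub>R a) = ?F s" if s: "s \<in> {0..1}" for s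
    proof -
      have "((\<lambda>t. s *\<^sub>R ?g (s * t)) has_integral (?F (s * 1) - ?F (s * 0))) {0..1}"
      proof (rule fundamental_theorem_of_calculus)
        fix t :: real assume t: "t \<in> {0..1}"
        have im: "(*) s ` {0..1} \<subseteq> {0..1}" using s by (auto simp: mult_le_one)
        have "(?F \<circ> (*) s has_vector_derivative s *\<^sub>R ?g (s * t)) (at t within {0..1})"
        proof (rule vector_diff_chain_within)
          show "((*) s has_vector_derivative s) (at t within {0..1})"
            by (auto intro!: derivative_eq_intros simp: has_real_derivative_iff_has_vector_derivative[symmetric])
          show "(?F has_vector_derivative ?g (s * t)) (at (s * t) within (*) s ` {0..1})"
            by (rule has_vector_derivative_within_subset[OF F im]) (rule subsetD[OF im imageI[OF t]])
        qed
        then show "((\<lambda>t. ?F (s * t)) has_vector_derivative s *\<^sub>R ?g (s * t)) (at t within {0..1})"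
          by (simp add: comp_def)
      qed simp
      from integral_unique[OF this] have "integral {0..1} (\<lambda>t. s *\<^sub>R ?g (s * t)) = ?F s" by simp
      moreover have "integral {0..1} (\<lambda>t. s *\<^sub>R ?g (s * t)) = \<phi> (s *\<^sub>R a)"
      proof -
        have "L (t *\<^sub>R s *\<^sub>R a, \<phi> (t *\<^sub>R s *\<^sub>R a)) (s *\<^sub>R a) = s *\<^sub>R ?g (s * t)" if "t \<in> {0..1}" for t
        proof -
          have "(t *\<^sub>R s *\<^sub>R a, \<phi> (t *\<^sub>R s *\<^sub>R a)) \<in> S" using K[OF scaled[OF a s] that] KS by blast
          from linear_scale[OF linear_L[OF this], of s a] show ?thesis by (simp add: mult.commute)
        qed
        then show ?thesis
          unfolding \<phi>[OF scaled[OF a s]] by (intro integral_cong) simp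
      qed
      ultimately show ?thesis by simp
    qed
    show ?thesis
      by (rule has_vector_derivative_transform[OF s eq F[OF s]])
  qed
  have lin: "linear (L (t *\<^sub>R a, \<phi> (t *\<^sub>R a)))" if "a \<in> cball 0 r" "t \<in> {0..1}" for a and t :: real
    by (rule linear_L) (use K[OF that] KS in blast)
  \<comment> \<open>A first comparison of two neighbouring rays; it makes the Taylor remainders in
    \<open>quadratic\<close> of second order in \<open>h\<close>.\<close>
  have lipschitz: "norm (\<phi> (t *\<^sub>R (a + h)) - \<phi> (t *\<^sub>R a)) \<le> (1 + 2 * C) * norm h"
    if a: "a \<in> cball 0 r" "a + h \<in> cball 0 r" and t: "t \<in> {0..1}" for a h and t :: real
  proof -
    let ?d = "\<lambda>t. \<phi> (t *\<^sub>R (a + h)) - \<phi> (t *\<^sub>R a)"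
    let ?z = "\<lambda>t::real. (t *\<^sub>R a, \<phi> (t *\<^sub>R a))" and ?z' = "\<lambda>t::real. (t *\<^sub>R (a + h), \<phi> (t *\<^sub>R (a + h)))"
    have "norm (?d t) \<le> 2 * ((1 / 2 + C) * norm h)"
    proof (rule small_growth_bound[where d = ?d and d' = "\<lambda>t. L (?z' t) (a + h) - L (?z t) a"])
      fix t :: real assume t: "t \<in> {0..1}"
      show "(?d has_vector_derivative L (?z' t) (a + h) - L (?z t) a) (at t within {0..1})"
        by (intro has_vector_derivative_diff ray a t)
      have "L (?z' t) (a + h) - L (?z t) a = (L (?z' t) (a + h) - L (?z t) (a + h)) + L (?z t) h"
        by (simp add: linear_add[OF lin[OF a(1) t]])
      also have "norm \<dots> \<le> C * norm (a + h) * norm (?z' t - ?z t) + C * norm h"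
        by (rule norm_triangle_le[OF add_mono[OF L2[OF K[OF a(1) t] K[OF a(2) t]] L0[OF K[OF a(1) t]]]])
      also have "C * norm (a + h) * norm (?z' t - ?z t) \<le> 1 / 2 * (norm (?d t) + norm h)"
      proof (rule mult_mono)
        have "C * norm (a + h) \<le> C * r" using a(2) C by (intro mult_left_mono) auto
        then show "C * norm (a + h) \<le> 1 / 2" using r(3) by linarith
        have "?z' t - ?z t = (t *\<^sub>R h, ?d t)" by (simp add: scaleR_add_right)
        then have "norm (?z' t - ?z t) \<le> norm (t *\<^sub>R h) + norm (?d t)" by (simp only: norm_Pair_le)
        also have "norm (t *\<^sub>R h) \<le> norm h" using t by (simp add: mult_left_le_one_le)
        finally show "norm (?z' t - ?z t) \<le> norm (?d t) + norm h" by simp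
      qed auto
      finally show "norm (L (?z' t) (a + h) - L (?z t) a) \<le> norm (?d t) / 2 + (1 / 2 + C) * norm h"
        by (simp add: algebra_simps)
    qed (use t in auto)
    then show ?thesis by (simp add: algebra_simps)
  qed
  \<comment> \<open>Twice the coefficient of \<open>(norm h)\<^sup>2\<close> in the estimate of
    \<open>?\<delta>'\<close> below; the factor 2 is the one in
    \<open>small_growth_bound\<close>.\<close>
  define M where "M = 2 * (C * (2 + 2 * C) + C * r * (2 + 2 * C)\<^sup>2)"
  have M: "M > 0" using C r by (simp add: M_def add_pos_nonneg)
  have Meq: "M * x = 2 * ((C * (2 + 2 * C) + C * r * (2 + 2 * C)\<^sup>2) * x)" for x
    by (simp only: M_def mult.assoc[of 2])
  have quadratic: "norm (\<phi> (a + h) - \<phi> a - L (a, \<phi> a) h) \<le> M * (norm h)\<^sup>2"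
    if a: "a \<in> cball 0 r" "a + h \<in> cball 0 r" for a h
  proof -
    let ?z = "\<lambda>t::real. (t *\<^sub>R a, \<phi> (t *\<^sub>R a))" and ?z' = "\<lambda>t::real. (t *\<^sub>R (a + h), \<phi> (t *\<^sub>R (a + h)))"
    let ?d = "\<lambda>t. \<phi> (t *\<^sub>R (a + h)) - \<phi> (t *\<^sub>R a)"
    let ?\<delta> = "\<lambda>t. ?d t - t *\<^sub>R L (?z t) h"
    let ?\<delta>' = "\<lambda>t. L (?z' t) (a + h) - L (?z t) a - (t *\<^sub>R DL h (?z t) (a, L (?z t) a) + L (?z t) h)"
    have "norm (?\<delta> 1) \<le> 2 * ((C * (2 + 2 * C) + C * r * (2 + 2 * C)\<^sup>2) * (norm h)\<^sup>2)"
    proof (rule small_growth_bound[where d = ?\<delta> and d' = ?\<delta>'])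
      fix t :: real assume t: "t \<in> {0..1}"
      have zS: "?z t \<in> S" using K[OF a(1) t] KS by blast
      have "(?z has_vector_derivative (a, L (?z t) a)) (at t within {0..1})"
        by (intro has_vector_derivative_Pair ray a t) (auto intro!: derivative_eq_intros)
      from vector_derivative_diff_chain_within[OF this has_derivative_at_withinI[OF L_has_derivative[OF zS]]]
      have "((\<lambda>t. L (?z t) h) has_vector_derivative DL h (?z t) (a, L (?z t) a)) (at t within {0..1})"
        by (simp add: comp_def)
      then have "((\<lambda>t. t *\<^sub>R L (?z t) h) has_vector_derivative
          t *\<^sub>R DL h (?z t) (a, L (?z t) a) + 1 *\<^sub>R L (?z t) h) (at t within {0..1})"
        by (intro has_vector_derivative_scaleR) auto
      then show "(?\<delta> has_vector_derivative ?\<delta>' t) (at t within {0..1})"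
        by (intro has_vector_derivative_diff ray a t) simp
      let ?\<zeta> = "?z' t - ?z t"
      have \<zeta>: "?\<zeta> = (t *\<^sub>R h, ?d t)" by (simp add: scaleR_add_right)
      have "norm ?\<zeta> \<le> norm (t *\<^sub>R h) + norm (?d t)" unfolding \<zeta> by (rule norm_Pair_le)
      also have "\<dots> \<le> norm h + (1 + 2 * C) * norm h"
        using t by (intro add_mono lipschitz a t) (simp add: mult_left_le_one_le)
      finally have n\<zeta>: "norm ?\<zeta> \<le> (2 + 2 * C) * norm h" by (simp add: algebra_simps)
      let ?R = "L (?z' t) (a + h) - L (?z t) (a + h) - DL (a + h) (?z t) ?\<zeta>"
      have "?\<zeta> = t *\<^sub>R (h, L (?z t) h) + (0, ?\<delta> t)" unfolding \<zeta> by simp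
      then have "DL a (?z t) ?\<zeta> = t *\<^sub>R DL a (?z t) (h, L (?z t) h) + DL a (?z t) (0, ?\<delta> t)"
        by (simp only: linear_add[OF linear_DL(1)[OF zS]] linear_scale[OF linear_DL(1)[OF zS]])
      \<comment> \<open>Involutivity cancels t DL h (a, L a), which comes from differentiating t
        L(h), against t DL a (h, L h), which comes from the linear part of L in z. What remains is
        quadratic in \<open>h\<close> or linear in \<open>?\<delta> t\<close>.\<close>
      then have eq: "?\<delta>' t = ?R + DL h (?z t) ?\<zeta> + DL a (?z t) (0, ?\<delta> t)"
        unfolding involutive[OF zS, of h a] linear_add[OF linear_DL(2)[OF zS], of a h]
          linear_add[OF lin[OF a(1) t], of a h] by simp
      have Ca: "C * norm b \<le> C * r" if "b \<in> cball 0 r" for b :: 'v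
        using that C by (intro mult_left_mono) auto
      have "norm ?R \<le> C * norm (a + h) * (norm ?\<zeta>)\<^sup>2"
        by (rule L3[OF K[OF a(1) t] K[OF a(2) t]])
      also have "\<dots> \<le> C * r * ((2 + 2 * C) * norm h)\<^sup>2"
        by (rule mult_mono[OF Ca[OF a(2)] power_mono[OF n\<zeta>]]) (use C r(1) in auto)
      finally have b1: "norm ?R \<le> C * r * ((2 + 2 * C) * norm h)\<^sup>2" .
      have "norm (DL h (?z t) ?\<zeta>) \<le> C * norm h * norm ?\<zeta>"
        by (rule L1[OF K[OF a(1) t]])
      also have "\<dots> \<le> C * norm h * ((2 + 2 * C) * norm h)"
        by (rule mult_left_mono[OF n\<zeta>]) (use C in auto)
      finally have b2: "norm (DL h (?z t) ?\<zeta>) \<le> C * norm h * ((2 + 2 * C) * norm h)" .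
      have "norm (DL a (?z t) (0, ?\<delta> t)) \<le> C * norm a * norm (0 :: 'v, ?\<delta> t)"
        by (rule L1[OF K[OF a(1) t]])
      also have "norm (0 :: 'v, ?\<delta> t) = norm (?\<delta> t)" by (simp add: norm_Pair)
      also have "C * norm a * norm (?\<delta> t) \<le> 1 / 2 * norm (?\<delta> t)"
        using Ca[OF a(1)] r(3) by (intro mult_right_mono) auto
      finally have b3: "norm (DL a (?z t) (0, ?\<delta> t)) \<le> 1 / 2 * norm (?\<delta> t)" .
      have "norm (?\<delta>' t) \<le>
          C * r * ((2 + 2 * C) * norm h)\<^sup>2 + C * norm h * ((2 + 2 * C) * norm h) + 1 / 2 * norm (?\<delta> t)"
        unfolding eq by (rule norm_triangle_le[OF add_mono[OF norm_triangle_le[OF add_mono[OF b1 b2]] b3]])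
      also have "\<dots> = norm (?\<delta> t) / 2 + (C * (2 + 2 * C) + C * r * (2 + 2 * C)\<^sup>2) * (norm h)\<^sup>2"
        by (simp only: power2_eq_square) (simp add: algebra_simps)
      finally show "norm (?\<delta>' t) \<le> norm (?\<delta> t) / 2 + (C * (2 + 2 * C) + C * r * (2 + 2 * C)\<^sup>2) * (norm h)\<^sup>2" .
    qed auto
    then show ?thesis unfolding Meq by simp
  qed
  have der: "(\<phi> has_derivative L (a, \<phi> a)) (at a)" if a: "a \<in> ball 0 r" for a
    unfolding has_derivative_at_alt
  proof (intro conjI allI impI)
    have "(a, \<phi> a) \<in> S" using K1[of a] a KS by auto
    then show "bounded_linear (L (a, \<phi> a))" using linear_L by (simp add: linear_conv_bounded_linear)
    fix e :: real assume e: "e > 0"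
    show "\<exists>d>0. \<forall>y. norm (y - a) < d \<longrightarrow> norm (\<phi> y - \<phi> a - L (a, \<phi> a) (y - a)) \<le> e * norm (y - a)"
    proof (intro exI[of _ "min (r - norm a) (e / M)"] conjI allI impI)
      show "0 < min (r - norm a) (e / M)" using a e M by simp
      fix y assume y: "norm (y - a) < min (r - norm a) (e / M)"
      have "norm y \<le> norm (y - a) + norm a" using norm_triangle_sub by (metis add.commute)
      then have "a + (y - a) \<in> cball 0 r" using y by simp
      with a have "norm (\<phi> (a + (y - a)) - \<phi> a - L (a, \<phi> a) (y - a)) \<le> M * (norm (y - a))\<^sup>2"
        by (intro quadratic) auto
      also have "\<dots> \<le> e * norm (y - a)"
      proof -
        have "M * norm (y - a) \<le> e" using y M by (simp add: field_simps)
        from mult_right_mono[OF this, of "norm (y - a)"] show ?thesis by (simp add: power2_eq_square mult.assoc)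
      qed
      finally show "norm (\<phi> y - \<phi> a - L (a, \<phi> a) (y - a)) \<le> e * norm (y - a)" by simp
    qed
  qed
  have inS: "(a, \<phi> a) \<in> S" if "a \<in> ball 0 r" for a using K1[of a] KS that by auto
  show thesis
    by (rule that[OF r(1) smooth_solution[OF open_ball inS der] \<phi>0 inS der])
qed

end

subsection \<open>The Frobenius theorem\<close>

lemma dform_compose_linear:
  assumes "bounded_linear h" "\<And>w. (\<lambda>q. \<beta> q w) differentiable (at p)"
  shows "dform (\<lambda>q w. h (\<beta> q w)) p v w = h (dform \<beta> p v w)"
proof -
  have *: "((\<lambda>q. h (\<beta> q w)) has_derivative (\<lambda>v. h (frechet_derivative (\<lambda>q. \<beta> q w) (at p) v))) (at p)" for w
    by (rule bounded_linear.has_derivative[OF assms(1)]) (simp add: assms(2) frechet_derivative_works[symmetric])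
  show ?thesis
    by (subst dform_eqI[OF * *]) (simp add: dform_def linear_diff[OF bounded_linear.linear[OF assms(1)]])
qed

text \<open>In the affine coordinates \<Psi> given by the frame at \<open>p0\<close>, the
  distribution is V at the origin. It is the kernel of \<psi>, the \<open>snd\<close> part of the
  pulled-back coframe, and hence the graph of L(z) as long as \<open>N z\<close> is injective;
  \<open>N 0\<close> is the identity.\<close>

theorem frobenius_coframe:
  fixes \<sigma> :: "'e::euclidean_space \<Rightarrow> 'v::euclidean_space \<times> 'w::euclidean_space \<Rightarrow> 'e"
  assumes S: "open S" "p0 \<in> S"
    and lin: "\<And>p. p \<in> S \<Longrightarrow> linear (\<sigma> p)" and bij: "\<And>p. p \<in> S \<Longrightarrow> bij (\<sigma> p)"
    and smooth: "\<And>t. smooth_on (\<lambda>p. \<sigma> p t) S"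
    and closed: "\<And>p v w. p \<in> S \<Longrightarrow> snd (dform (\<lambda>p. inv (\<sigma> p)) p (\<sigma> p (v, 0)) (\<sigma> p (w, 0))) = 0"
  obtains r and f :: "'v \<Rightarrow> 'e" where "r > 0" "smooth_on f (ball 0 r)" "f 0 = p0" "f ` ball 0 r \<subseteq> S" "inj_on f (ball 0 r)"
    "\<forall>y\<in>ball 0 r. inj (frechet_derivative f (at y)) \<and>
      range (frechet_derivative f (at y)) = range (\<lambda>v. \<sigma> (f y) (v, 0))"
proof -
  let ?\<theta> = "\<lambda>p. inv (\<sigma> p)"
  have lin\<theta>: "linear (?\<theta> p)" if "p \<in> S" for p by (rule linear_inv_family[OF S(1) lin bij that])
  have smooth\<theta>: "smooth_on (\<lambda>p. ?\<theta> p \<xi>) S" for \<xi> by (rule smooth_on_inv_family[OF S(1) lin bij smooth])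
  have \<theta>\<sigma>: "?\<theta> p (\<sigma> p t) = t" "\<sigma> p (?\<theta> p \<xi>) = \<xi>" if "p \<in> S" for p t \<xi>
    using bij[OF that] by (simp_all add: bij_def surj_f_inv_f)
  let ?T = "\<sigma> p0"
  have T: "linear ?T" "bounded_linear ?T" "inj ?T"
    using lin[OF S(2)] bij[OF S(2)] by (auto simp: linear_conv_bounded_linear bij_def)
  define \<Psi> where "\<Psi> z = p0 + ?T z" for z
  define S1 where "S1 = \<Psi> -` S"
  have D\<Psi>: "(\<Psi> has_derivative ?T) (at z)" for z
    unfolding \<Psi>_def[abs_def]
    using has_derivative_add[OF has_derivative_const bounded_linear_imp_has_derivative[OF T(2)]] by simp
  have smooth\<Psi>: "open V \<Longrightarrow> smooth_on \<Psi> V" for V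
    unfolding \<Psi>_def[abs_def] by (rule smooth_on_add[OF _ smooth_on_const smooth_on_linear[OF _ T(2)]])
  have S1: "open S1"
    unfolding S1_def
    by (rule continuous_open_vimage[OF S(1)]) (use D\<Psi> has_derivative_continuous in blast)
  have S1_0: "0 \<in> S1" by (simp add: S1_def \<Psi>_def linear_0[OF T(1)] S(2))
  have S1D: "\<Psi> z \<in> S" if "z \<in> S1" for z using that by (simp add: S1_def)
  define M where "M z \<xi> = ?\<theta> (\<Psi> z) (?T \<xi>)" for z \<xi>
  define \<psi> where "\<psi> z \<xi> = snd (M z \<xi>)" for z \<xi>
  define N where "N z \<xi> = (fst \<xi>, \<psi> z \<xi>)" for z \<xi>
  have linM: "linear (M z)" if "z \<in> S1" for z
    unfolding M_def[abs_def] using linear_compose[OF T(1) lin\<theta>[OF S1D[OF that]]] by (simp add: comp_def)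
  have lin\<psi>: "linear (\<psi> z)" if "z \<in> S1" for z
    unfolding \<psi>_def[abs_def] using linear_compose[OF linM[OF that] linear_snd] by (simp add: comp_def)
  have linN: "linear (N z)" if "z \<in> S1" for z
    unfolding N_def[abs_def]
    by (intro linearI) (simp_all add: linear_add[OF lin\<psi>[OF that]] linear_scale[OF lin\<psi>[OF that]])
  have smoothM: "smooth_on (\<lambda>z. M z \<xi>) S1" for \<xi>
    unfolding M_def
    by (rule smooth_on_compose[where T = S and f = \<Psi>]) (use S1 S(1) S1D smooth\<Psi> smooth\<theta> in auto)
  have smooth\<psi>: "smooth_on (\<lambda>z. \<psi> z \<xi>) S1" for \<xi>
    unfolding \<psi>_def by (rule smooth_on_compose_linear[OF S1 bounded_linear_snd smoothM])
  have smoothN: "smooth_on (\<lambda>z. N z \<xi>) S1" for \<xi>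
    unfolding N_def by (rule smooth_on_Pair[OF S1 smooth_on_const[OF S1] smooth\<psi>])
  have "M 0 \<xi> = \<xi>" for \<xi> using \<theta>\<sigma>(1)[OF S(2)] by (simp add: M_def \<Psi>_def linear_0[OF T(1)])
  then have "N 0 = id" by (simp add: N_def[abs_def] \<psi>_def fun_eq_iff)
  then have "inj (N 0)" by simp
  then obtain U where U: "open U" "0 \<in> U" "U \<subseteq> S1" and injN: "\<And>z. z \<in> U \<Longrightarrow> inj (N z)"
    using linear_family_inj_nhd[OF S1 linN smooth_on_continuous[OF smoothN] S1_0] by blast
  have U1: "z \<in> S1" if "z \<in> U" for z using U(3) that by blast
  have linN': "linear (N z)" if "z \<in> U" for z by (rule linN[OF U1[OF that]])
  have bijN: "bij (N z)" if "z \<in> U" for z by (rule linear_bij_finite[OF linN'[OF that] injN[OF that]])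
  define L where "L z h = snd (inv (N z) (h, 0))" for z h
  have N_inv: "N z (inv (N z) \<xi>) = \<xi>" "inv (N z) (N z \<xi>) = \<xi>" if "z \<in> U" for z \<xi>
    using bijN[OF that] by (simp_all add: bij_def surj_f_inv_f)
  have graph: "inv (N z) (h, 0) = (h, L z h)" if "z \<in> U" for z h
    using N_inv(1)[OF that, of "(h, 0)"] by (simp add: L_def N_def prod_eq_iff)
  have \<psi>_graph: "\<psi> z (h, L z h) = 0" if "z \<in> U" for z h
    using N_inv(1)[OF that, of "(h, 0)"] unfolding graph[OF that] by (simp add: N_def)
  have \<psi>_ker: "snd \<xi> = L z (fst \<xi>)" if "z \<in> U" "\<psi> z \<xi> = 0" for z \<xi>
  proof -
    have "N z \<xi> = (fst \<xi>, 0)" using that(2) by (simp add: N_def)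
    then have "inv (N z) (fst \<xi>, 0) = \<xi>" using N_inv(2)[OF that(1), of \<xi>] by simp
    then show ?thesis by (simp add: L_def)
  qed
  have linL: "linear (L z)" if "z \<in> U" for z
  proof -
    have "linear (inv (N z))" by (rule linear_inv_family[OF U(1) linN' bijN that])
    then show ?thesis
      unfolding L_def[abs_def]
      by (auto intro!: linearI simp: linear_add[symmetric] linear_scale[symmetric] snd_add[symmetric] snd_scaleR[symmetric]
          simp del: snd_add snd_scaleR)
  qed
  have smoothL: "smooth_on (\<lambda>z. L z h) U" for h
    unfolding L_def
    by (rule smooth_on_compose_linear[OF U(1) bounded_linear_snd smooth_on_inv_family[OF U(1) linN' bijN
            smooth_on_subset[OF smoothN U(3)]]])
  interpret L: total_differential_equation L U
  proof (rule total_differential_equation.intro[OF U(1,2) linL smoothL])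
    fix z h k assume z: "z \<in> U"
    then have z1: "z \<in> S1" using U by auto
    let ?DL = "\<lambda>h. frechet_derivative (\<lambda>z. L z h) (at z)"
    let ?D\<psi> = "\<lambda>\<xi>. frechet_derivative (\<lambda>z. \<psi> z \<xi>) (at z)"
    \<comment> \<open>Differentiating the identity \<psi>(h, L h) = 0 trades derivatives of \<psi>
      for derivatives of L.\<close>
    have key: "?D\<psi> (h, L z h) \<zeta> = - \<psi> z (0, ?DL h \<zeta>)" for h \<zeta>
    proof -
      have "((\<lambda>z. \<psi> z (h, L z h)) has_derivative
          (\<lambda>\<zeta>. ?D\<psi> (h, L z h) \<zeta> + \<psi> z (0, ?DL h \<zeta>))) (at z)"
      proof (rule has_derivative_apply[OF S1 z1 lin\<psi> smooth_on_has_derivative[OF smooth\<psi> z1]])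
        show "((\<lambda>z. (h, L z h)) has_derivative (\<lambda>\<zeta>. (0, ?DL h \<zeta>))) (at z)"
          by (rule has_derivative_Pair[OF has_derivative_const smooth_on_has_derivative[OF smoothL z]])
      qed
      moreover have "((\<lambda>z. \<psi> z (h, L z h)) has_derivative (\<lambda>\<zeta>. 0)) (at z)"
        by (rule has_derivative_transform_within_open[OF has_derivative_const U(1) z]) (simp add: \<psi>_graph)
      ultimately have "(\<lambda>\<zeta>. ?D\<psi> (h, L z h) \<zeta> + \<psi> z (0, ?DL h \<zeta>)) = (\<lambda>\<zeta>. 0)"
        by (rule has_derivative_unique)
      from fun_cong[OF this, of \<zeta>] show ?thesis by (simp add: eq_neg_iff_add_eq_0)
    qed
    have closed\<psi>: "dform \<psi> z \<xi> \<eta> = 0" if "\<psi> z \<xi> = 0" "\<psi> z \<eta> = 0" for \<xi> \<eta>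
    proof -
      have Tv: "?T \<xi> = \<sigma> (\<Psi> z) (fst (M z \<xi>), 0)" if "\<psi> z \<xi> = 0" for \<xi>
      proof -
        have "(fst (M z \<xi>), 0) = M z \<xi>" using that by (simp add: \<psi>_def prod_eq_iff)
        then show ?thesis using \<theta>\<sigma>(2)[OF S1D[OF z1]] by (simp add: M_def)
      qed
      have DT: "frechet_derivative \<Psi> (at y) = ?T" for y by (rule frechet_derivative_at[OF D\<Psi>, symmetric])
      have "dform M z \<xi> \<eta> = dform ?\<theta> (\<Psi> z) (?T \<xi>) (?T \<eta>)"
        using dform_pullback[OF S1 smooth\<Psi>[OF S1] z1 lin\<theta>[OF S1D] smooth_on_differentiable[OF smooth\<theta> S1D[OF z1]]]
        unfolding DT M_def[abs_def] .
      then have "snd (dform M z \<xi> \<eta>) = 0"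
        using closed[OF S1D[OF z1]] Tv[OF that(1)] Tv[OF that(2)] by simp
      then show ?thesis
        unfolding \<psi>_def[abs_def]
          dform_compose_linear[OF bounded_linear_snd smooth_on_differentiable[OF smoothM z1]] .
    qed
    \<comment> \<open>On two graph vectors the exterior derivative is the defect of involutivity,
      seen through \<psi>(0, _). This map is injective because the kernel of \<psi> is a graph over
      the first factor.\<close>
    have "dform \<psi> z (k, L z k) (h, L z h) = 0" by (rule closed\<psi>[OF \<psi>_graph[OF z] \<psi>_graph[OF z]])
    then have "\<psi> z (0, ?DL k (h, L z h)) - \<psi> z (0, ?DL h (k, L z k)) = 0"
      unfolding dform_def key by simp
    then have "\<psi> z (0, ?DL k (h, L z h) - ?DL h (k, L z k)) = 0"
      using linear_diff[OF lin\<psi>[OF z1], of "(0, ?DL k (h, L z h))" "(0, ?DL h (k, L z k))"] by simp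
    from \<psi>_ker[OF z this] have "?DL k (h, L z h) - ?DL h (k, L z k) = 0"
      by (simp add: linear_0[OF linL[OF z]])
    then show "?DL h (k, L z k) = ?DL k (h, L z h)" by simp
  qed
  obtain r \<phi> where r: "r > 0" and \<phi>: "smooth_on \<phi> (ball 0 r)" "\<phi> 0 = 0" "\<And>a. a \<in> ball 0 r \<Longrightarrow> (a, \<phi> a) \<in> U"
    and D\<phi>: "\<And>a. a \<in> ball 0 r \<Longrightarrow> (\<phi> has_derivative L (a, \<phi> a)) (at a)"
    by (rule L.solution) blast
  define f where "f y = \<Psi> (y, \<phi> y)" for y
  have Df: "frechet_derivative f (at y) = (\<lambda>h. ?T (h, L (y, \<phi> y) h))" if "y \<in> ball 0 r" for y
  proof (rule frechet_derivative_at[symmetric])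
    show "(f has_derivative (\<lambda>h. ?T (h, L (y, \<phi> y) h))) (at y)"
      unfolding f_def[abs_def]
      by (rule has_derivative_compose[OF has_derivative_Pair[OF has_derivative_ident D\<phi>[OF that]] D\<Psi>])
  qed
  show thesis
  proof (rule that[OF r])
    show "smooth_on f (ball 0 r)"
      unfolding f_def[abs_def]
      by (rule smooth_on_compose[where T = UNIV and g = \<Psi>])
        (use smooth_on_Pair[OF open_ball smooth_on_linear[OF open_ball bounded_linear_ident] \<phi>(1)] smooth\<Psi> in auto)
    show "f 0 = p0" by (simp add: f_def \<phi>(2) \<Psi>_def linear_0[OF T(1)] flip: zero_prod_def)
    show "f ` ball 0 r \<subseteq> S" by (rule image_subsetI) (simp only: f_def S1D[OF U1[OF \<phi>(3)]])
    show "inj_on f (ball 0 r)"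
      by (rule inj_onI) (use injD[OF T(3)] in \<open>auto simp: f_def \<Psi>_def\<close>)
    show "\<forall>y\<in>ball 0 r. inj (frechet_derivative f (at y)) \<and>
        range (frechet_derivative f (at y)) = range (\<lambda>v. \<sigma> (f y) (v, 0))"
    proof (intro ballI conjI)
      fix y assume y: "y \<in> ball (0::'v) r"
      let ?z = "(y, \<phi> y)"
      have z: "?z \<in> U" "?z \<in> S1" "\<Psi> ?z \<in> S" using \<phi>(3)[OF y] U(3) S1D by auto
      show "inj (frechet_derivative f (at y))"
        unfolding Df[OF y] by (rule injI) (use injD[OF T(3)] in auto)
      show "range (frechet_derivative f (at y)) = range (\<lambda>v :: 'v. \<sigma> (f y) (v, 0))"
      proof (intro equalityI subsetI)
        fix \<xi> assume "\<xi> \<in> range (frechet_derivative f (at y))"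
        then obtain h where h: "\<xi> = ?T (h, L ?z h)" unfolding Df[OF y] by blast
        have "M ?z (h, L ?z h) = (fst (M ?z (h, L ?z h)), 0)"
          using \<psi>_graph[OF z(1), of h] by (simp add: \<psi>_def prod_eq_iff)
        then have "\<xi> = \<sigma> (f y) (fst (M ?z (h, L ?z h)), 0)"
          using \<theta>\<sigma>(2)[OF z(3), of \<xi>] unfolding M_def h[symmetric] f_def by metis
        then show "\<xi> \<in> range (\<lambda>v :: 'v. \<sigma> (f y) (v, 0))" by blast
      next
        fix \<xi> assume "\<xi> \<in> range (\<lambda>v :: 'v. \<sigma> (f y) (v, 0))"
        then obtain v where v: "\<xi> = \<sigma> (\<Psi> ?z) (v, 0)" unfolding f_def by blast
        obtain \<eta> where \<eta>: "\<xi> = ?T \<eta>" using bij[OF S(2)] by (metis bij_pointE)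
        have "\<psi> ?z \<eta> = 0" using \<theta>\<sigma>(1)[OF z(3), of "(v, 0)"] by (simp add: \<psi>_def M_def \<eta>[symmetric] v)
        from \<psi>_ker[OF z(1) this] have "\<eta> = (fst \<eta>, L ?z (fst \<eta>))" by (simp add: prod_eq_iff)
        then show "\<xi> \<in> range (frechet_derivative f (at y))" unfolding Df[OF y] \<eta> by (metis rangeI)
      qed
    qed
  qed
qed

subsection \<open>Integrability\<close>

context Q_structure
begin

lemma associated_distribution_section:
  assumes "local_section A P U s" "y \<in> U"
  shows "associated_distribution P y = range (\<lambda>v. s y (v, 0))"
proof -
  have "associated_distribution P y = (\<Union>g\<in>Q_group. s y ` (g ` V_sub))"
    unfolding associated_distribution_def P_orbit[OF local_sectionD(2)[OF assms]] by (auto simp: image_comp)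
  also have "\<dots> = s y ` V_sub" using id_Q_group by (auto simp: Q_group_def)
  also have "\<dots> = range (\<lambda>v. s y (v, 0))" by (auto simp: V_sub_def)
  finally show ?thesis .
qed

text \<open>Brings the torsion into the form to which \<open>frobenius_coframe\<close> applies, and
  from which its smooth dependence on the point can be read off.\<close>

lemma intrinsic_torsion_chart:
  assumes s: "local_section A P U s" and c: "c \<in> A" and p: "p \<in> snd c ` (fst c \<inter> U)"
  shows "intrinsic_torsion A P (chart_inv c p) (s (chart_inv c p)) v w =
    snd (dform (\<lambda>p. inv (local_frame c s p)) p (local_frame c s p (v, 0)) (local_frame c s p (w, 0)))"
proof -
  interpret section_on A U s by (rule section_on[OF s])
  obtain y where y: "y \<in> fst c" "y \<in> U" "p = snd c y" using p by auto
  note cy = charts_atI[OF c y(1)]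
  have tan: "s y t \<in> tangent_space A y" for t by (rule framesD(4)[OF frame[OF y(2)]])
  have "dform (local_form A (\<lambda>y. inv (s y)) c) p = dform (\<lambda>p. inv (local_frame c s p)) p"
    by (rule dform_cong[OF open_image[OF c] p])
      (use local_frame(3)[OF c] smooth_on_differentiable[OF smooth_one_form_onD(2)[OF smooth_coframe c] p] in auto)
  then have "ext_deriv A (\<lambda>y. inv (s y)) y (s y (v, 0)) (s y (w, 0)) =
      dform (\<lambda>p. inv (local_frame c s p)) p (local_frame c s p (v, 0)) (local_frame c s p (w, 0))"
    using ext_deriv_chart[OF smooth_coframe y(2) cy tan tan] y c by (simp add: local_frame_def)
  then show ?thesis using intrinsic_torsion_section[OF s y(2)] y c by simp
qed

theorem torsion_free_imp_integrable:
  assumes zero: "\<And>x u. u \<in> P x \<Longrightarrow> intrinsic_torsion A P x u = (\<lambda>v w. 0)"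
  shows "integrable_distribution TYPE('n V) A (associated_distribution P)"
  unfolding integrable_distribution_def
proof
  fix x
  obtain U s where s: "local_section A P U s" and x: "x \<in> U"
    using G_structure unfolding G_structure_def by metis
  interpret section_on A U s by (rule section_on[OF s])
  let ?c = "some_chart A x"
  note cx = charts_atD[OF some_chart, of x]
  let ?O = "snd ?c ` (fst ?c \<inter> U)"
  have O: "open ?O" "snd ?c x \<in> ?O" using open_image[OF cx(1)] cx x by auto
  have sec: "s (chart_inv ?c p) \<in> P (chart_inv ?c p)" if "p \<in> ?O" for p
    using local_sectionD(2)[OF s] that cx by auto
  have closed: "snd (dform (\<lambda>p. inv (local_frame ?c s p)) p (local_frame ?c s p (v, 0)) (local_frame ?c s p (w, 0))) = 0"
    if "p \<in> ?O" for p v w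
    unfolding intrinsic_torsion_chart[OF s cx(1) that, symmetric] zero[OF sec[OF that]] ..
  obtain r and f :: "'n V \<Rightarrow> 'e" where r: "r > 0" and f: "smooth_on f (ball 0 r)" "f 0 = snd ?c x" "f ` ball 0 r \<subseteq> ?O" "inj_on f (ball 0 r)"
    and Df: "\<forall>y\<in>ball 0 r. inj (frechet_derivative f (at y)) \<and>
      range (frechet_derivative f (at y)) = range (\<lambda>v. local_frame ?c s (f y) (v, 0))"
    by (rule frobenius_coframe[OF O local_frame(1)[OF cx(1)] local_frame(2)[OF cx(1)] smooth_local_frame[OF cx(1)] closed]) blast
  have inj: "inj (frechet_derivative f (at y))"
    and rng: "range (frechet_derivative f (at y)) = range (\<lambda>v. local_frame ?c s (f y) (v, 0))"
    if "y \<in> ball 0 r" for y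
    using Df that by blast+
  let ?S = "ball (0 :: 'n V) r" and ?f = "\<lambda>y. chart_inv ?c (f y)"
  have fy: "?f y \<in> fst ?c" "?f y \<in> U" "snd ?c (?f y) = f y" if "y \<in> ?S" for y
    using f(3) that cx by fastforce+
  have contf: "continuous_on ?S ?f"
    by (rule continuous_on_compose2[OF continuous_on_chart_inv[OF cx(1)] smooth_on_continuous[OF f(1)]]) (use f(3) in auto)
  have smooth: "smooth_on (snd c' \<circ> ?f) (?S \<inter> ?f -` fst c')" if c': "c' \<in> A" for c'
  proof -
    have op: "open (?S \<inter> ?f -` fst c')"
      by (rule continuous_open_preimage[OF contf open_ball open_chart[OF c']])
    have "smooth_on (\<lambda>y. change ?c c' (f y)) (?S \<inter> ?f -` fst c')"
    proof (rule smooth_on_compose[OF op open_chart_image[OF cx(1) open_chart[OF c']] _ _ smooth_change[OF cx(1) c']])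
      show "f ` (?S \<inter> ?f -` fst c') \<subseteq> snd ?c ` (fst ?c \<inter> fst c')"
        using fy by (force intro!: image_eqI)
      show "smooth_on f (?S \<inter> ?f -` fst c')" by (rule smooth_on_subset[OF f(1)]) auto
    qed
    then show ?thesis by (simp add: comp_def)
  qed
  \<comment> \<open>A tangent vector has components in all charts around the point; the chain rule
    identifies the one in any chart with what \<open>?c\<close> determines.\<close>
  have push: "pushforward A ?f y h = tvec_of A ?c (?f y) (frechet_derivative f (at y) h)" if y: "y \<in> ?S" for y h
  proof
    fix c'
    show "pushforward A ?f y h c' = tvec_of A ?c (?f y) (frechet_derivative f (at y) h) c'"
    proof (cases "c' \<in> charts_at A (?f y)")
      case True
      have "((\<lambda>y. change ?c c' (f y)) has_derivative
          (\<lambda>h. Dchange ?c c' (f y) (frechet_derivative f (at y) h))) (at y)"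
        by (rule has_derivative_compose[OF smooth_on_has_derivative[OF f(1) y]])
          (use change_has_derivative[OF charts_atI[OF cx(1) fy(1)[OF y]] True] fy(3)[OF y] in \<open>simp add: comp_def\<close>)
      from frechet_derivative_at[OF this] show ?thesis
        using True fy(3)[OF y] by (simp add: pushforward_def tvec_of_def comp_def) metis
    qed (simp add: pushforward_def tvec_of_def)
  qed
  show "\<exists>(S :: 'n V set) f. smooth_into A S f \<and> inj_on f S \<and> x \<in> f ` S \<and>
      (\<forall>y\<in>S. inj (pushforward A f y) \<and> range (pushforward A f y) = associated_distribution P (f y))"
  proof (intro exI conjI ballI)
    show "smooth_into A ?S ?f" unfolding smooth_into_def using contf smooth by auto
    show "inj_on ?f ?S" by (rule inj_onI) (metis f(4) fy(3) inj_onD)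
    show "x \<in> ?f ` ?S" using r f(2) cx by (intro image_eqI[of _ _ 0]) auto
    fix y assume y: "y \<in> ?S"
    note cy = charts_atI[OF cx(1) fy(1)[OF y]]
    show "inj (pushforward A ?f y)"
      by (rule injI) (metis push[OF y] tvec_of_chart[OF cy] injD[OF inj[OF y]])
    have "s (?f y) (v, 0) = tvec_of A ?c (?f y) (local_frame ?c s (f y) (v, 0))" for v
      unfolding local_frame_def
      by (rule tvec_of_component[OF framesD(4)[OF frame[OF fy(2)[OF y]]] cy, symmetric])
    then have "associated_distribution P (?f y) = tvec_of A ?c (?f y) ` range (\<lambda>v. local_frame ?c s (f y) (v, 0))"
      unfolding associated_distribution_section[OF s fy(2)[OF y]] by auto
    also have "\<dots> = range (pushforward A ?f y)"
      unfolding rng[OF y, symmetric] using push[OF y] by auto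
    finally show "range (pushforward A ?f y) = associated_distribution P (?f y)" ..
  qed
qed

text \<open>Pulled back to an integral manifold, the form snd \<circ> \<theta> vanishes identically,
  hence so does its exterior derivative; and the tangent spaces of the manifold fill the
  distribution.\<close>

theorem integrable_imp_torsion_free:
  assumes "integrable_distribution TYPE('n V) A (associated_distribution P)" and u: "u \<in> P x"
  shows "intrinsic_torsion A P x u = (\<lambda>v w. 0)"
proof (intro ext)
  fix v w
  have "\<exists>(S :: 'n V set) f. smooth_into A S f \<and> inj_on f S \<and> x \<in> f ` S \<and>
      (\<forall>y\<in>S. inj (pushforward A f y) \<and> range (pushforward A f y) = associated_distribution P (f y))"
    using assms(1) unfolding integrable_distribution_def by (rule spec)
  then obtain S and f :: "'n V \<Rightarrow> 'm" where "smooth_into A S f \<and> inj_on f S \<and> x \<in> f ` S \<and>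
      (\<forall>y\<in>S. inj (pushforward A f y) \<and> range (pushforward A f y) = associated_distribution P (f y))"
    by (elim exE)
  then obtain y0 where f: "smooth_into A S f" and y0: "y0 \<in> S" "x = f y0"
    and rng: "\<And>y. y \<in> S \<Longrightarrow> range (pushforward A f y) = associated_distribution P (f y)"
    by blast
  obtain U s where s: "local_section A P U s" "x \<in> U" "s x = u" by (rule section_through[OF u])
  interpret section_on A U s by (rule section_on[OF s(1)])
  let ?c = "some_chart A x"
  note cx = charts_atD[OF some_chart, of x]
  let ?\<theta> = "local_form A (\<lambda>y. inv (s y)) ?c" and ?g = "snd ?c \<circ> f"
  let ?S = "S \<inter> f -` (fst ?c \<inter> U)"
  have S: "open ?S"
    by (rule continuous_open_preimage) (use f open_chart[OF cx(1)] open_U in \<open>auto simp: smooth_into_def\<close>)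
  have "smooth_on ?g (S \<inter> f -` fst ?c)" using f cx(1) unfolding smooth_into_def by blast
  then have g: "smooth_on ?g ?S" by (rule smooth_on_subset) auto
  have y0S: "y0 \<in> ?S" using y0 s(2) cx by auto
  have gO: "?g y \<in> snd ?c ` (fst ?c \<inter> U)" if "y \<in> ?S" for y using that by auto
  note form = smooth_one_form_onD[OF smooth_coframe cx(1)]
  have diff: "(\<lambda>q. ?\<theta> q \<xi>) differentiable at (?g y0)" for \<xi>
    by (rule smooth_on_differentiable[OF form(2) gO[OF y0S]])
  have frame_at: "local_form A (\<lambda>y. inv (s y)) ?c (?g y) (s (f y) t ?c) = t" if "y \<in> ?S" for y t
  proof -
    have y: "?c \<in> charts_at A (f y)" "s (f y) \<in> frames A (f y)" using that cx by (auto intro: charts_atI frame)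
    show ?thesis
      by (simp only: comp_apply local_form_at[OF y(1) framesD(4)[OF y(2)]] framesD(5)[OF y(2)])
  qed
  have D: "\<exists>v. frechet_derivative ?g (at y) h = s (f y) (v, 0) ?c" if y: "y \<in> ?S" for y h
  proof -
    obtain v where v: "pushforward A f y h = s (f y) (v, 0)"
      using rng[of y] y associated_distribution_section[OF s(1), of "f y"] by blast
    have "pushforward A f y h ?c = frechet_derivative ?g (at y) h"
      using y cx by (simp add: pushforward_def charts_atI)
    then have "frechet_derivative ?g (at y) h = s (f y) (v, 0) ?c" by (simp only: v)
    then show ?thesis by (rule exI)
  qed
  have zero: "snd (?\<theta> (?g y) (frechet_derivative ?g (at y) h)) = 0" if "y \<in> ?S" for y h
    using D[OF that, of h] frame_at[OF that] by auto
  have "dform (\<lambda>y h. snd (?\<theta> (?g y) (frechet_derivative ?g (at y) h))) y0 h k =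
      dform (\<lambda>p \<xi>. snd (?\<theta> p \<xi>)) (?g y0) (frechet_derivative ?g (at y0) h) (frechet_derivative ?g (at y0) k)" for h k
  proof (rule dform_pullback[OF S g y0S])
    show "linear (\<lambda>\<xi>. snd (?\<theta> (?g y) \<xi>))" if "y \<in> ?S" for y
      using linear_compose[OF form(1)[OF gO[OF that]] linear_snd] by (simp add: comp_def)
    show "(\<lambda>q. snd (?\<theta> q \<xi>)) differentiable at (?g y0)" for \<xi>
      by (rule differentiableI[OF has_derivative_snd[OF diff[of \<xi>, unfolded frechet_derivative_works]]])
  qed
  moreover have "dform (\<lambda>y h. snd (?\<theta> (?g y) (frechet_derivative ?g (at y) h))) y0 h k = 0" for h k
  proof -
    have "dform (\<lambda>y h. 0 :: W) y0 = dform (\<lambda>y h. snd (?\<theta> (?g y) (frechet_derivative ?g (at y) h))) y0"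
      by (rule dform_cong[OF S y0S zero[symmetric] differentiable_const])
    then show ?thesis by (simp add: dform_def flip: frechet_derivative_const) (simp add: dform_def fun_eq_iff)
  qed
  ultimately have *: "snd (dform ?\<theta> (?g y0) (frechet_derivative ?g (at y0) h) (frechet_derivative ?g (at y0) k)) = 0" for h k
    using dform_compose_linear[OF bounded_linear_snd diff] by (simp del: comp_apply)
  have "\<exists>h. u (v, 0) ?c = frechet_derivative ?g (at y0) h" for v
  proof -
    have "u (v, 0) \<in> range (pushforward A f y0)"
      using rng[OF y0(1)] associated_distribution_section[OF s(1,2)] s(3) y0(2) by blast
    then show ?thesis using cx y0 by (auto simp: pushforward_def charts_atI)
  qed
  moreover have "u t \<in> tangent_space A x" for t by (rule framesD(4)[OF P_frames[OF u]])
  ultimately have "snd (ext_deriv A (\<lambda>y. inv (s y)) x (u (v, 0)) (u (w, 0))) = 0"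
    unfolding ext_deriv_some_chart using * y0(2) by (metis comp_apply)
  then show "intrinsic_torsion A P x u v w = 0"
    using intrinsic_torsion_section[OF s(1,2)] s(3) by simp
qed

end

subsection \<open>Quaternionic structure of the model\<close>

unbundle cross3_syntax

text \<open>Each block \<open>\<real>\<^sup>4\<close> is the space of quaternions \<open>\<real> \<oplus> \<real>\<^sup>3\<close>; \<open>quat_J c\<close> is right multiplication by
  the imaginary quaternion \<open>c\<close>.\<close>

definition quat :: "real \<Rightarrow> real ^ 3 \<Rightarrow> real ^ 4" where
  "quat a b = (\<chi> i. if i = 1 then a else if i = 2 then b $ 1 else if i = 3 then b $ 2 else b $ 3)"

definition quat_im :: "real ^ 4 \<Rightarrow> real ^ 3" where
  "quat_im x = vector [x $ 2, x $ 3, x $ 4]"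

definition quat_J :: "W \<Rightarrow> 'n::finite V \<Rightarrow> 'n V" where
  "quat_J c v = (\<chi> j. quat (- (c \<bullet> quat_im (v $ j))) (v $ j $ 1 *\<^sub>R c - c \<times> quat_im (v $ j)))"

lemma quat_nth [simp]: "quat a b $ 1 = a" "quat a b $ 2 = b $ 1" "quat a b $ 3 = b $ 2" "quat a b $ 4 = b $ 3"
  by (simp_all add: quat_def)

lemma quat_im_nth [simp]: "quat_im x $ 1 = x $ 2" "quat_im x $ 2 = x $ 3" "quat_im x $ 3 = x $ 4"
  by (simp_all add: quat_im_def)

lemma quat_im_quat [simp]: "quat_im (quat a b) = b"
  by (simp add: vec_eq_iff forall_3)

lemma quat_eq_iff: "x = y \<longleftrightarrow> x $ 1 = y $ 1 \<and> quat_im x = quat_im y" for x y :: "real ^ 4"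
  by (auto simp: vec_eq_iff forall_3 forall_4)

lemma inner_quat: "x \<bullet> y = x $ 1 * y $ 1 + quat_im x \<bullet> quat_im y" for x y :: "real ^ 4"
  by (simp add: inner_vec_def sum_3 sum_4)

lemma linear_quat_im: "linear quat_im"
  by (rule linearI) (simp_all add: vec_eq_iff forall_3)

lemma qc_model_nth: "qc_model v w $ 1 = omega1 v w" "qc_model v w $ 2 = omega2 v w" "qc_model v w $ 3 = omega3 v w"
  by (simp_all add: qc_model_def axis_def)

text \<open>Each summand is the imaginary part of the quaternion product conj(v_j) w_j.\<close>

lemma qc_model_quat:
  "qc_model v w = (\<Sum>j\<in>UNIV. (v $ j $ 1) *\<^sub>R quat_im (w $ j) - (w $ j $ 1) *\<^sub>R quat_im (v $ j)
    - quat_im (v $ j) \<times> quat_im (w $ j))"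
  by (auto simp: vec_eq_iff forall_3 qc_model_nth omega1_def omega2_def omega3_def coord_wedge_def
      cross_components sum_component algebra_simps intro!: sum.cong)

lemma qc_model_add: "qc_model (v + v') w = qc_model v w + qc_model v' w"
  "qc_model v (w + w') = qc_model v w + qc_model v w'"
  by (simp_all add: qc_model_quat linear_add[OF linear_quat_im] algebra_simps cross_add_left cross_add_right
      flip: sum.distrib)

lemma qc_model_scale: "qc_model (r *\<^sub>R v) w = r *\<^sub>R qc_model v w" "qc_model v (r *\<^sub>R w) = r *\<^sub>R qc_model v w"
  by (simp_all add: qc_model_quat linear_scale[OF linear_quat_im] cross_mult_left cross_mult_right
      scaleR_sum_right scaleR_diff_right mult.commute)

lemma inner_quat_J: "quat_J c v \<bullet> w = c \<bullet> qc_model v w"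
proof -
  have "quat_J c v $ j \<bullet> w $ j = c \<bullet> ((v $ j $ 1) *\<^sub>R quat_im (w $ j) - (w $ j $ 1) *\<^sub>R quat_im (v $ j)
    - quat_im (v $ j) \<times> quat_im (w $ j))" for j
    by (simp add: inner_quat quat_J_def inner_diff_right inner_diff_left cross3_simps)
  then show ?thesis by (simp add: inner_vec_def[of "quat_J c v"] qc_model_quat inner_sum_right)
qed

text \<open>Right multiplications compose in reverse order: the left-hand side is v d c, and d c = -
  (c \<bullet> d) - c \<times> d. Hence the sign of the cross product.\<close>

lemma quat_J_quat_J: "quat_J c (quat_J d v) = - (c \<bullet> d) *\<^sub>R v - quat_J (c \<times> d) v"
  by (subst vec_eq_iff) (simp add: quat_J_def quat_eq_iff linear_diff[OF linear_quat_im]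
      linear_neg[OF linear_quat_im] linear_scale[OF linear_quat_im] cross3_simps forall_3)

lemma linear_quat_J: "linear (quat_J c)" "linear (\<lambda>c. quat_J c v)"
  by (auto intro!: linearI simp: quat_J_def vec_eq_iff forall_4 cross3_simps)

lemma quat_J_skew: "quat_J c v \<bullet> v = 0"
proof -
  have "qc_model v v = 0" by (simp add: qc_model_quat)
  then show ?thesis by (simp add: inner_quat_J)
qed

text \<open>Quaternion multiplication in real and imaginary parts. It isolates the real part, which
  is all that a trace sees.\<close>

lemma quat_J_product:
  "a *\<^sub>R (a' *\<^sub>R u + quat_J b' u) + quat_J b (a' *\<^sub>R u + quat_J b' u) =
    (a * a' - b \<bullet> b') *\<^sub>R u + quat_J (a *\<^sub>R b' + a' *\<^sub>R b - b \<times> b') u"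
  by (simp add: quat_J_quat_J linear_add[OF linear_quat_J(1)] linear_scale[OF linear_quat_J(1)]
      linear_add[OF linear_quat_J(2)] linear_diff[OF linear_quat_J(2)] linear_scale[OF linear_quat_J(2)]
      algebra_simps)

text \<open>Skewness of \<open>quat_J\<close> removes the imaginary part of the product. The triple
  product that survives is what later detects orientations.\<close>

lemma quat_J_triple: "quat_J a (quat_J b (quat_J c v)) \<bullet> v = (a \<bullet> (b \<times> c)) * (v \<bullet> v)"
  by (simp add: quat_J_quat_J[of b] linear_diff[OF linear_quat_J(1)] linear_scale[OF linear_quat_J(1)]
      linear_neg[OF linear_quat_J(1)] quat_J_quat_J[of a] inner_diff_left quat_J_skew)

lemma quat_J_inverse: "quat_J c (quat_J c v) = - (c \<bullet> c) *\<^sub>R v"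
  by (simp add: quat_J_quat_J linear_0[OF linear_quat_J(2)])

lemma bij_quat_J: "c \<noteq> 0 \<Longrightarrow> bij (quat_J c)"
  by (rule linear_bij_finite[OF linear_quat_J(1)])
    (metis (no_types, lifting) injI inner_eq_zero_iff neg_equal_0_iff_equal quat_J_inverse scaleR_cancel_left)

section \<open>Oriented orthonormal triples and rotations\<close>

lemma orthonormal_triple_zero:
  assumes f: "f1 \<bullet> f1 = 1" "f2 \<bullet> f2 = 1" "f1 \<bullet> f2 = 0" and f3: "f3 = f1 \<times> f2"
    and x: "f1 \<bullet> x = 0" "f2 \<bullet> x = 0" "f3 \<bullet> x = 0"
  shows "x = 0"
proof -
  have "f3 \<bullet> f3 = 1"
    using f norm_cross_dot[of f1 f2] by (simp add: f3 power2_norm_eq_inner power_mult_distrib)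
  then have n: "norm f3 = 1" by (simp add: norm_eq_sqrt_inner)
  have "(f1 \<times> f2) \<times> x = 0" using x by (simp add: cross_skew[of _ x] Lagrange inner_commute)
  then have "(norm f3 * norm x)\<^sup>2 = 0" using norm_cross_dot[of f3 x] x(3) by (simp add: f3)
  then show "x = 0" using n by simp
qed

text \<open>Being orthogonal to \<open>f1\<close> and \<open>f2\<close>, the vector
  \<open>f3\<close> is a multiple of f1 \<times> f2. The lengths make the factor 1 or -1, and the
  triple product is that factor.\<close>

lemma orthonormal_triple_oriented:
  assumes f: "f1 \<bullet> f1 = 1" "f2 \<bullet> f2 = 1" "f3 \<bullet> f3 = 1" "f1 \<bullet> f2 = 0" "f1 \<bullet> f3 = 0" "f2 \<bullet> f3 = 0"
  shows "f1 \<bullet> (f2 \<times> f3) \<noteq> 0" "f1 \<bullet> (f2 \<times> f3) > 0 \<Longrightarrow> f3 = f1 \<times> f2"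
proof -
  let ?n = "f1 \<times> f2"
  have n: "?n \<bullet> ?n = 1"
    using f norm_cross_dot[of f1 f2] by (simp add: power2_norm_eq_inner power_mult_distrib)
  have t: "f1 \<bullet> (f2 \<times> f3) = ?n \<bullet> f3" by (simp add: cross3_simps)
  have "f3 \<times> ?n = 0" using f by (simp add: Lagrange inner_commute)
  moreover have "?n \<times> (f3 \<times> ?n) = (?n \<bullet> ?n) *\<^sub>R f3 - (?n \<bullet> f3) *\<^sub>R ?n" by (rule Lagrange)
  ultimately have f3: "f3 = (?n \<bullet> f3) *\<^sub>R ?n" using n by simp
  then have "f3 \<bullet> f3 = ((?n \<bullet> f3) *\<^sub>R ?n) \<bullet> ((?n \<bullet> f3) *\<^sub>R ?n)" by metis
  then have sq: "(?n \<bullet> f3) * (?n \<bullet> f3) = 1" using f(3) n by simp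
  then show "f1 \<bullet> (f2 \<times> f3) \<noteq> 0" unfolding t by auto
  assume "f1 \<bullet> (f2 \<times> f3) > 0"
  then have "?n \<bullet> f3 = 1" using sq unfolding t by (simp add: square_eq_1_iff)
  then show "f3 = ?n" using f3 by simp
qed

text \<open>Rotations of \<open>\<real>\<^sup>3\<close> act by automorphisms of the quaternions.\<close>

lemma qc_model_rotation:
  assumes f: "f1 \<bullet> f1 = 1" "f2 \<bullet> f2 = 1" "f1 \<bullet> f2 = 0" and f3: "f3 = f1 \<times> f2"
  obtains R :: "'n::finite V \<Rightarrow> 'n V" where "linear R" "bij R"
    "\<And>v w. f1 \<bullet> qc_model v w = omega1 (R v) (R w)" "\<And>v w. f2 \<bullet> qc_model v w = omega2 (R v) (R w)"
    "\<And>v w. f3 \<bullet> qc_model v w = omega3 (R v) (R w)"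
proof -
  have f33: "f3 \<bullet> f3 = 1" "f3 \<bullet> f1 = 0" "f3 \<bullet> f2 = 0"
    using f norm_cross_dot[of f1 f2] by (simp_all add: f3 dot_cross_self power2_norm_eq_inner power_mult_distrib)
  have cyc: "f2 \<times> f3 = f1" "f3 \<times> f1 = f2"
    unfolding f3 using f
    by (simp_all add: Lagrange cross_triple cross_skew[of "f1 \<times> f2" f1] inner_commute)
  define F :: "real ^ 3 \<Rightarrow> real ^ 3" where "F x = vector [f1 \<bullet> x, f2 \<bullet> x, f3 \<bullet> x]" for x
  have linF: "linear F" by (rule linearI) (simp_all add: F_def vec_eq_iff forall_3 inner_add_right)
  \<comment> \<open>The frame is positively oriented, so each of its vectors is the cross product of
    the next two. The Lagrange identity then expresses the components of x \<times> y by those of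
    \<open>x\<close> and \<open>y\<close>.\<close>
  have crossF: "F x \<times> F y = F (x \<times> y)" for x y
  proof -
    have *: "(a \<times> b) \<bullet> (x \<times> y) = (a \<bullet> x) * (b \<bullet> y) - (a \<bullet> y) * (b \<bullet> x)" for a b :: "real ^ 3"
      by (simp add: cross3_simps)
    have "f1 \<bullet> (x \<times> y) = (f2 \<times> f3) \<bullet> (x \<times> y)" "f2 \<bullet> (x \<times> y) = (f3 \<times> f1) \<bullet> (x \<times> y)"
      "f3 \<bullet> (x \<times> y) = (f1 \<times> f2) \<bullet> (x \<times> y)" by (simp_all only: cyc f3[symmetric])
    then show ?thesis unfolding * by (simp add: F_def vec_eq_iff forall_3 cross_components)
  qed
  define R where "R v = (\<chi> j. quat (v $ j $ 1) (F (quat_im (v $ j))))" for v :: "'n V"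
  have linR: "linear R"
    by (rule linearI) (simp_all add: R_def vec_eq_iff[of _ "_ :: 'n V"] quat_eq_iff linear_add[OF linear_quat_im]
        linear_scale[OF linear_quat_im] linear_add[OF linF] linear_scale[OF linF])
  have "F x = 0 \<Longrightarrow> x = 0" for x
    using orthonormal_triple_zero[OF f f3, of x] by (simp add: F_def vec_eq_iff forall_3)
  then have "inj F" using linear_injective_0[OF linF] by blast
  then have "inj R"
    by (intro injI) (auto simp: R_def vec_eq_iff[of _ "_ :: 'n V"] quat_eq_iff inj_eq)
  then have "bij R" by (rule linear_bij_finite[OF linR])
  have "qc_model (R v) (R w) = F (qc_model v w)" for v w
    by (simp add: qc_model_quat R_def crossF linear_diff[OF linF] linear_scale[OF linF] linear_sum[OF linF])
  then have "qc_model (R v) (R w) $ i = F (qc_model v w) $ i" for v w i by simp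
  then have "f1 \<bullet> qc_model v w = omega1 (R v) (R w)" "f2 \<bullet> qc_model v w = omega2 (R v) (R w)"
    "f3 \<bullet> qc_model v w = omega3 (R v) (R w)" for v w
    by (simp_all add: F_def flip: qc_model_nth)
  with linR \<open>bij R\<close> that show thesis by blast
qed

text \<open>The Hom(W, V) part of Q acts trivially on
  \<open>\<Lambda>\<^sup>2V\<^sup>* \<otimes> T/V\<close>, so the orbits are those of GL(V) \<times>
  GL(W). Here \<kappa> is the inverse of the V-part of the group element and \<open>D\<close> its
  action on \<open>T/V\<close>.\<close>

lemma Q_orbit_iff:
  "\<Theta> \<in> Q_orbit \<Theta>0 \<longleftrightarrow> (\<exists>\<kappa> D. linear \<kappa> \<and> bij \<kappa> \<and> linear D \<and> bij D \<and> \<Theta> = (\<lambda>v w. D (\<Theta>0 (\<kappa> v) (\<kappa> w))))"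
  for \<Theta> :: "'n::finite V \<Rightarrow> 'n V \<Rightarrow> W"
proof
  assume "\<Theta> \<in> Q_orbit \<Theta>0"
  then obtain g where g: "g \<in> Q_group" "\<Theta> = Q_act g \<Theta>0" by (auto simp: Q_orbit_def)
  note Q = Q_groupD[OF g(1)]
  let ?\<kappa> = "\<lambda>v. fst (inv g (v, 0))" and ?D = "\<lambda>b. snd (g (0, b))"
  have gi: "inv g (g t) = t" "g (inv g t) = t" for t
    using Q(2) by (simp_all add: bij_def surj_f_inv_f)
  have l: "linear (\<lambda>v. (v, 0))" "linear (\<lambda>w. (0, w))" by (auto intro!: linearI)
  have lin\<kappa>: "linear ?\<kappa>" and linD: "linear ?D"
    using linear_compose[OF linear_compose[OF l(1) Q(5)] linear_fst] linear_compose[OF linear_compose[OF l(2) Q(1)] linear_snd]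
    by (simp_all add: comp_def)
  have "v = 0" if "?\<kappa> v = 0" for v
  proof -
    have "inv g (v, 0) = 0" using that Q(4)[of v] by (simp add: prod_eq_iff)
    then have "g 0 = (v, 0)" using gi(2)[of "(v, 0)"] by metis
    then show ?thesis unfolding linear_0[OF Q(1)] by (simp add: prod_eq_iff)
  qed
  then have "bij ?\<kappa>" using linear_injective_0[OF lin\<kappa>] linear_bij_finite[OF lin\<kappa>] by blast
  have "b = 0" if "?D b = 0" for b
  proof -
    have "g (0, b) = (fst (g (0, b)), 0)" using that by (simp add: prod_eq_iff)
    then have "snd (inv g (g (0, b))) = 0" using Q(4) by metis
    then show ?thesis by (simp add: gi)
  qed
  then have "bij ?D" using linear_injective_0[OF linD] linear_bij_finite[OF linD] by blast
  with lin\<kappa> linD \<open>bij ?\<kappa>\<close> g(2)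
  show "\<exists>\<kappa> D. linear \<kappa> \<and> bij \<kappa> \<and> linear D \<and> bij D \<and> \<Theta> = (\<lambda>v w. D (\<Theta>0 (\<kappa> v) (\<kappa> w)))"
    by (intro exI[of _ ?\<kappa>] exI[of _ ?D]) (simp add: fun_eq_iff Q_act_def)
next
  assume "\<exists>\<kappa> D. linear \<kappa> \<and> bij \<kappa> \<and> linear D \<and> bij D \<and> \<Theta> = (\<lambda>v w. D (\<Theta>0 (\<kappa> v) (\<kappa> w)))"
  then obtain \<kappa> D where \<kappa>: "linear \<kappa>" "bij \<kappa>" and D: "linear D" "bij D"
    and \<Theta>: "\<Theta> = (\<lambda>v w. D (\<Theta>0 (\<kappa> v) (\<kappa> w)))" by blast
  let ?g = "\<lambda>t. (inv \<kappa> (fst t), D (snd t))"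
  have lin\<kappa>': "linear (inv \<kappa>)" by (rule linear_inv_family[of UNIV "\<lambda>_. \<kappa>"]) (use \<kappa> in auto)
  have \<kappa>i: "inv \<kappa> (\<kappa> v) = v" "\<kappa> (inv \<kappa> v) = v" for v using \<kappa>(2) by (simp_all add: bij_def surj_f_inv_f)
  have g: "linear ?g" by (rule linearI) (simp_all add: linear_add[OF lin\<kappa>'] linear_scale[OF lin\<kappa>'] linear_add[OF D(1)] linear_scale[OF D(1)])
  have "inj ?g"
  proof (rule injI)
    fix t t' assume "?g t = ?g t'"
    then have "\<kappa> (inv \<kappa> (fst t)) = \<kappa> (inv \<kappa> (fst t'))" "snd t = snd t'"
      using D(2) by (auto simp: bij_def inj_eq)
    then show "t = t'" by (simp add: \<kappa>i prod_eq_iff)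
  qed
  then have Q: "?g \<in> Q_group" by (rule Q_groupI'[OF g]) (simp add: linear_0[OF D(1)])
  have "inv ?g (v, 0) = (\<kappa> v, 0)" for v
    by (rule inv_f_eq[OF \<open>inj ?g\<close>]) (simp add: \<kappa>i linear_0[OF D(1)])
  then have "Q_act ?g \<Theta>0 = \<Theta>" by (simp add: fun_eq_iff Q_act_def \<Theta>)
  with Q show "\<Theta> \<in> Q_orbit \<Theta>0" unfolding Q_orbit_def by blast
qed

subsection \<open>Torsion of qc structures\<close>

text \<open>Separates the conditions at a single point from the choice of smooth one-forms near
  it.\<close>

definition qc_forms_at ::
  "'n::finite itself \<Rightarrow> ('m::topological_space, 'e::euclidean_space) chart set \<Rightarrow> ('m \<Rightarrow> ('m, 'e) tvec set) \<Rightarrow>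
    ('m \<Rightarrow> ('m, 'e) tvec \<Rightarrow> real) \<Rightarrow> ('m \<Rightarrow> ('m, 'e) tvec \<Rightarrow> real) \<Rightarrow> ('m \<Rightarrow> ('m, 'e) tvec \<Rightarrow> real) \<Rightarrow>
    'm \<Rightarrow> bool" where
  "qc_forms_at _ A D \<eta>1 \<eta>2 \<eta>3 x \<longleftrightarrow>
    D x = {v \<in> tangent_space A x. \<eta>1 x v = 0 \<and> \<eta>2 x v = 0 \<and> \<eta>3 x v = 0} \<and>
    (\<exists>u :: 'n V \<Rightarrow> ('m, 'e) tvec. tlinear u \<and> bij_betw u UNIV (D x) \<and>
      (\<forall>a\<in>Basis. \<forall>b\<in>Basis.
        ext_deriv A \<eta>1 x (u a) (u b) = omega1 a b \<and>
        ext_deriv A \<eta>2 x (u a) (u b) = omega2 a b \<and>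
        ext_deriv A \<eta>3 x (u a) (u b) = omega3 a b))"

lemma qc_structure_iff:
  "qc_structure TYPE('n::finite) A D \<longleftrightarrow> distribution TYPE('n V) A D \<and>
    (\<forall>p. \<exists>U \<eta>1 \<eta>2 \<eta>3. p \<in> U \<and> smooth_one_form_on A U \<eta>1 \<and> smooth_one_form_on A U \<eta>2 \<and>
      smooth_one_form_on A U \<eta>3 \<and> (\<forall>x\<in>U. qc_forms_at TYPE('n) A D \<eta>1 \<eta>2 \<eta>3 x))"
  unfolding qc_structure_def qc_forms_at_def ..

context Q_structure
begin

lemma distribution_associated: "distribution TYPE('n V) A (associated_distribution P)"
  unfolding distribution_def
proof
  fix x
  obtain U s where s: "local_section A P U s" "x \<in> U"
    using G_structure unfolding G_structure_def by metis
  let ?X = "\<lambda>y v :: 'n V. s y (v, 0)"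
  have "smooth_tlinear_on A U s" using s(1) by (simp add: local_section_def)
  then have "smooth_tlinear_on A U ?X"
    unfolding smooth_tlinear_on_def
  proof (elim conjE, intro conjI ballI allI)
    fix y assume *: "\<forall>y\<in>U. tlinear (s y) \<and> range (s y) \<subseteq> tangent_space A y" and y: "y \<in> U"
    then show "range (?X y) \<subseteq> tangent_space A y" by blast
    have "linear (\<lambda>t. s y t c)" for c using * y unfolding tlinear_def by blast
    then have "linear ((\<lambda>t. s y t c) \<circ> (\<lambda>v. (v, 0)))" for c
      by (intro linear_compose) (auto intro!: linearI)
    then show "tlinear (?X y)" by (simp add: tlinear_def comp_def del: split_paired_All)
  qed blast+
  moreover have "bij_betw (?X y) UNIV (associated_distribution P y)" if y: "y \<in> U" for y
    unfolding associated_distribution_section[OF s(1) y]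
    using framesD(2)[OF P_frames[OF local_sectionD(2)[OF s(1) y]]]
    by (intro bij_betw_imageI) (auto intro!: inj_onI dest: injD)
  ultimately show "\<exists>U (X :: 'm \<Rightarrow> 'n V \<Rightarrow> ('m, 'e) tvec).
      x \<in> U \<and> smooth_tlinear_on A U X \<and> (\<forall>y\<in>U. bij_betw (X y) UNIV (associated_distribution P y))"
    using s(2) by blast
qed

text \<open>\<open>\<eta>\<close> factors through \<open>snd \<circ> inv (s y)\<close>, and on the distribution the terms of \<open>d\<eta>\<close> that involve
  derivatives of the factor vanish.\<close>

lemma ext_deriv_annihilator:
  fixes \<eta> :: "'m \<Rightarrow> ('m, 'e) tvec \<Rightarrow> real"
  assumes s: "local_section A P U s" and \<eta>: "smooth_one_form_on A U' \<eta>" and x: "x \<in> U" "x \<in> U'"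
    and van: "\<And>y v. y \<in> U \<inter> U' \<Longrightarrow> \<eta> y (s y (v, 0)) = 0"
  shows "ext_deriv A \<eta> x (s x (v, 0)) (s x (w, 0)) =
    \<eta> x (s x (0, intrinsic_torsion A P x (s x) v w))"
proof -
  interpret section_on A U s by (rule section_on[OF s])
  let ?c = "some_chart A x"
  note c = some_chart[of x]
  note A = charts_atD[OF c]
  let ?S = "snd ?c ` (fst ?c \<inter> (U \<inter> U'))"
  have "open U'" using \<eta> by (simp add: smooth_one_form_on_def)
  then have S: "open ?S" using open_chart_image[OF A(1)] open_U by blast
  have xS: "snd ?c x \<in> ?S" using A x by auto
  let ?\<theta> = "local_form A (\<lambda>y. inv (s y)) ?c"
  let ?M = "\<lambda>p (t :: 'n T). local_form A \<eta> ?c p (local_frame ?c s p (0, snd t))"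
  note f\<theta> = smooth_one_form_onD[OF smooth_coframe A(1)] and f\<eta> = smooth_one_form_onD[OF \<eta> A(1)]
  have sub: "?S \<subseteq> snd ?c ` (fst ?c \<inter> U)" "?S \<subseteq> snd ?c ` (fst ?c \<inter> U')" by auto
  have local: "local_form A \<eta> ?c (snd ?c y) (local_frame ?c s (snd ?c y) t) = \<eta> y (s y t)"
    "local_form A \<eta> ?c (snd ?c y) \<xi> = \<eta> y (tvec_of A ?c y \<xi>)"
    "?\<theta> (snd ?c y) \<xi> = inv (s y) (tvec_of A ?c y \<xi>)"
    if y: "y \<in> fst ?c" "y \<in> U" for y t \<xi>
  proof -
    have cy: "?c \<in> charts_at A y" by (rule charts_atI[OF A(1) y(1)])
    have "tvec_of A ?c y (s y t ?c) = s y t"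
      by (rule tvec_of_component[OF framesD(4)[OF frame[OF y(2)]] cy])
    then show "local_form A \<eta> ?c (snd ?c y) (local_frame ?c s (snd ?c y) t) = \<eta> y (s y t)"
      "local_form A \<eta> ?c (snd ?c y) \<xi> = \<eta> y (tvec_of A ?c y \<xi>)"
      "?\<theta> (snd ?c y) \<xi> = inv (s y) (tvec_of A ?c y \<xi>)"
      using A(1) y(1) by (simp_all add: local_form_def local_frame_def)
  qed
  have fac: "local_form A \<eta> ?c p \<xi> = ?M p (?\<theta> p \<xi>)" if p: "p \<in> ?S" for p \<xi>
  proof -
    obtain y where y: "y \<in> fst ?c" "y \<in> U" "y \<in> U'" "p = snd ?c y" using p by blast
    have cy: "?c \<in> charts_at A y" by (rule charts_atI[OF A(1) y(1)])
    let ?t = "?\<theta> p \<xi>"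
    have lin: "linear (\<lambda>t. local_form A \<eta> ?c p (local_frame ?c s p t))"
      using linear_compose[OF local_frame(1)[OF A(1) subsetD[OF sub(1) p]] f\<eta>(1)[OF subsetD[OF sub(2) p]]]
      by (simp add: comp_def)
    have "s y ?t = tvec_of A ?c y \<xi>"
      unfolding y(4) local(3)[OF y(1,2)] by (rule framesD(6)[OF frame[OF y(2)] tvec_of_in_tangent_space[OF cy]])
    moreover have "local_form A \<eta> ?c p \<xi> = \<eta> y (tvec_of A ?c y \<xi>)"
      unfolding y(4) by (rule local(2)[OF y(1,2)])
    moreover have "local_form A \<eta> ?c p (local_frame ?c s p ?t) = \<eta> y (s y ?t)"
      unfolding y(4) by (rule local(1)[OF y(1,2)])
    ultimately have "local_form A \<eta> ?c p \<xi> = local_form A \<eta> ?c p (local_frame ?c s p ?t)" by simp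
    also have "?t = (fst ?t, 0) + (0, snd ?t)" by simp
    also have "local_form A \<eta> ?c p (local_frame ?c s p \<dots>) =
        local_form A \<eta> ?c p (local_frame ?c s p (fst ?t, 0)) + ?M p ?t"
      by (rule linear_add[OF lin])
    also have "local_form A \<eta> ?c p (local_frame ?c s p (fst ?t, 0)) = 0"
      unfolding y(4) local(1)[OF y(1,2)] using van y by simp
    finally show ?thesis by simp
  qed
  have linM: "linear (?M p)" if p: "p \<in> ?S" for p
  proof -
    have l: "linear (\<lambda>t :: 'n T. (0 :: 'n V, snd t))" by (auto intro!: linearI)
    from linear_compose[OF linear_compose[OF l local_frame(1)[OF A(1) subsetD[OF sub(1) p]]] f\<eta>(1)[OF subsetD[OF sub(2) p]]]
    show ?thesis by (simp add: comp_def)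
  qed
  have smoothM: "smooth_on (\<lambda>p. ?M p t) ?S" for t
  proof (rule smooth_on_apply[OF S, where M = "local_form A \<eta> ?c"])
    show "linear (local_form A \<eta> ?c p)" if "p \<in> ?S" for p by (rule f\<eta>(1)[OF subsetD[OF sub(2) that]])
    show "smooth_on (\<lambda>p. local_form A \<eta> ?c p b) ?S" for b by (rule smooth_on_subset[OF f\<eta>(2) sub(2)])
    show "smooth_on (\<lambda>p. local_frame ?c s p (0, snd t)) ?S"
      by (rule smooth_on_subset[OF smooth_local_frame[OF A(1)] sub(1)])
  qed
  have d\<theta>: "(\<lambda>q. ?\<theta> q \<xi>) differentiable at (snd ?c x)" for \<xi>
    by (rule smooth_on_differentiable[OF f\<theta>(2) subsetD[OF sub(1) xS]])
  have d\<eta>: "(\<lambda>q. local_form A \<eta> ?c q \<xi>) differentiable at (snd ?c x)" for \<xi>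
    by (rule smooth_on_differentiable[OF f\<eta>(2) subsetD[OF sub(2) xS]])
  have fr: "s x \<in> frames A x" by (rule frame[OF x(1)])
  have \<theta>s: "?\<theta> (snd ?c x) (s x t ?c) = t" for t
    unfolding local(3)[OF A(2) x(1)] tvec_of_component[OF framesD(4)[OF fr] c] by (rule framesD(5)[OF fr])
  have zero: "frechet_derivative (\<lambda>p. ?M p (v, 0)) (at (snd ?c x)) = (\<lambda>_. 0)" for v
  proof (rule frechet_derivative_at[symmetric])
    have "?M p (v, 0) = 0" if "p \<in> ?S" for p
      using linear_0[OF linM[OF that]] by (simp add: zero_prod_def)
    then show "((\<lambda>p. ?M p (v, 0)) has_derivative (\<lambda>_. 0)) (at (snd ?c x))"
      by (intro has_derivative_transform_within_open[OF has_derivative_const S xS]) simp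
  qed
  have "ext_deriv A \<eta> x (s x (v, 0)) (s x (w, 0)) =
      dform (local_form A \<eta> ?c) (snd ?c x) (s x (v, 0) ?c) (s x (w, 0) ?c)"
    by (rule ext_deriv_some_chart)
  also have "dform (local_form A \<eta> ?c) (snd ?c x) = dform (\<lambda>p \<xi>. ?M p (?\<theta> p \<xi>)) (snd ?c x)"
    by (rule dform_cong[OF S xS fac d\<eta>])
  also have "\<dots> (s x (v, 0) ?c) (s x (w, 0) ?c) =
      ?M (snd ?c x) (dform ?\<theta> (snd ?c x) (s x (v, 0) ?c) (s x (w, 0) ?c))"
    by (simp only: dform_apply[where M = ?M and \<beta> = ?\<theta>, OF S xS linM smooth_on_has_derivative[OF smoothM xS] d\<theta>]
        \<theta>s zero add_0_right diff_0_right)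
  also have "\<dots> = \<eta> x (s x (0, intrinsic_torsion A P x (s x) v w))"
    unfolding local(1)[OF A(2) x(1)] intrinsic_torsion_section[OF s x(1)] ext_deriv_some_chart ..
  finally show ?thesis .
qed

theorem qc_imp_torsion_orbit:
  assumes qc: "qc_structure TYPE('n) A (associated_distribution P)" and u: "u \<in> P x"
  shows "intrinsic_torsion A P x u \<in> Q_orbit qc_model"
proof -
  obtain U s where s: "local_section A P U s" "x \<in> U" "s x = u" by (rule section_through[OF u])
  obtain U' \<eta>1 \<eta>2 \<eta>3 where xU': "x \<in> U'"
    and \<eta>: "smooth_one_form_on A U' \<eta>1" "smooth_one_form_on A U' \<eta>2" "smooth_one_form_on A U' \<eta>3"
    and *: "\<forall>x\<in>U'. qc_forms_at TYPE('n) A (associated_distribution P) \<eta>1 \<eta>2 \<eta>3 x"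
    using qc unfolding qc_structure_iff by metis
  have D: "associated_distribution P y = {v \<in> tangent_space A y. \<eta>1 y v = 0 \<and> \<eta>2 y v = 0 \<and> \<eta>3 y v = 0}"
    if "y \<in> U'" for y
    using * that unfolding qc_forms_at_def by blast
  obtain u' :: "'n V \<Rightarrow> ('m, 'e) tvec" where u': "tlinear u'" "bij_betw u' UNIV (associated_distribution P x)"
    and om: "\<And>a b. a \<in> Basis \<Longrightarrow> b \<in> Basis \<Longrightarrow> ext_deriv A \<eta>1 x (u' a) (u' b) = omega1 a b \<and>
      ext_deriv A \<eta>2 x (u' a) (u' b) = omega2 a b \<and> ext_deriv A \<eta>3 x (u' a) (u' b) = omega3 a b"
    using * xU' unfolding qc_forms_at_def by blast
  have fr: "u \<in> frames A x" by (rule P_frames[OF u])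
  have Dx: "associated_distribution P x = range (\<lambda>v. u (v, 0))"
    using associated_distribution_section[OF s(1,2)] s(3) by simp
  have rng: "range u' \<subseteq> tangent_space A x" using u'(2) D[OF xU'] by (auto simp: bij_betw_def)
  \<comment> \<open>The definition of qc structures fixes the exterior derivatives on pairs of basis
    vectors; bilinearity carries them over to all pairs.\<close>
  have ext: "h (u' a) (u' b) = f a b"
    if h: "\<And>a. linear (\<lambda>b. h (u' a) (u' b))" "\<And>b. linear (\<lambda>a. h (u' a) (u' b))"
      and f: "\<And>a. linear (f a)" "\<And>b. linear (\<lambda>a. f a b)"
      and eq: "\<And>a b. a \<in> Basis \<Longrightarrow> b \<in> Basis \<Longrightarrow> h (u' a) (u' b) = f a b"
    for h :: "('m, 'e) tvec \<Rightarrow> ('m, 'e) tvec \<Rightarrow> real" and f a b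
  proof -
    have "h (u' a) (u' b) = f a b" if "a \<in> Basis" for a b
      by (rule linear_eq_on_span[OF h(1) f(1), of Basis, THEN fun_cong[of _ _ b, OF ext]]) (use eq that in auto)
    then show ?thesis
      using linear_eq_stdbasis[OF h(2) f(2)] by metis
  qed
  have lin_om: "linear (omega1 a)" "linear (\<lambda>a. omega1 a b)" "linear (omega2 a)" "linear (\<lambda>a. omega2 a b)"
    "linear (omega3 a)" "linear (\<lambda>a. omega3 a b)" for a b :: "'n V"
    by (auto intro!: linearI simp: qc_model_add qc_model_scale simp flip: qc_model_nth)
  note bil = bilinear_ext_deriv[OF _ xU' u'(1) u'(1) rng rng]
  have om1: "ext_deriv A \<eta>1 x (u' a) (u' b) = omega1 a b" and om2: "ext_deriv A \<eta>2 x (u' a) (u' b) = omega2 a b"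
    and om3: "ext_deriv A \<eta>3 x (u' a) (u' b) = omega3 a b" for a b
    by (rule ext[OF bil(2)[OF \<eta>(1)] bil(1)[OF \<eta>(1)] lin_om(1,2)], use om in blast)
      (rule ext[OF bil(2)[OF \<eta>(2)] bil(1)[OF \<eta>(2)] lin_om(3,4)], use om in blast,
       rule ext[OF bil(2)[OF \<eta>(3)] bil(1)[OF \<eta>(3)] lin_om(5,6)], use om in blast)
  \<comment> \<open>The restriction of \<open>u\<close> to V and the frame \<open>u'\<close> of the
    qc structure both parametrize the distribution at \<open>x\<close>; \<kappa> compares
    them.\<close>
  define \<kappa> where "\<kappa> v = inv u' (u (v, 0))" for v
  have u'\<kappa>: "u' (\<kappa> v) = u (v, 0)" for v
    unfolding \<kappa>_def by (rule f_inv_into_f) (use u'(2) Dx in \<open>auto simp: bij_betw_def\<close>)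
  have inj': "u' a = u' b \<Longrightarrow> a = b" for a b using u'(2) by (auto simp: bij_betw_def dest: injD)
  have lu': "linear (\<lambda>v. u' v c)" and lu: "linear (\<lambda>t. u t c)" for c
    using u'(1) framesD(1)[OF fr] unfolding tlinear_def by blast+
  have lin\<kappa>: "linear \<kappa>"
  proof
    fix v w r
    have "u' (\<kappa> (v + w)) c = u' (\<kappa> v + \<kappa> w) c" "u' (\<kappa> (r *\<^sub>R v)) c = u' (r *\<^sub>R \<kappa> v) c" for c
      using linear_add[OF lu, of "(v, 0)" "(w, 0)"] linear_scale[OF lu, of r "(v, 0)"]
      by (simp_all add: u'\<kappa> linear_add[OF lu'] linear_scale[OF lu'])
    then show "\<kappa> (v + w) = \<kappa> v + \<kappa> w" "\<kappa> (r *\<^sub>R v) = r *\<^sub>R \<kappa> v" by (auto intro!: inj' ext)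
  qed
  have "inj \<kappa>"
  proof (rule injI)
    fix v w assume "\<kappa> v = \<kappa> w"
    then have "u (v, 0) = u (w, 0)" by (metis u'\<kappa>)
    then show "v = w" using injD[OF framesD(2)[OF fr]] by blast
  qed
  then have bij\<kappa>: "bij \<kappa>" by (rule linear_bij_finite[OF lin\<kappa>])
  define C :: "W \<Rightarrow> W" where "C b = vector [\<eta>1 x (u (0, b)), \<eta>2 x (u (0, b)), \<eta>3 x (u (0, b))]" for b
  have lin\<eta>: "linear (\<lambda>b. \<eta> x (u (0, b)))" if "smooth_one_form_on A U' \<eta>" for \<eta> :: "'m \<Rightarrow> ('m, 'e) tvec \<Rightarrow> real"
  proof -
    let ?c = "some_chart A x"
    note c = some_chart[of x]
    have l: "linear (\<lambda>b :: W. (0 :: 'n V, b))" by (auto intro!: linearI)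
    have "linear (local_form A \<eta> ?c (snd ?c x))"
      using smooth_one_form_onD(1)[OF that charts_atD(1)[OF c]] charts_atD(2)[OF c] xU' by blast
    note linear_compose[OF linear_compose[OF l lu[of ?c]] this]
    moreover have "local_form A \<eta> ?c (snd ?c x) (u (0, b) ?c) = \<eta> x (u (0, b))" for b
      by (rule local_form_at[OF c framesD(4)[OF fr]])
    ultimately show ?thesis by (simp add: comp_def)
  qed
  have linC: "linear C"
    by (rule linearI) (simp_all add: C_def vec_eq_iff forall_3 linear_add[OF lin\<eta>[OF \<eta>(1)]] linear_add[OF lin\<eta>[OF \<eta>(2)]]
        linear_add[OF lin\<eta>[OF \<eta>(3)]] linear_scale[OF lin\<eta>[OF \<eta>(1)]] linear_scale[OF lin\<eta>[OF \<eta>(2)]] linear_scale[OF lin\<eta>[OF \<eta>(3)]])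
  \<comment> \<open>If all three forms annihilate \<open>u (0, b)\<close>, this vector lies in the
    distribution, that is in the image of V under the injective map \<open>u\<close>.\<close>
  have "b = 0" if "C b = 0" for b
  proof -
    have "u (0, b) \<in> associated_distribution P x"
      using that framesD(4)[OF fr] unfolding D[OF xU'] by (simp add: C_def vec_eq_iff forall_3)
    then obtain v where "u (0, b) = u (v, 0)" unfolding Dx by blast
    then show ?thesis using injD[OF framesD(2)[OF fr]] by blast
  qed
  then have bijC: "bij C" using linear_injective_0[OF linC] linear_bij_finite[OF linC] by blast
  have van: "\<eta>1 y (s y (v, 0)) = 0" "\<eta>2 y (s y (v, 0)) = 0" "\<eta>3 y (s y (v, 0)) = 0" if "y \<in> U \<inter> U'" for y v
    using D[of y] associated_distribution_section[OF s(1), of y] that by blast+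
  have C\<Theta>: "C (intrinsic_torsion A P x u v w) = qc_model (\<kappa> v) (\<kappa> w)" for v w
    unfolding C_def vec_eq_iff forall_3 qc_model_nth om1[symmetric] om2[symmetric] om3[symmetric] u'\<kappa> s(3)[symmetric]
    using ext_deriv_annihilator[OF s(1) \<eta>(1) s(2) xU' van(1)] ext_deriv_annihilator[OF s(1) \<eta>(2) s(2) xU' van(2)]
      ext_deriv_annihilator[OF s(1) \<eta>(3) s(2) xU' van(3)] by simp
  have "intrinsic_torsion A P x u = (\<lambda>v w. inv C (qc_model (\<kappa> v) (\<kappa> w)))"
    unfolding C\<Theta>[symmetric] using bijC by (simp add: bij_def)
  moreover have "linear (inv C)" by (rule linear_inv_family[of UNIV "\<lambda>_. C"]) (use linC bijC in auto)
  moreover have "bij (inv C)" by (rule bij_imp_bij_inv[OF bijC])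
  ultimately show ?thesis unfolding Q_orbit_iff using lin\<kappa> bij\<kappa> by blast
qed

end

subsection \<open>Smooth orthonormalization\<close>

text \<open>\<open>G\<close> is given point by point, without any continuity, and serves for
  symmetry and positivity. Smoothness comes from \<open>q\<close>: the Gram-Schmidt formulas,
  started at the constant standard basis, consist of values of \<open>q\<close>, square roots and
  inverses.\<close>

lemma smooth_gram_schmidt:
  fixes q :: "'a::euclidean_space \<Rightarrow> W \<Rightarrow> W \<Rightarrow> real"
  assumes S: "open S" and smooth: "\<And>d e. smooth_on (\<lambda>p. q p d e) S"
    and metric: "\<And>p. p \<in> S \<Longrightarrow> \<exists>G :: W \<Rightarrow> W. linear G \<and> inj G \<and> (\<forall>d e. q p d e = G d \<bullet> G e)"
  obtains b1 b2 b3 where "smooth_on b1 S" "smooth_on b2 S" "smooth_on b3 S"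
    "\<And>p. p \<in> S \<Longrightarrow> q p (b1 p) (b1 p) = 1 \<and> q p (b2 p) (b2 p) = 1 \<and> q p (b3 p) (b3 p) = 1 \<and>
      q p (b1 p) (b2 p) = 0 \<and> q p (b1 p) (b3 p) = 0 \<and> q p (b2 p) (b3 p) = 0"
proof -
  have bil: "linear (q p d)" "linear (\<lambda>d. q p d e)" "q p d e = q p e d" "d \<noteq> 0 \<Longrightarrow> q p d d > 0"
    if p: "p \<in> S" for p d e
  proof -
    obtain G :: "W \<Rightarrow> W" where G: "linear G" "inj G" "\<And>d e. q p d e = G d \<bullet> G e" using metric[OF p] by blast
    show "linear (q p d)" "linear (\<lambda>d. q p d e)" "q p d e = q p e d"
      by (auto intro!: linearI simp: G(3) linear_add[OF G(1)] linear_scale[OF G(1)] inner_add_left inner_add_right inner_commute)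
    assume "d \<noteq> 0"
    then have "G d \<noteq> 0" using G(1,2) linear_injective_0 by blast
    then show "q p d d > 0" by (simp add: G(3))
  qed
  have smooth_q: "smooth_on (\<lambda>p. q p (a p) (b p)) S" if "smooth_on a S" "smooth_on b S" for a b
  proof (rule smooth_on_apply[where M = "\<lambda>p. q p (a p)", OF S bil(1) _ that(2)])
    show "smooth_on (\<lambda>p. q p (a p) d) S" for d
      by (rule smooth_on_apply[where M = "\<lambda>p d'. q p d' d", OF S bil(2) smooth that(1)])
  qed
  define normed where "normed u p = inverse (sqrt (q p (u p) (u p))) *\<^sub>R u p" for u :: "'a \<Rightarrow> W" and p
  have smooth_normed: "smooth_on (normed u) S" if u: "smooth_on u S" "\<And>p. p \<in> S \<Longrightarrow> u p \<noteq> 0" for u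
  proof -
    have pos: "q p (u p) (u p) > 0" if "p \<in> S" for p by (rule bil(4)[OF that u(2)[OF that]])
    have "smooth_on (\<lambda>p. q p (u p) (u p)) S" by (rule smooth_q[OF u(1) u(1)])
    from smooth_on_sqrt[OF S this pos] have sq: "smooth_on (\<lambda>p. sqrt (q p (u p) (u p))) S" .
    have "sqrt (q p (u p) (u p)) \<noteq> 0" if "p \<in> S" for p using pos[OF that] by simp
    from smooth_on_inverse[OF S sq this]
    have "smooth_on (\<lambda>p. inverse (sqrt (q p (u p) (u p)))) S" .
    from smooth_on_scaleR[OF S this u(1)] show ?thesis unfolding normed_def[abs_def] .
  qed
  have normed: "q p (normed u p) (normed u p) = 1" "q p d (u p) = 0 \<Longrightarrow> q p d (normed u p) = 0"
    if "p \<in> S" "u p \<noteq> 0" for u p d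
  proof -
    have "q p (u p) (u p) > 0" by (rule bil(4)[OF that])
    then have "sqrt (q p (u p) (u p)) * sqrt (q p (u p) (u p)) = q p (u p) (u p)" "sqrt (q p (u p) (u p)) > 0" by auto
    then show "q p (normed u p) (normed u p) = 1"
      by (simp add: normed_def linear_scale[OF bil(1)[OF that(1)]] linear_scale[OF bil(2)[OF that(1)]] field_simps)
    show "q p d (u p) = 0 \<Longrightarrow> q p d (normed u p) = 0"
      by (simp add: normed_def linear_scale[OF bil(1)[OF that(1)]])
  qed
  define b1 where "b1 = normed (\<lambda>_. axis 1 1)"
  define u2 where "u2 p = axis 2 1 - q p (b1 p) (axis 2 1) *\<^sub>R b1 p" for p
  define b2 where "b2 = normed u2"
  define u3 where "u3 p = axis 3 1 - q p (b1 p) (axis 3 1) *\<^sub>R b1 p - q p (b2 p) (axis 3 1) *\<^sub>R b2 p" for p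
  define b3 where "b3 = normed u3"
  have e1: "axis 1 1 \<noteq> (0 :: W)" by (simp add: axis_eq_0_iff)
  have s1: "smooth_on b1 S" unfolding b1_def by (rule smooth_normed[OF smooth_on_const[OF S] e1])
  have c1: "b1 p $ 2 = 0" "b1 p $ 3 = 0" for p by (simp_all add: b1_def normed_def axis_def)
  \<comment> \<open>The vectors stay triangular with respect to the standard basis, so a coordinate
    equal to 1 shows that the vector about to be normalized is nonzero.\<close>
  have "u2 p $ 2 = 1" for p by (simp add: u2_def c1)
  then have n2: "u2 p \<noteq> 0" for p by (metis zero_index zero_neq_one)
  have s2u: "smooth_on u2 S"
    unfolding u2_def[abs_def]
    by (rule smooth_on_diff[OF S smooth_on_const[OF S] smooth_on_scaleR[OF S smooth_q[OF s1 smooth_on_const[OF S]] s1]])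
  have s2: "smooth_on b2 S" unfolding b2_def by (rule smooth_normed[OF s2u n2])
  have c2: "b2 p $ 3 = 0" for p by (simp add: b2_def normed_def u2_def c1 axis_def)
  have "u3 p $ 3 = 1" for p by (simp add: u3_def c1 c2)
  then have n3: "u3 p \<noteq> 0" for p by (metis zero_index zero_neq_one)
  have s3u: "smooth_on u3 S"
    unfolding u3_def[abs_def]
    by (rule smooth_on_diff[OF S smooth_on_diff[OF S smooth_on_const[OF S] smooth_on_scaleR[OF S smooth_q[OF s1 smooth_on_const[OF S]] s1]]
          smooth_on_scaleR[OF S smooth_q[OF s2 smooth_on_const[OF S]] s2]])
  have s3: "smooth_on b3 S" unfolding b3_def by (rule smooth_normed[OF s3u n3])
  show thesis
  proof (rule that[OF s1 s2 s3])
    fix p assume p: "p \<in> S"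
    note l = linear_diff[OF bil(1)[OF p]] linear_scale[OF bil(1)[OF p]]
    have q1: "q p (b1 p) (b1 p) = 1" unfolding b1_def by (rule normed(1)[OF p e1])
    have q2: "q p (b2 p) (b2 p) = 1" unfolding b2_def by (rule normed(1)[OF p n2])
    have q3: "q p (b3 p) (b3 p) = 1" unfolding b3_def by (rule normed(1)[OF p n3])
    have q12: "q p (b1 p) (b2 p) = 0"
      unfolding b2_def by (rule normed(2)[OF p n2]) (simp add: u2_def l q1)
    have q13: "q p (b1 p) (b3 p) = 0"
      unfolding b3_def by (rule normed(2)[OF p n3]) (simp add: u3_def l q1 q12)
    have q23: "q p (b2 p) (b3 p) = 0"
      unfolding b3_def by (rule normed(2)[OF p n3]) (simp add: u3_def l q2 bil(3)[OF p, of "b2 p" "b1 p"] q12)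
    show "q p (b1 p) (b1 p) = 1 \<and> q p (b2 p) (b2 p) = 1 \<and> q p (b3 p) (b3 p) = 1 \<and>
      q p (b1 p) (b2 p) = 0 \<and> q p (b1 p) (b3 p) = 0 \<and> q p (b2 p) (b3 p) = 0"
      using q1 q2 q3 q12 q13 q23 by simp
  qed
qed

section \<open>Traces of endomorphisms\<close>

definition trace_map :: "('a::euclidean_space \<Rightarrow> 'a) \<Rightarrow> real" where
  "trace_map f = (\<Sum>b\<in>Basis. f b \<bullet> b)"

lemma trace_map_commute:
  fixes f g :: "'a::euclidean_space \<Rightarrow> 'a"
  assumes "linear f" "linear g"
  shows "trace_map (\<lambda>v. f (g v)) = trace_map (\<lambda>v. g (f v))"
proof -
  have e: "f (g b) \<bullet> b = (\<Sum>a\<in>Basis. (g b \<bullet> a) * (f a \<bullet> b))" if "linear f" for f g :: "'a \<Rightarrow> 'a" and b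
    by (subst linear_euclidean_expansion[OF that, of "g b"]) (simp add: inner_sum_left)
  have "trace_map (\<lambda>v. f (g v)) = (\<Sum>b\<in>Basis. \<Sum>a\<in>Basis. (g b \<bullet> a) * (f a \<bullet> b))"
    unfolding trace_map_def by (simp only: e[OF assms(1), of g])
  also have "\<dots> = (\<Sum>a\<in>Basis. \<Sum>b\<in>Basis. (g b \<bullet> a) * (f a \<bullet> b))" by (rule sum.swap)
  also have "\<dots> = trace_map (\<lambda>v. g (f v))"
    unfolding trace_map_def by (simp only: e[OF assms(2), of f] mult.commute)
  finally show ?thesis .
qed

text \<open>Conjugation invariance is what eliminates the unknown \<kappa>.\<close>

lemma trace_map_conj:
  fixes f \<kappa> :: "'a::euclidean_space \<Rightarrow> 'a"
  assumes "linear f" "linear \<kappa>" "bij \<kappa>"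
  shows "trace_map (\<lambda>v. inv \<kappa> (f (\<kappa> v))) = trace_map f"
proof -
  have "linear (inv \<kappa>)" by (rule linear_inv_family[of UNIV "\<lambda>_. \<kappa>"]) (use assms in auto)
  then have "trace_map (\<lambda>v. inv \<kappa> (f (\<kappa> v))) = trace_map (\<lambda>v. f (\<kappa> (inv \<kappa> v)))"
    using trace_map_commute[of "inv \<kappa>" "\<lambda>v. f (\<kappa> v)"] linear_compose[OF assms(2,1)] by (simp add: comp_def)
  then show ?thesis using assms(3) by (simp add: bij_def surj_f_inv_f)
qed

text \<open>A skew endomorphism has zero diagonal, so the trace of a quaternion acting by
  multiplication is its real part times the dimension.\<close>

lemma trace_map_scalar_skew:
  assumes "\<And>v. g v \<bullet> v = 0"
  shows "trace_map (\<lambda>v :: 'a::euclidean_space. \<alpha> *\<^sub>R v + g v) = \<alpha> * DIM('a)"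
  by (simp add: trace_map_def inner_add_left assms inner_Basis)

subsection \<open>Families of forms in the orbit of the model\<close>

text \<open>The endomorphism of \<open>\<real>\<^sup>4\<^sup>n\<close> representing the two-form \<open>c \<bullet> \<Theta>\<close>.\<close>

definition form_map :: "('n::finite V \<Rightarrow> 'n V \<Rightarrow> W) \<Rightarrow> W \<Rightarrow> 'n V \<Rightarrow> 'n V" where
  "form_map \<Theta> c v = (\<Sum>b\<in>Basis. (c \<bullet> \<Theta> v b) *\<^sub>R b)"

definition conformal_trace :: "('n::finite V \<Rightarrow> 'n V \<Rightarrow> W) \<Rightarrow> W \<Rightarrow> real" where
  "conformal_trace \<Theta> d =
    trace_map (\<lambda>v. inv (form_map \<Theta> (axis 1 1)) (form_map \<Theta> d v)) / DIM('n V)"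

text \<open>For \<open>\<Theta> = D \<circ> qc_model(\<kappa>, \<kappa>)\<close> this is \<open>\<langle>D\<^sup>T d, D\<^sup>T e\<rangle> / |D\<^sup>T e\<^sub>1|\<^sup>2\<close>, although it is defined without
  reference to \<open>D\<close> and \<open>\<kappa>\<close>; hence it depends smoothly on \<open>\<Theta>\<close>.\<close>

definition conformal_metric :: "('n::finite V \<Rightarrow> 'n V \<Rightarrow> W) \<Rightarrow> W \<Rightarrow> W \<Rightarrow> real" where
  "conformal_metric \<Theta> d e = 2 * conformal_trace \<Theta> d * conformal_trace \<Theta> e -
    trace_map (\<lambda>v. inv (form_map \<Theta> (axis 1 1)) (form_map \<Theta> d
      (inv (form_map \<Theta> (axis 1 1)) (form_map \<Theta> e v)))) / DIM('n V)"

text \<open>A single form in the orbit together with witnesses from \<open>Q_orbit_iff\<close>.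
  Quantities built from \<open>form_map\<close> \<Theta> alone cannot depend on the choice of these
  witnesses.\<close>

locale model_form =
  fixes \<Theta> :: "'n::finite V \<Rightarrow> 'n V \<Rightarrow> W" and \<kappa> :: "'n V \<Rightarrow> 'n V" and D :: "W \<Rightarrow> W"
  assumes \<kappa>: "linear \<kappa>" "bij \<kappa>" and D: "linear D" "bij D"
    and \<Theta>: "\<And>v w. \<Theta> v w = D (qc_model (\<kappa> v) (\<kappa> w))"
begin

abbreviation adj :: "W \<Rightarrow> W" where "adj \<equiv> adjoint D"

lemma inner_D: "c \<bullet> D b = adj c \<bullet> b"
  by (metis adjoint_works[OF D(1)] inner_commute)

lemma adj: "linear adj" "inj adj"
proof -
  show l: "linear adj" by (rule adjoint_linear[OF D(1)])
  have "c = 0" if "adj c = 0" for c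
  proof -
    obtain b where "c = D b" using D(2) by (metis bij_pointE)
    then show "c = 0" using inner_D[of c b] that by simp
  qed
  then show "inj adj" using linear_injective_0[OF l] by blast
qed

lemma adj_nonzero: "c \<noteq> 0 \<Longrightarrow> adj c \<noteq> 0"
  using adj linear_injective_0 by blast

lemma inner_\<Theta>: "c \<bullet> \<Theta> v w = adj c \<bullet> qc_model (\<kappa> v) (\<kappa> w)"
  by (simp add: \<Theta> inner_D)

lemma \<kappa>_inv: "\<kappa> (inv \<kappa> v) = v" "inv \<kappa> (\<kappa> v) = v" "linear (inv \<kappa>)"
  using \<kappa>(2) linear_inv_family[of UNIV "\<lambda>_. \<kappa>"] \<kappa> by (auto simp: bij_def surj_f_inv_f)

text \<open>Pulling a two-form back by \<kappa> turns its endomorphism J into \<kappa>^T J \<kappa>,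
  and pairing with \<open>c\<close> moves \<open>D\<close> to its adjoint.\<close>

lemma form_map: "form_map \<Theta> c v = adjoint \<kappa> (quat_J (adj c) (\<kappa> v))"
proof (rule euclidean_eqI)
  fix b :: "'n V" assume b: "b \<in> Basis"
  have "form_map \<Theta> c v \<bullet> b = c \<bullet> \<Theta> v b"
    using b by (simp add: form_map_def inner_sum_left inner_Basis if_distrib cong: if_cong)
  also have "\<dots> = adjoint \<kappa> (quat_J (adj c) (\<kappa> v)) \<bullet> b"
    by (simp add: inner_\<Theta> inner_quat_J[symmetric] adjoint_clauses(2)[OF \<kappa>(1)])
  finally show "form_map \<Theta> c v \<bullet> b = adjoint \<kappa> (quat_J (adj c) (\<kappa> v)) \<bullet> b" .
qed

lemma linear_form_map: "linear (form_map \<Theta> c)" "linear (\<lambda>c. form_map \<Theta> c v)"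
proof -
  note l = linear_compose[OF linear_compose[OF \<kappa>(1) linear_quat_J(1)] adjoint_linear[OF \<kappa>(1)], unfolded comp_def]
    linear_compose[OF linear_compose[OF adj(1) linear_quat_J(2)] adjoint_linear[OF \<kappa>(1)], unfolded comp_def]
  show "linear (form_map \<Theta> c)" "linear (\<lambda>c. form_map \<Theta> c v)"
    unfolding form_map[abs_def] by (rule l)+
qed

lemma bij_form_map: "c \<noteq> 0 \<Longrightarrow> bij (form_map \<Theta> c)"
proof (rule linear_bij_finite[OF linear_form_map(1)])
  assume c: "c \<noteq> 0"
  have "v = 0" if "form_map \<Theta> c v = 0" for v
  proof -
    have "quat_J (adj c) (\<kappa> v) \<bullet> \<kappa> w = 0" for w
      using that by (simp add: form_map flip: adjoint_clauses(2)[OF \<kappa>(1)])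
    then have "quat_J (adj c) (\<kappa> v) = 0" by (metis \<kappa>_inv(1) inner_eq_zero_iff)
    then have "\<kappa> v = 0"
      using bij_quat_J[OF adj_nonzero[OF c]] linear_injective_0[OF linear_quat_J(1)] by (auto simp: bij_def)
    then show "v = 0" using \<kappa>(2) linear_injective_0[OF \<kappa>(1)] by (auto simp: bij_def)
  qed
  then show "inj (form_map \<Theta> c)" using linear_injective_0[OF linear_form_map(1)] by blast
qed

text \<open>In the quotient of two such endomorphisms the transpose of \<kappa> cancels. What
  remains is conjugate by \<kappa> to a quaternion multiplication, the inverse of J_c being - J_c /
  |c|^2.\<close>

lemma inv_form_map:
  assumes "c \<noteq> 0"
  shows "inv (form_map \<Theta> c) (form_map \<Theta> d v) =
    inv \<kappa> (- (1 / (adj c \<bullet> adj c)) *\<^sub>R quat_J (adj c) (quat_J (adj d) (\<kappa> v)))"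
proof -
  have "inj (form_map \<Theta> c)" using bij_form_map[OF assms] by (simp add: bij_def)
  then show ?thesis
  proof (rule inv_f_eq)
    have "adj c \<bullet> adj c \<noteq> 0" using adj_nonzero[OF assms] by simp
    then show "form_map \<Theta> c (inv \<kappa> (- (1 / (adj c \<bullet> adj c)) *\<^sub>R quat_J (adj c) (quat_J (adj d) (\<kappa> v)))) = form_map \<Theta> d v"
      unfolding form_map \<kappa>_inv(1) linear_scale[OF linear_quat_J(1)] quat_J_inverse by simp
  qed
qed

text \<open>Write c, d and e for their images under \<open>adj\<close>. The quotient
  \<open>?X d\<close> acts as the quaternion with real part (c \<bullet> d) / |c|^2 and imaginary
  part (c \<times> d) / |c|^2. The normalized trace of a product of two quotients is the product of
  the real parts minus the inner product of the imaginary parts. Subtracting it from twice the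
  product of the real parts leaves the sum of both, and the Lagrange identity turns this sum into (d
  \<bullet> e) / |c|^2.\<close>

lemma conformal_metric: "conformal_metric \<Theta> d e = adj d \<bullet> adj e / (adj (axis 1 1) \<bullet> adj (axis 1 1))"
proof -
  let ?c = "adj (axis 1 1)"
  let ?cc = "?c \<bullet> ?c"
  have e1: "axis 1 1 \<noteq> (0 :: W)" by (simp add: axis_eq_0_iff)
  have cc: "?cc \<noteq> 0" using adj_nonzero[OF e1] by simp
  let ?X = "\<lambda>d u :: 'n V. - (1 / ?cc) *\<^sub>R quat_J ?c (quat_J (adj d) u)"
  have linX: "linear (?X d)" for d
    by (rule linear_compose_scale_right[OF linear_compose[OF linear_quat_J(1) linear_quat_J(1), unfolded comp_def]])
  have X: "?X d u = (?c \<bullet> adj d / ?cc) *\<^sub>R u + quat_J ((1 / ?cc) *\<^sub>R (?c \<times> adj d)) u" for d u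
    by (simp add: quat_J_quat_J linear_scale[OF linear_quat_J(2)] scaleR_diff_right)
  have dim: "real DIM('n V) \<noteq> 0" using DIM_positive[where 'a = "'n V"] by linarith
  have tr: "conformal_trace \<Theta> d = ?c \<bullet> adj d / ?cc" for d
  proof -
    have "conformal_trace \<Theta> d = trace_map (\<lambda>v. inv \<kappa> (?X d (\<kappa> v))) / DIM('n V)"
      unfolding conformal_trace_def inv_form_map[OF e1] ..
    also have "trace_map (\<lambda>v. inv \<kappa> (?X d (\<kappa> v))) = trace_map (?X d)"
      by (rule trace_map_conj[OF linX \<kappa>])
    also have "\<dots> = (?c \<bullet> adj d / ?cc) * DIM('n V)"
      unfolding X by (rule trace_map_scalar_skew[OF quat_J_skew])
    finally show ?thesis using dim by simp
  qed
  have XX: "?X d (?X e u) = ((?c \<bullet> adj d / ?cc) * (?c \<bullet> adj e / ?cc) -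
      ((1 / ?cc) *\<^sub>R (?c \<times> adj d)) \<bullet> ((1 / ?cc) *\<^sub>R (?c \<times> adj e))) *\<^sub>R u +
    quat_J ((?c \<bullet> adj d / ?cc) *\<^sub>R ((1 / ?cc) *\<^sub>R (?c \<times> adj e)) + (?c \<bullet> adj e / ?cc) *\<^sub>R ((1 / ?cc) *\<^sub>R (?c \<times> adj d))
      - ((1 / ?cc) *\<^sub>R (?c \<times> adj d)) \<times> ((1 / ?cc) *\<^sub>R (?c \<times> adj e))) u" for u
  proof -
    have Xd: "?X d (?X e u) = (?c \<bullet> adj d / ?cc) *\<^sub>R ?X e u + quat_J ((1 / ?cc) *\<^sub>R (?c \<times> adj d)) (?X e u)"
      by (rule X)
    have Xe: "?X e u = (?c \<bullet> adj e / ?cc) *\<^sub>R u + quat_J ((1 / ?cc) *\<^sub>R (?c \<times> adj e)) u"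
      by (rule X)
    show ?thesis by (rule trans[OF Xd]) (simp only: Xe quat_J_product)
  qed
  have "trace_map (\<lambda>v. inv (form_map \<Theta> (axis 1 1)) (form_map \<Theta> d
      (inv (form_map \<Theta> (axis 1 1)) (form_map \<Theta> e v)))) = trace_map (\<lambda>v. inv \<kappa> (?X d (?X e (\<kappa> v))))"
    unfolding inv_form_map[OF e1] \<kappa>_inv(1) ..
  also have "\<dots> = trace_map (\<lambda>u. ?X d (?X e u))"
    by (rule trace_map_conj[OF _ \<kappa>]) (use linear_compose[OF linX linX] in \<open>simp add: comp_def\<close>)
  also have "\<dots> = ((?c \<bullet> adj d / ?cc) * (?c \<bullet> adj e / ?cc) -
      ((1 / ?cc) *\<^sub>R (?c \<times> adj d)) \<bullet> ((1 / ?cc) *\<^sub>R (?c \<times> adj e))) * DIM('n V)"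
    by (simp only: XX) (rule trace_map_scalar_skew[OF quat_J_skew])
  also have "((1 / ?cc) *\<^sub>R (?c \<times> adj d)) \<bullet> ((1 / ?cc) *\<^sub>R (?c \<times> adj e)) =
      ((?c \<times> adj d) \<bullet> (?c \<times> adj e)) / ?cc\<^sup>2"
    by (simp add: power2_eq_square)
  finally have "conformal_metric \<Theta> d e = (?c \<bullet> adj d / ?cc) * (?c \<bullet> adj e / ?cc) + ((?c \<times> adj d) \<bullet> (?c \<times> adj e)) / ?cc\<^sup>2"
    unfolding conformal_metric_def tr using dim by simp
  also have "(?c \<times> adj d) \<bullet> (?c \<times> adj e) = ?cc * (adj d \<bullet> adj e) - (?c \<bullet> adj d) * (?c \<bullet> adj e)"
    by (simp add: cross3_simps)
  finally show ?thesis using cc by (simp add: power2_eq_square field_simps)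
qed

text \<open>Up to a factor that is positive for every nonzero \<open>v\<close>, this is minus the
  triple product. Hence one test vector decides the orientation, a negative value meaning a positive
  triple.\<close>

lemma triple_form_map:
  assumes "b2 \<noteq> 0"
  shows "form_map \<Theta> b1 (inv (form_map \<Theta> b2) (form_map \<Theta> b3 v)) \<bullet> v =
    - (adj b1 \<bullet> (adj b2 \<times> adj b3)) * (\<kappa> v \<bullet> \<kappa> v) / (adj b2 \<bullet> adj b2)"
  unfolding inv_form_map[OF assms] unfolding form_map \<kappa>_inv(1) linear_scale[OF linear_quat_J(1)]
    adjoint_clauses(2)[OF \<kappa>(1)] inner_scaleR_left quat_J_triple by simp

end

text \<open>Divided by \<mu>, the length of \<open>adj (axis 1 1)\<close>, the images of the triple
  under \<open>adj\<close> are orthonormal in the standard sense, and \<sigma> < 0 makes them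
  positively oriented. They differ from the standard basis by a rotation, which
  \<open>qc_model_rotation\<close> moves to the arguments in V.\<close>

lemma (in model_form) orthonormal_triple:
  assumes q: "conformal_metric \<Theta> b1 b1 = 1" "conformal_metric \<Theta> b2 b2 = 1" "conformal_metric \<Theta> b3 b3 = 1"
    "conformal_metric \<Theta> b1 b2 = 0" "conformal_metric \<Theta> b1 b3 = 0" "conformal_metric \<Theta> b2 b3 = 0"
    and v: "v \<noteq> 0"
  defines "\<sigma> \<equiv> form_map \<Theta> b1 (inv (form_map \<Theta> b2) (form_map \<Theta> b3 v)) \<bullet> v"
  shows "\<sigma> \<noteq> 0"
    and "\<sigma> < 0 \<Longrightarrow> b1 \<bullet> \<zeta> = 0 \<Longrightarrow> b2 \<bullet> \<zeta> = 0 \<Longrightarrow> b3 \<bullet> \<zeta> = 0 \<Longrightarrow> \<zeta> = 0"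
    and "\<sigma> < 0 \<Longrightarrow> \<exists>K :: 'n V \<Rightarrow> 'n V. linear K \<and> bij K \<and> (\<forall>v w. b1 \<bullet> \<Theta> v w = omega1 (K v) (K w) \<and>
      b2 \<bullet> \<Theta> v w = omega2 (K v) (K w) \<and> b3 \<bullet> \<Theta> v w = omega3 (K v) (K w))"
proof -
  let ?c = "adj (axis 1 1)"
  define \<mu> where "\<mu> = sqrt (?c \<bullet> ?c)"
  have "axis 1 1 \<noteq> (0 :: W)" by (simp add: axis_eq_0_iff)
  then have "?c \<noteq> 0" by (rule adj_nonzero)
  then have \<mu>: "\<mu> > 0" "\<mu> * \<mu> = ?c \<bullet> ?c" by (simp_all add: \<mu>_def)
  define f where "f b = (1 / \<mu>) *\<^sub>R adj b" for b
  have adjf: "adj b = \<mu> *\<^sub>R f b" for b using \<mu>(1) by (simp add: f_def)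
  have ff: "f b \<bullet> f b' = conformal_metric \<Theta> b b'" for b b'
    by (simp add: f_def conformal_metric \<mu>(2)[symmetric])
  note o = q[folded ff]
  have b2: "b2 \<noteq> 0" using o(2) linear_0[OF adj(1)] by (auto simp: f_def)
  have t: "\<sigma> = - (f b1 \<bullet> (f b2 \<times> f b3)) * (\<mu> * (\<kappa> v \<bullet> \<kappa> v))"
    unfolding \<sigma>_def triple_form_map[OF b2] adjf using \<mu>(1) o(2)
    by (simp add: cross_mult_left cross_mult_right field_simps)
  have \<kappa>v: "\<kappa> v \<noteq> 0" using v \<kappa> linear_injective_0[OF \<kappa>(1)] by (auto simp: bij_def)
  then have pos: "\<mu> * (\<kappa> v \<bullet> \<kappa> v) > 0" using \<mu>(1) by simp
  then show "\<sigma> \<noteq> 0" unfolding t using orthonormal_triple_oriented(1)[OF o] \<kappa>v \<mu>(1) by simp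
  have f3: "f b3 = f b1 \<times> f b2" if "\<sigma> < 0"
  proof -
    have "0 < (f b1 \<bullet> (f b2 \<times> f b3)) * (\<mu> * (\<kappa> v \<bullet> \<kappa> v))" using that unfolding t by simp
    then have "f b1 \<bullet> (f b2 \<times> f b3) > 0" by (rule zero_less_mult_pos2[OF _ pos])
    then show ?thesis by (rule orthonormal_triple_oriented(2)[OF o])
  qed
  show "\<zeta> = 0" if "\<sigma> < 0" "b1 \<bullet> \<zeta> = 0" "b2 \<bullet> \<zeta> = 0" "b3 \<bullet> \<zeta> = 0"
  proof -
    obtain \<xi> where \<xi>: "\<zeta> = D \<xi>" using D(2) by (metis bij_pointE)
    have "\<xi> = 0"
      by (rule orthonormal_triple_zero[OF o(1,2,4) f3[OF that(1)]])
        (use that(2-4) \<mu>(1) in \<open>simp_all add: \<xi> inner_D adjf\<close>)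
    then show ?thesis by (simp add: \<xi> linear_0[OF D(1)])
  qed
  assume neg: "\<sigma> < 0"
  obtain R :: "'n V \<Rightarrow> 'n V" where R: "linear R" "bij R"
    "\<And>v w. f b1 \<bullet> qc_model v w = omega1 (R v) (R w)" "\<And>v w. f b2 \<bullet> qc_model v w = omega2 (R v) (R w)"
    "\<And>v w. f b3 \<bullet> qc_model v w = omega3 (R v) (R w)"
    by (rule qc_model_rotation[OF o(1,2,4) f3[OF neg]]) blast
  \<comment> \<open>The model is bilinear, so rescaling both arguments by the square root of \<mu>
    produces the missing factor \<mu>.\<close>
  let ?K = "\<lambda>v. R (sqrt \<mu> *\<^sub>R \<kappa> v)"
  have eq: "b \<bullet> \<Theta> v w = f b \<bullet> qc_model (sqrt \<mu> *\<^sub>R \<kappa> v) (sqrt \<mu> *\<^sub>R \<kappa> w)" for b v w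
    using \<mu>(1) by (simp add: inner_\<Theta> adjf qc_model_scale)
  have lin: "linear ?K"
    using linear_compose[OF linear_compose_scale_right[OF \<kappa>(1)] R(1)] by (simp add: comp_def)
  have "inj ?K"
    by (rule injI) (use \<mu>(1) \<kappa>(2) R(2) in \<open>simp add: bij_def inj_eq\<close>)
  then have "bij ?K" by (rule linear_bij_finite[OF lin])
  with lin show "\<exists>K :: 'n V \<Rightarrow> 'n V. linear K \<and> bij K \<and> (\<forall>v w. b1 \<bullet> \<Theta> v w = omega1 (K v) (K w) \<and>
      b2 \<bullet> \<Theta> v w = omega2 (K v) (K w) \<and> b3 \<bullet> \<Theta> v w = omega3 (K v) (K w))"
    by (intro exI[of _ ?K]) (simp add: eq R)
qed

text \<open>Pointwise, a suitable triple exists by assumption; the conformal metric allows to choose it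
  smoothly, up to an orientation which is locally constant.\<close>

lemma orbit_family_smooth_frame:
  fixes \<Theta> :: "'a::euclidean_space \<Rightarrow> 'n::finite V \<Rightarrow> 'n V \<Rightarrow> W"
  assumes S: "open S" "p0 \<in> S" and smooth: "\<And>v w. smooth_on (\<lambda>p. \<Theta> p v w) S"
    and orbit: "\<And>p. p \<in> S \<Longrightarrow> \<Theta> p \<in> Q_orbit qc_model"
  obtains S' b1 b2 b3 where "open S'" "p0 \<in> S'" "S' \<subseteq> S" "smooth_on b1 S'" "smooth_on b2 S'" "smooth_on b3 S'"
    "\<forall>p\<in>S'. (\<forall>\<zeta>. b1 p \<bullet> \<zeta> = 0 \<longrightarrow> b2 p \<bullet> \<zeta> = 0 \<longrightarrow> b3 p \<bullet> \<zeta> = 0 \<longrightarrow> \<zeta> = 0) \<and>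
      (\<exists>K :: 'n V \<Rightarrow> 'n V. linear K \<and> bij K \<and> (\<forall>v w. b1 p \<bullet> \<Theta> p v w = omega1 (K v) (K w) \<and>
        b2 p \<bullet> \<Theta> p v w = omega2 (K v) (K w) \<and> b3 p \<bullet> \<Theta> p v w = omega3 (K v) (K w)))"
proof -
  have model: "\<exists>\<kappa> D. model_form (\<Theta> p) \<kappa> D" if p: "p \<in> S" for p
  proof -
    obtain \<kappa> :: "'n V \<Rightarrow> 'n V" and D where "linear \<kappa>" "bij \<kappa>" "linear D" "bij D" "\<Theta> p = (\<lambda>v w. D (qc_model (\<kappa> v) (\<kappa> w)))"
      using orbit[OF p] unfolding Q_orbit_iff by blast
    then have "model_form (\<Theta> p) \<kappa> D" by (simp add: model_form_def)
    then show ?thesis by blast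
  qed
  have A: "linear (form_map (\<Theta> p) c)" "linear (\<lambda>c. form_map (\<Theta> p) c v)" "c \<noteq> 0 \<Longrightarrow> bij (form_map (\<Theta> p) c)"
    if p: "p \<in> S" for p c v
    using model[OF p] model_form.linear_form_map model_form.bij_form_map by blast+
  have smoothA: "smooth_on (\<lambda>p. form_map (\<Theta> p) c v) S" for c v
    unfolding form_map_def
    by (rule smooth_on_sum[OF S(1)], rule smooth_on_scaleR[OF S(1) smooth_on_inner[OF S(1)
          smooth_on_const[OF S(1)] smooth] smooth_on_const[OF S(1)]])
  have smoothA': "smooth_on (\<lambda>p. form_map (\<Theta> p) (b p) (Y p)) S" if "smooth_on b S" "smooth_on Y S" for b Y
  proof (rule smooth_on_apply[where M = "\<lambda>p. form_map (\<Theta> p) (b p)", OF S(1) A(1) _ that(2)])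
    show "smooth_on (\<lambda>p. form_map (\<Theta> p) (b p) v) S" for v
      by (rule smooth_on_apply[where M = "\<lambda>p c. form_map (\<Theta> p) c v", OF S(1) A(2) smoothA that(1)])
  qed
  have smoothN: "smooth_on (\<lambda>p. inv (form_map (\<Theta> p) (b p)) (Y p)) S"
    if b: "smooth_on b S" "\<And>p. p \<in> S \<Longrightarrow> b p \<noteq> 0" and Y: "smooth_on Y S" for b Y
  proof (rule smooth_on_apply[where M = "\<lambda>p. inv (form_map (\<Theta> p) (b p))", OF S(1) _ _ Y])
    show "linear (inv (form_map (\<Theta> p) (b p)))" if "p \<in> S" for p
      by (rule linear_inv_family[where M = "\<lambda>p. form_map (\<Theta> p) (b p)", OF S(1) A(1) A(3)[OF _ b(2)] that])
    show "smooth_on (\<lambda>p. inv (form_map (\<Theta> p) (b p)) v) S" for v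
      by (rule smooth_on_inv_family[where M = "\<lambda>p. form_map (\<Theta> p) (b p)", OF S(1) A(1) A(3)[OF _ b(2)]
            smoothA'[OF b(1) smooth_on_const[OF S(1)]]])
  qed
  have e1: "axis 1 1 \<noteq> (0 :: W)" by (simp add: axis_eq_0_iff)
  note c = smooth_on_const[OF S(1)]
  let ?N = "\<lambda>p d v. inv (form_map (\<Theta> p) (axis 1 1)) (form_map (\<Theta> p) d v)"
  have N: "smooth_on (\<lambda>p. ?N p d (Y p)) S" if "smooth_on Y S" for d Y
    by (rule smoothN[OF c e1 smoothA'[OF c that]])
  have smooth_tr: "smooth_on (\<lambda>p. trace_map (F p) / DIM('n V)) S" if "\<And>v. smooth_on (\<lambda>p. F p v) S"
    for F :: "'a \<Rightarrow> 'n V \<Rightarrow> 'n V"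
    unfolding trace_map_def
    by (rule smooth_on_compose_linear[OF S(1) bounded_linear_divide smooth_on_sum[OF S(1) smooth_on_inner[OF S(1) that c]]])
  have smooth_ct: "smooth_on (\<lambda>p. conformal_trace (\<Theta> p) d) S" for d
    unfolding conformal_trace_def by (rule smooth_tr[OF N[OF c]])
  have smooth_q: "smooth_on (\<lambda>p. conformal_metric (\<Theta> p) d e) S" for d e
    unfolding conformal_metric_def
    by (rule smooth_on_diff[OF S(1) smooth_on_mult[OF S(1) smooth_on_mult[OF S(1) c smooth_ct] smooth_ct]
          smooth_tr[OF N[OF N[OF c]]]])
  have metric: "\<exists>G :: W \<Rightarrow> W. linear G \<and> inj G \<and> (\<forall>d e. conformal_metric (\<Theta> p) d e = G d \<bullet> G e)"
    if p: "p \<in> S" for p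
  proof -
    obtain \<kappa> D where m: "model_form (\<Theta> p) \<kappa> D" using model[OF p] by blast
    interpret model_form "\<Theta> p" \<kappa> D by (rule m)
    let ?c = "adj (axis 1 1) \<bullet> adj (axis 1 1)"
    let ?G = "\<lambda>d. (1 / sqrt ?c) *\<^sub>R adj d"
    have c: "?c > 0" using adj_nonzero[OF e1] by simp
    then have "sqrt ?c * sqrt ?c = ?c" by simp
    then have "conformal_metric (\<Theta> p) d e = ?G d \<bullet> ?G e" for d e
      by (simp add: conformal_metric)
    moreover have "linear ?G" by (rule linear_compose_scale_right[OF adj(1)])
    moreover have "inj ?G" by (rule injI) (use c inj_eq[OF adj(2)] in simp)
    ultimately show ?thesis by blast
  qed
  obtain b1 b2 b3 where b: "smooth_on b1 S" "smooth_on b2 S" "smooth_on b3 S"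
    and q: "\<And>p. p \<in> S \<Longrightarrow> conformal_metric (\<Theta> p) (b1 p) (b1 p) = 1 \<and> conformal_metric (\<Theta> p) (b2 p) (b2 p) = 1 \<and>
      conformal_metric (\<Theta> p) (b3 p) (b3 p) = 1 \<and> conformal_metric (\<Theta> p) (b1 p) (b2 p) = 0 \<and>
      conformal_metric (\<Theta> p) (b1 p) (b3 p) = 0 \<and> conformal_metric (\<Theta> p) (b2 p) (b3 p) = 0"
    by (rule smooth_gram_schmidt[OF S(1) smooth_q metric]) blast+
  obtain v0 :: "'n V" where "v0 \<in> Basis" using nonempty_Basis by blast
  then have v0: "v0 \<noteq> 0" by (rule nonzero_Basis)
  \<comment> \<open>The sign of \<sigma> records the orientation of the triple at \<open>p\<close>,
    by \<open>triple_form_map\<close> with the fixed test vector \<open>v0\<close>.\<close>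
  define \<sigma> where "\<sigma> p = form_map (\<Theta> p) (b1 p) (inv (form_map (\<Theta> p) (b2 p)) (form_map (\<Theta> p) (b3 p) v0)) \<bullet> v0" for p
  have b2: "b2 p \<noteq> 0" if p: "p \<in> S" for p
  proof
    assume "b2 p = 0"
    obtain G :: "W \<Rightarrow> W" where G: "linear G" "\<And>d e. conformal_metric (\<Theta> p) d e = G d \<bullet> G e"
      using metric[OF p] by blast
    have "conformal_metric (\<Theta> p) (b2 p) (b2 p) = 0" unfolding G(2) \<open>b2 p = 0\<close> linear_0[OF G(1)] by simp
    then show False using q[OF p] by simp
  qed
  have "smooth_on \<sigma> S"
    unfolding \<sigma>_def by (rule smooth_on_inner[OF S(1) smoothA'[OF b(1) smoothN[OF b(2) b2 smoothA'[OF b(3) c]]] c])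
  then have cont: "continuous_on S \<sigma>" by (rule smooth_on_continuous)
  have nz: "\<sigma> p \<noteq> 0" if p: "p \<in> S" for p
  proof -
    obtain \<kappa> D where m: "model_form (\<Theta> p) \<kappa> D" using model[OF p] by blast
    show ?thesis
      unfolding \<sigma>_def by (rule model_form.orthonormal_triple(1)[OF m _ _ _ _ _ _ v0]) (use q[OF p] in auto)
  qed
  \<comment> \<open>Flips \<open>b3\<close> if the triple at \<open>p0\<close> is negatively
    oriented, that is if \<sigma> is positive there. Since \<sigma> is continuous and nonzero at
    \<open>p0\<close>, the corrected sign persists on the neighbourhood \<open>S'\<close>.\<close>
  define \<epsilon> :: real where "\<epsilon> = (if \<sigma> p0 < 0 then 1 else - 1)"
  have \<epsilon>: "\<epsilon> * \<epsilon> = 1" by (simp add: \<epsilon>_def)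
  define S' where "S' = S \<inter> (\<lambda>p. \<epsilon> * \<sigma> p) -` {..<0}"
  have S': "open S'" "S' \<subseteq> S"
    unfolding S'_def by (intro continuous_open_preimage continuous_intros cont S open_lessThan) auto
  have p0: "p0 \<in> S'" using S(2) nz[OF S(2)] by (auto simp: S'_def \<epsilon>_def)
  show thesis
  proof (rule that[OF S'(1) p0 S'(2) smooth_on_subset[OF b(1) S'(2)] smooth_on_subset[OF b(2) S'(2)]
        smooth_on_subset[OF smooth_on_scaleR[OF S(1) c b(3)] S'(2), of \<epsilon>]], intro ballI)
    fix p assume p': "p \<in> S'"
    then have p: "p \<in> S" and neg: "\<epsilon> * \<sigma> p < 0" by (auto simp: S'_def)
    obtain \<kappa> D where m: "model_form (\<Theta> p) \<kappa> D" using model[OF p] by blast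
    interpret model_form "\<Theta> p" \<kappa> D by (rule m)
    let ?b3 = "\<epsilon> *\<^sub>R b3 p"
    have lin: "linear (inv (form_map (\<Theta> p) (b2 p)))"
      by (rule linear_inv_family[of UNIV "\<lambda>_. form_map (\<Theta> p) (b2 p)"]) (use linear_form_map bij_form_map[OF b2[OF p]] in auto)
    have "form_map (\<Theta> p) (b1 p) (inv (form_map (\<Theta> p) (b2 p)) (form_map (\<Theta> p) ?b3 v0)) \<bullet> v0 = \<epsilon> * \<sigma> p"
      by (simp add: \<sigma>_def linear_scale[OF linear_form_map(2)] linear_scale[OF lin] linear_scale[OF linear_form_map(1)])
    with neg have neg': "form_map (\<Theta> p) (b1 p) (inv (form_map (\<Theta> p) (b2 p)) (form_map (\<Theta> p) ?b3 v0)) \<bullet> v0 < 0" by simp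
    have cm: "conformal_metric (\<Theta> p) d (r *\<^sub>R e) = r * conformal_metric (\<Theta> p) d e"
      "conformal_metric (\<Theta> p) (r *\<^sub>R d) e = r * conformal_metric (\<Theta> p) d e" for r d e
      by (simp_all add: conformal_metric linear_scale[OF adj(1)])
    have o: "conformal_metric (\<Theta> p) (b1 p) (b1 p) = 1" "conformal_metric (\<Theta> p) (b2 p) (b2 p) = 1"
      "conformal_metric (\<Theta> p) ?b3 ?b3 = 1" "conformal_metric (\<Theta> p) (b1 p) (b2 p) = 0"
      "conformal_metric (\<Theta> p) (b1 p) ?b3 = 0" "conformal_metric (\<Theta> p) (b2 p) ?b3 = 0"
      using q[OF p] \<epsilon> by (simp_all add: cm mult.assoc[symmetric])
    show "(\<forall>\<zeta>. b1 p \<bullet> \<zeta> = 0 \<longrightarrow> b2 p \<bullet> \<zeta> = 0 \<longrightarrow> ?b3 \<bullet> \<zeta> = 0 \<longrightarrow> \<zeta> = 0) \<and>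
      (\<exists>K :: 'n V \<Rightarrow> 'n V. linear K \<and> bij K \<and> (\<forall>v w. b1 p \<bullet> \<Theta> p v w = omega1 (K v) (K w) \<and>
        b2 p \<bullet> \<Theta> p v w = omega2 (K v) (K w) \<and> ?b3 \<bullet> \<Theta> p v w = omega3 (K v) (K w)))"
      using orthonormal_triple(2)[OF o v0 neg'] orthonormal_triple(3)[OF o v0 neg'] by blast
  qed
qed

lemma smooth_on_dform:
  fixes \<beta> :: "'a::euclidean_space \<Rightarrow> 'a \<Rightarrow> 'b::real_normed_vector"
  assumes S: "open S" and lin: "\<And>p. p \<in> S \<Longrightarrow> linear (\<beta> p)" and smooth: "\<And>w. smooth_on (\<lambda>p. \<beta> p w) S"
    and X: "smooth_on X S" and Y: "smooth_on Y S"
  shows "smooth_on (\<lambda>p. dform \<beta> p (X p) (Y p)) S"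
proof -
  note l = bilinear_dform[OF S _ lin smooth_on_differentiable[OF smooth]]
  show ?thesis
  proof (rule smooth_on_apply[where M = "\<lambda>p. dform \<beta> p (X p)", OF S l(2) _ Y])
    fix b
    have "smooth_on (\<lambda>p. dform \<beta> p a b) S" for a
      unfolding dform_def
      by (rule smooth_on_diff[OF S smooth_on_frechet_derivative[OF smooth] smooth_on_frechet_derivative[OF smooth]])
    from smooth_on_apply[where M = "\<lambda>p a. dform \<beta> p a b", OF S l(1) this X]
    show "smooth_on (\<lambda>p. dform \<beta> p (X p) b) S" .
  qed
qed

section \<open>From torsion in the orbit to qc structures\<close>

context Q_structure
begin

theorem torsion_orbit_imp_qc:
  assumes orbit: "\<And>x u. u \<in> P x \<Longrightarrow> intrinsic_torsion A P x u \<in> Q_orbit qc_model"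
  shows "qc_structure TYPE('n) A (associated_distribution P)"
  unfolding qc_structure_iff
proof (intro conjI distribution_associated allI)
  fix x0
  obtain U s where s: "local_section A P U s" and x0: "x0 \<in> U"
    using G_structure unfolding G_structure_def by metis
  interpret section_on A U s by (rule section_on[OF s])
  let ?c = "some_chart A x0"
  note cx = charts_atD[OF some_chart, of x0]
  let ?O = "snd ?c ` (fst ?c \<inter> U)"
  have O: "open ?O" "snd ?c x0 \<in> ?O" using open_image[OF cx(1)] cx x0 by auto
  define \<Theta> where "\<Theta> p = intrinsic_torsion A P (chart_inv ?c p) (s (chart_inv ?c p))" for p
  have smooth: "smooth_on (\<lambda>p. \<Theta> p v w) ?O" for v w
  proof (rule smooth_on_cong[OF O(1)])
    show "smooth_on (\<lambda>p. snd (dform (\<lambda>p. inv (local_frame ?c s p)) p (local_frame ?c s p (v, 0)) (local_frame ?c s p (w, 0)))) ?O"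
      by (rule smooth_on_compose_linear[OF O(1) bounded_linear_snd smooth_on_dform[OF O(1)
            linear_local_coframe[OF cx(1)] smooth_local_coframe[OF cx(1)]
            smooth_local_frame[OF cx(1)] smooth_local_frame[OF cx(1)]]])
  qed (simp add: \<Theta>_def intrinsic_torsion_chart[OF s cx(1)])
  have orb: "\<Theta> p \<in> Q_orbit qc_model" if "p \<in> ?O" for p
    unfolding \<Theta>_def by (rule orbit, rule local_sectionD(2)[OF s]) (use that cx in auto)
  obtain S' b1 b2 b3 where S': "open S'" "snd ?c x0 \<in> S'" "S' \<subseteq> ?O"
    and b: "smooth_on b1 S'" "smooth_on b2 S'" "smooth_on b3 S'"
    and B: "\<forall>p\<in>S'. (\<forall>\<zeta>. b1 p \<bullet> \<zeta> = 0 \<longrightarrow> b2 p \<bullet> \<zeta> = 0 \<longrightarrow> b3 p \<bullet> \<zeta> = 0 \<longrightarrow> \<zeta> = 0) \<and>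
      (\<exists>K :: 'n V \<Rightarrow> 'n V. linear K \<and> bij K \<and> (\<forall>v w. b1 p \<bullet> \<Theta> p v w = omega1 (K v) (K w) \<and>
        b2 p \<bullet> \<Theta> p v w = omega2 (K v) (K w) \<and> b3 p \<bullet> \<Theta> p v w = omega3 (K v) (K w)))"
    by (rule orbit_family_smooth_frame[OF O smooth orb]) blast
  let ?U = "fst ?c \<inter> snd ?c -` S'"
  have U: "open ?U" by (rule continuous_open_preimage[OF continuous_on_chart[OF cx(1)] open_chart[OF cx(1)] S'(1)])
  have UU: "y \<in> U" if "y \<in> ?U" for y
  proof -
    have "snd ?c y \<in> ?O" using that S'(3) by auto
    then show ?thesis using chart_image_iff[OF cx(1)] that by blast
  qed
  \<comment> \<open>These one-forms annihilate the distribution, so by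
    \<open>ext_deriv_annihilator\<close> the exterior derivative of \<open>\<eta> b\<close>
    restricted to it is b \<bullet> \<Theta>, whatever the smooth coefficient \<open>b\<close>
    is.\<close>
  define \<eta> :: "('e \<Rightarrow> W) \<Rightarrow> 'm \<Rightarrow> ('m, 'e) tvec \<Rightarrow> real" where "\<eta> b y v = b (snd ?c y) \<bullet> snd (inv (s y) v)" for b y v
  have smooth_\<eta>: "smooth_one_form_on A ?U (\<eta> b)" if b: "smooth_on b S'" for b
  proof (rule smooth_one_form_onI[OF U])
    fix c p assume c: "c \<in> A"
    let ?S = "snd c ` (fst c \<inter> ?U)"
    have S: "open ?S" by (rule open_chart_image[OF c U])
    have sub: "?S \<subseteq> snd c ` (fst c \<inter> U)" using UU by blast
    note f = smooth_one_form_onD[OF smooth_coframe c]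
    have eq: "local_form A (\<eta> b) c p = (\<lambda>\<xi>. b (change c ?c p) \<bullet> snd (local_form A (\<lambda>y. inv (s y)) c p \<xi>))" for p
      by (simp add: local_form_def[abs_def] \<eta>_def)
    show "linear (local_form A (\<eta> b) c p)" if "p \<in> ?S" for p
      unfolding eq using f(1)[OF subsetD[OF sub that]]
      by (intro linearI) (simp_all add: linear_add linear_scale inner_add_right)
    show "smooth_on (\<lambda>p. local_form A (\<eta> b) c p \<xi>) ?S" for \<xi>
      unfolding eq
    proof (rule smooth_on_inner[OF S _ smooth_on_compose_linear[OF S bounded_linear_snd smooth_on_subset[OF f(2) sub]]])
      show "smooth_on (\<lambda>p. b (change c ?c p)) ?S"
      proof (rule smooth_on_compose[OF S S'(1) _ _ b])
        show "change c ?c ` ?S \<subseteq> S'" using c by auto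
        show "smooth_on (change c ?c) ?S" by (rule smooth_on_subset[OF smooth_change[OF c cx(1)]]) auto
      qed
    qed
  qed
  have point: "qc_forms_at TYPE('n) A (associated_distribution P) (\<eta> b1) (\<eta> b2) (\<eta> b3) y" if y: "y \<in> ?U" for y
    unfolding qc_forms_at_def
  proof
    have yU: "y \<in> U" and yS: "snd ?c y \<in> S'" and yc: "y \<in> fst ?c" using y UU by auto
    note fr = framesD[OF frame[OF yU]]
    have D: "associated_distribution P y = range (\<lambda>v. s y (v, 0))"
      by (rule associated_distribution_section[OF s yU])
    have \<eta>s: "\<eta> b z (s z t) = b (snd ?c z) \<bullet> snd t" if "z \<in> U" for b z t
      unfolding \<eta>_def framesD(5)[OF frame[OF that]] ..
    show "associated_distribution P y = {v \<in> tangent_space A y. \<eta> b1 y v = 0 \<and> \<eta> b2 y v = 0 \<and> \<eta> b3 y v = 0}"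
    proof (intro equalityI subsetI)
      fix v assume "v \<in> {v \<in> tangent_space A y. \<eta> b1 y v = 0 \<and> \<eta> b2 y v = 0 \<and> \<eta> b3 y v = 0}"
      then have v: "v \<in> tangent_space A y" "\<eta> b1 y v = 0" "\<eta> b2 y v = 0" "\<eta> b3 y v = 0" by auto
      have "snd (inv (s y) v) = 0" using B yS v(2-4) unfolding \<eta>_def by blast
      then have "inv (s y) v = (fst (inv (s y) v), 0)" by (simp add: prod_eq_iff)
      then have "v = s y (fst (inv (s y) v), 0)" using fr(6)[OF v(1)] by metis
      then show "v \<in> associated_distribution P y" unfolding D by blast
    qed (use fr(4) \<eta>s[OF yU] D in auto)
    obtain K :: "'n V \<Rightarrow> 'n V" where K: "linear K" "bij K"
      "\<And>v w. b1 (snd ?c y) \<bullet> \<Theta> (snd ?c y) v w = omega1 (K v) (K w)"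
      "\<And>v w. b2 (snd ?c y) \<bullet> \<Theta> (snd ?c y) v w = omega2 (K v) (K w)"
      "\<And>v w. b3 (snd ?c y) \<bullet> \<Theta> (snd ?c y) v w = omega3 (K v) (K w)"
      using B yS by blast
    have \<Theta>y: "\<Theta> (snd ?c y) = intrinsic_torsion A P y (s y)" using cx(1) yc by (simp add: \<Theta>_def)
    have K': "linear (inv K)" "\<And>v. K (inv K v) = v" "bij (inv K)"
      using linear_inv_family[of UNIV "\<lambda>_. K"] K(1,2) by (auto simp: bij_def surj_f_inv_f bij_imp_bij_inv[unfolded bij_def])
    have ext: "ext_deriv A (\<eta> b) y (s y (inv K v, 0)) (s y (inv K w, 0)) = b (snd ?c y) \<bullet> \<Theta> (snd ?c y) (inv K v) (inv K w)"
      if "smooth_on b S'" for b v w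
    proof -
      have "\<eta> b z (s z (v, 0)) = 0" if "z \<in> U \<inter> ?U" for z v using \<eta>s[of z] that by simp
      from ext_deriv_annihilator[OF s smooth_\<eta>[OF that] yU y this] show ?thesis
        unfolding \<Theta>y \<eta>s[OF yU] by simp
    qed
    \<comment> \<open>The three forms b \<bullet> \<Theta> are the model forms pulled back by
      \<open>K\<close>; composing the frame with the inverse of \<open>K\<close> undoes this. The
      choice of \<open>K\<close> is made at the single point \<open>y\<close>.\<close>
    let ?u = "\<lambda>a. s y (inv K a, 0)"
    have "tlinear ?u"
      unfolding tlinear_def
    proof
      fix c
      have "linear (\<lambda>t. s y t c)" using fr(1) unfolding tlinear_def by blast
      moreover have "linear (\<lambda>a. (inv K a, 0))"
        by (rule linearI) (simp_all add: linear_add[OF K'(1)] linear_scale[OF K'(1)])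
      ultimately show "linear (\<lambda>a. ?u a c)" using linear_compose by (fastforce simp: comp_def)
    qed
    moreover have "bij_betw ?u UNIV (associated_distribution P y)"
    proof (rule bij_betw_imageI)
      show "inj ?u" by (rule injI) (metis K'(2) Pair_inject fr(2) injD)
      have "range ?u = (\<lambda>v. s y (v, 0)) ` range (inv K)" by auto
      also have "range (inv K) = UNIV" using K'(3) by (simp add: bij_def)
      finally show "range ?u = associated_distribution P y" unfolding D .
    qed
    ultimately show "\<exists>u :: 'n V \<Rightarrow> ('m, 'e) tvec. tlinear u \<and> bij_betw u UNIV (associated_distribution P y) \<and>
         (\<forall>a\<in>Basis. \<forall>b\<in>Basis.
            ext_deriv A (\<eta> b1) y (u a) (u b) = omega1 a b \<and>
            ext_deriv A (\<eta> b2) y (u a) (u b) = omega2 a b \<and>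
            ext_deriv A (\<eta> b3) y (u a) (u b) = omega3 a b)"
      by (intro exI[of _ ?u]) (simp add: ext[OF b(1)] ext[OF b(2)] ext[OF b(3)] K(3-5) K'(2))
  qed
  show "\<exists>U \<eta>1 \<eta>2 \<eta>3. x0 \<in> U \<and> smooth_one_form_on A U \<eta>1 \<and> smooth_one_form_on A U \<eta>2 \<and>
      smooth_one_form_on A U \<eta>3 \<and> (\<forall>x\<in>U. qc_forms_at TYPE('n) A (associated_distribution P) \<eta>1 \<eta>2 \<eta>3 x)"
  proof (rule exI[of _ ?U], rule exI[of _ "\<eta> b1"], rule exI[of _ "\<eta> b2"], rule exI[of _ "\<eta> b3"], intro conjI)
    show "x0 \<in> ?U" using S'(2) cx(2) by simp
  qed (rule smooth_\<eta>[OF b(1)] smooth_\<eta>[OF b(2)] smooth_\<eta>[OF b(3)] ballI[OF point], assumption?)+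
qed

end

theorem proposition3:
  fixes A :: "('m::{t2_space,second_countable_topology}, 'e::euclidean_space) chart set"
    and P :: "'m \<Rightarrow> ('n::finite T, 'm, 'e) frame set"
  assumes "smooth_atlas A"
    and "DIM('e) = 4 * CARD('n) + 3"
    and "G_structure A Q_group P"
  shows "(integrable_distribution TYPE('n V) A (associated_distribution P) \<longleftrightarrow>
           (\<forall>x. \<forall>u\<in>P x. intrinsic_torsion A P x u = (\<lambda>v w. 0))) \<and>
         (qc_structure TYPE('n) A (associated_distribution P) \<longleftrightarrow>
           (\<forall>x. \<forall>u\<in>P x. intrinsic_torsion A P x u \<in> Q_orbit qc_model))"
proof -
  interpret Q_structure A P by unfold_locales (rule assms)+
  show ?thesis
    using integrable_imp_torsion_free torsion_free_imp_integrable qc_imp_torsion_orbit torsion_orbit_imp_qc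
    by blast
qed

end
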